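(* Let $\mathcal G$ be a graph of groups with loose polynomial distortion and finitely generated vertex groups. If each vertex-group has the Rapid Decay property, then so does $\pi_1(\mathcal G)$.
   Context: Graphs of groups. A graph $\Gamma=(V,E)$ (finite, connected, not necessarily simplicial) has oriented edges $e$ with initial vertex $i(e)$, terminal vertex $t(e)$ and reversed edge $\bar e$. A graph of groups $\mathcal G=(\Gamma,\{G_e\},\{G_v\},\{\imath_e\})$ consists of such a graph, a finitely generated edge-group $G_e=G_{\bar e}$ for each oriented edge $e$, a finitely generated (discrete) vertex-group $G_v$ for each vertex $v$, and a monomorphism $\imath_e\colon G_e\to G_{t(e)}$ for each oriented edge $e$ (so $\imath_{\bar e}\colon G_e\to G_{i(e)}$). A $\mathcal G$-sequence from $v$ to $v'$ is $s=(g_0,e_1,g_1,\dots,e_k,g_k)$ with $k\ge0$ (its edge-length), $e_1\cdots e_k$ an edge-path in $\Gamma$ from $v$ to $v'$, $g_0\in G_v$ and $g_j\in G_{t(e_j)}$ for $j\ge1$; it is a $\mathcal G$-loop if $v=v'$. The relation $\sim$ on $\mathcal G$-sequences is generated by $(g,e,g')\sim(g\,\imath_{\bar e}(h),e,\imath_e(h^{-1})g')$ for $h\in G_e$ and $(g,e,1,\bar e,k)\sim(gk)$ (applied to subsequences); $[s]$ is the class of $s$. $\pi_1(\mathcal G)$ is the group, under concatenation, of classes of $\mathcal G$-loops based at a fixed vertex $v_0$ (independent of $v_0$ up to isomorphism). For $g\in G_v$ and a $\mathcal G$-loop $s$ at $v$, $[s]=g$ means $s\sim(g)$. Lengths. Fix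 finite generating sets of the vertex-groups, with word lengths $L_{G_v}$. For $s=(g_0,e_1,\dots,e_k,g_k)$ put $L_\Gamma(s)=k+\sum_{i=0}^kL(g_i)$, each $g_i$ being measured in its vertex-group. $\mathcal G$ has loose polynomial distortion if for some (hence any) such choice there is a polynomial $P$ such that for any vertex-group $G_v$, any $g\in G_v$ and any $\mathcal G$-loop $s$ with $[s]=g$, $L_{G_v}(g)\le P(L_\Gamma(s))$. Rapid Decay. For a group $G$, $\mathbb{R}^+G$ is the set of finitely supported functions $G\to\mathbb{R}^+$, $(f*g)(\gamma)=\sum_{\mu\in G}f(\mu)g(\mu^{-1}\gamma)$, and $\|\cdot\|_2$ is the $\ell^2$-norm. A finitely generated group $G$ with word length $L$ (for a finite generating set) has the Rapid Decay property if there is a polynomial $P$ such that for any $r>0$, any $f\in\mathbb{R}^+G$ with support in $B_L(r)=\{L\le r\}$ and any $g\in\mathbb{R}^+G$, $\|f*g\|_2\le P(r)\|f\|_2\|g\|_2$. *)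

theory Defs
  imports
    "Graph_Theory.Arc_Walk"
    "Graph_Theory.Digraph_Component"
    "Graph_Theory.Bidirected_Digraph"
    "HOL-Analysis.Infinite_Sum"
    "HOL-Computational_Algebra.Polynomial"
    "HOL-Algebra.Generated_Groups"
begin

section \<open>Finitely generated groups and word lengths\<close>

definition finite_generating_set :: "('a, 'm) monoid_scheme \<Rightarrow> 'a set \<Rightarrow> bool" where
  "finite_generating_set G S \<longleftrightarrow> finite S \<and> S \<subseteq> carrier G \<and> generate G S = carrier G"

definition finitely_generated_group :: "('a, 'm) monoid_scheme \<Rightarrow> bool" where
  "finitely_generated_group G \<longleftrightarrow> group G \<and> (\<exists>S. finite_generating_set G S)"

definition word_length :: "('a, 'm) monoid_scheme \<Rightarrow> 'a set \<Rightarrow> 'a \<Rightarrow> nat" where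
  "word_length G S g =
    (LEAST n. \<exists>w. length w = n \<and> set w \<subseteq> S \<union> m_inv G ` S \<and> foldr (mult G) w \<one>\<^bsub>G\<^esub> = g)"


section \<open>Rapid Decay\<close>

text \<open>Functions on the group are represented by functions on the type that vanish outside the
  carrier.\<close>

definition pos_group_ring :: "('a, 'm) monoid_scheme \<Rightarrow> ('a \<Rightarrow> real) set" where
  "pos_group_ring G = {f. finite {x. f x \<noteq> 0} \<and> {x. f x \<noteq> 0} \<subseteq> carrier G \<and> (\<forall>x. f x \<ge> 0)}"

definition convolution ::
    "('a, 'm) monoid_scheme \<Rightarrow> ('a \<Rightarrow> real) \<Rightarrow> ('a \<Rightarrow> real) \<Rightarrow> 'a \<Rightarrow> real" where
  "convolution G f g \<gamma> =
    (if \<gamma> \<in> carrier G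
     then (\<Sum>\<^sub>\<infinity>\<mu>\<in>carrier G. f \<mu> * g (inv\<^bsub>G\<^esub> \<mu> \<otimes>\<^bsub>G\<^esub> \<gamma>)) else 0)"

definition l2_norm :: "('a, 'm) monoid_scheme \<Rightarrow> ('a \<Rightarrow> real) \<Rightarrow> real" where
  "l2_norm G f = sqrt (\<Sum>\<^sub>\<infinity>x\<in>carrier G. (f x)\<^sup>2)"

definition rapid_decay :: "('a, 'm) monoid_scheme \<Rightarrow> bool" where
  "rapid_decay G \<longleftrightarrow> group G \<and>
    (\<exists>S. finite_generating_set G S \<and>
      (\<exists>P :: real poly. \<forall>r>0. \<forall>f\<in>pos_group_ring G. \<forall>g\<in>pos_group_ring G.
        {x. f x \<noteq> 0} \<subseteq> {x \<in> carrier G. real (word_length G S x) \<le> r} \<longrightarrow>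
        l2_norm G (convolution G f g) \<le> poly P r * l2_norm G f * l2_norm G g))"


section \<open>Graphs of groups\<close>

text \<open>
  Oriented edges are the arcs of a digraph: \<open>tail\<close> is the initial vertex, \<open>head\<close> the terminal
  vertex and \<open>rev_arc\<close> the orientation reversal. Loops and multiple edges are allowed.
  All vertex groups have their carriers in one type \<open>'a\<close>, all edge groups in one type \<open>'b\<close>;
  the carriers at different vertices (or edges) are unrelated and may overlap.
\<close>

record ('v, 'e, 'a, 'b) graph_of_groups =
  base_graph :: "('v, 'e) pre_digraph"
  rev_arc :: "'e \<Rightarrow> 'e"
  edge_group :: "'e \<Rightarrow> 'b monoid"
  vertex_group :: "'v \<Rightarrow> 'a monoid"
  edge_map :: "'e \<Rightarrow> 'b \<Rightarrow> 'a"

text \<open>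
  \<^const>\<open>bidirected_digraph\<close> says that \<open>rev_arc\<close> is an involution of the arcs without fixed points
  which exchanges \<open>tail\<close> and \<open>head\<close>; its clause \<open>a \<in> arcs \<longleftrightarrow> rev_arc a \<noteq> a\<close> also fixes the value
  of \<open>rev_arc\<close> outside the arcs, which is never used.
\<close>

locale graph_of_groups =
  fin_digraph "base_graph \<G>" + bidirected_digraph "base_graph \<G>" "rev_arc \<G>"
  for \<G> :: "('v, 'e, 'a, 'b) graph_of_groups" +
  assumes connected_base: "Digraph_Component.connected (base_graph \<G>)"
    and vertex_group_fg:
      "v \<in> verts (base_graph \<G>) \<Longrightarrow> finitely_generated_group (vertex_group \<G> v)"
    and edge_group_fg:
      "e \<in> arcs (base_graph \<G>) \<Longrightarrow> finitely_generated_group (edge_group \<G> e)"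
    and edge_group_rev:
      "e \<in> arcs (base_graph \<G>) \<Longrightarrow> edge_group \<G> (rev_arc \<G> e) = edge_group \<G> e"
    and edge_map_hom:
      "e \<in> arcs (base_graph \<G>) \<Longrightarrow>
        edge_map \<G> e \<in> hom (edge_group \<G> e) (vertex_group \<G> (head (base_graph \<G>) e))"
    and edge_map_inj:
      "e \<in> arcs (base_graph \<G>) \<Longrightarrow> inj_on (edge_map \<G> e) (carrier (edge_group \<G> e))"

text \<open>The sequence $(g_0, e_1, g_1, \dots, e_k, g_k)$ is represented by
  \<open>(g\<^sub>0, [(e\<^sub>1, g\<^sub>1), \<dots>, (e\<^sub>k, g\<^sub>k)])\<close>.\<close>

type_synonym ('a, 'e) gseq = "'a \<times> ('e \<times> 'a) list"

definition gseqs :: "('v, 'e, 'a, 'b) graph_of_groups \<Rightarrow> 'v \<Rightarrow> 'v \<Rightarrow> ('a, 'e) gseq set" where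
  "gseqs \<G> v v' =
    {(g, l). g \<in> carrier (vertex_group \<G> v) \<and>
             pre_digraph.awalk (base_graph \<G>) v (map fst l) v' \<and>
             (\<forall>(e, x)\<in>set l. x \<in> carrier (vertex_group \<G> (head (base_graph \<G>) e)))}"

text \<open>The two elementary moves, performed on the initial segment of a sequence (\<open>slide\<close>,
  \<open>cancel\<close>) or further along (\<open>later\<close>). Membership of the entries in the right groups is imposed
  in \<open>gseq_sim\<close> below.\<close>

inductive gseq_step ::
    "('v, 'e, 'a, 'b) graph_of_groups \<Rightarrow> ('a, 'e) gseq \<Rightarrow> ('a, 'e) gseq \<Rightarrow> bool"
  for \<G> where
  slide:
    "h \<in> carrier (edge_group \<G> e) \<Longrightarrow>
     gseq_step \<G>
       (g, (e, g') # l)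
       (g \<otimes>\<^bsub>vertex_group \<G> (tail (base_graph \<G>) e)\<^esub> edge_map \<G> (rev_arc \<G> e) h,
        (e, edge_map \<G> e (inv\<^bsub>edge_group \<G> e\<^esub> h)
              \<otimes>\<^bsub>vertex_group \<G> (head (base_graph \<G>) e)\<^esub> g') # l)"
| cancel:
    "gseq_step \<G>
       (g, (e, \<one>\<^bsub>vertex_group \<G> (head (base_graph \<G>) e)\<^esub>) # (rev_arc \<G> e, k) # l)
       (g \<otimes>\<^bsub>vertex_group \<G> (tail (base_graph \<G>) e)\<^esub> k, l)"
| later:
    "gseq_step \<G> (g, l) (g', l') \<Longrightarrow> gseq_step \<G> (x, (e, g) # l) (x, (e, g') # l')"

definition gseq_sim ::
    "('v, 'e, 'a, 'b) graph_of_groups \<Rightarrow> 'v \<Rightarrow> 'v \<Rightarrow> ('a, 'e) gseq rel" where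
  "gseq_sim \<G> v v' =
    {(s, t). s \<in> gseqs \<G> v v' \<and> t \<in> gseqs \<G> v v' \<and>
       equivclp (\<lambda>s t. s \<in> gseqs \<G> v v' \<and> t \<in> gseqs \<G> v v' \<and> gseq_step \<G> s t) s t}"

text \<open>Concatenation of a sequence ending at \<open>v\<close> with one starting at \<open>v\<close>; the two group elements
  that meet are multiplied in the group at \<open>v\<close>.\<close>

fun gseq_concat ::
    "('v, 'e, 'a, 'b) graph_of_groups \<Rightarrow> 'v \<Rightarrow> ('a, 'e) gseq \<Rightarrow> ('a, 'e) gseq \<Rightarrow> ('a, 'e) gseq" where
  "gseq_concat \<G> v (g, []) (g', l') = (g \<otimes>\<^bsub>vertex_group \<G> v\<^esub> g', l')"
| "gseq_concat \<G> v (g, (e, x) # l) t =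
    (let (y, m) = gseq_concat \<G> v (x, l) t in (g, (e, y) # m))"

definition pi1 :: "('v, 'e, 'a, 'b) graph_of_groups \<Rightarrow> 'v \<Rightarrow> ('a, 'e) gseq set monoid" where
  "pi1 \<G> v0 =
    \<lparr> carrier = gseqs \<G> v0 v0 // gseq_sim \<G> v0 v0,
      mult = (\<lambda>A B. \<Union>s\<in>A. \<Union>t\<in>B. gseq_sim \<G> v0 v0 `` {gseq_concat \<G> v0 s t}),
      one = gseq_sim \<G> v0 v0 `` {(\<one>\<^bsub>vertex_group \<G> v0\<^esub>, [])} \<rparr>"


section \<open>Loose polynomial distortion\<close>

text \<open>\<open>S v\<close> is the generating set of the group at \<open>v\<close>. The first argument of type \<open>'v\<close> is the
  initial vertex of the sequence, which determines the group in which \<open>g\<^sub>0\<close> is measured.\<close>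

fun gseq_length ::
    "('v, 'e, 'a, 'b) graph_of_groups \<Rightarrow> ('v \<Rightarrow> 'a set) \<Rightarrow> 'v \<Rightarrow> ('a, 'e) gseq \<Rightarrow> nat" where
  "gseq_length \<G> S v (g, l) =
    length l + (word_length (vertex_group \<G> v) (S v) g +
      (\<Sum>(e, x)\<leftarrow>l. word_length (vertex_group \<G> (head (base_graph \<G>) e))
                                (S (head (base_graph \<G>) e)) x))"

definition loose_polynomial_distortion :: "('v, 'e, 'a, 'b) graph_of_groups \<Rightarrow> bool" where
  "loose_polynomial_distortion \<G> \<longleftrightarrow>
    (\<exists>S. (\<forall>v\<in>verts (base_graph \<G>). finite_generating_set (vertex_group \<G> v) (S v)) \<and>
      (\<exists>P :: real poly. \<forall>v\<in>verts (base_graph \<G>). \<forall>g\<in>carrier (vertex_group \<G> v).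
        \<forall>s\<in>gseqs \<G> v v. (s, (g, [])) \<in> gseq_sim \<G> v v \<longrightarrow>
          real (word_length (vertex_group \<G> v) (S v) g) \<le> poly P (real (gseq_length \<G> S v s))))"

end

theory Submission
  imports Defs "HOL-Analysis.L2_Norm" "HOL-Analysis.Convex"
begin

text \<open>
  The fundamental group acts on the Bass--Serre tree, and the convolution of \<open>f\<close> and \<open>g\<close> is cut into
  pieces along this tree until each piece is a convolution in a vertex group. Let \<open>x\<^sub>0\<close> be the base
  vertex of the tree. For a product \<open>c = a b\<close> the points \<open>x\<^sub>0\<close>, \<open>a x\<^sub>0\<close> and \<open>c x\<^sub>0\<close> span a tripod; let
  \<open>y\<close> be its centre. If \<open>a\<close> has edge-length \<open>k\<close> and \<open>j\<close> of these edges cancel in the product, then \<open>y\<close>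
  is the vertex number \<open>k - j\<close> on the geodesic from \<open>x\<^sub>0\<close> to \<open>a x\<^sub>0\<close>, and also on the geodesic from
  \<open>x\<^sub>0\<close> to \<open>c x\<^sub>0\<close>. So, once \<open>k\<close> and \<open>j\<close> are fixed, the pair \<open>(y, c\<^sup>-\<^sup>1 y)\<close> is determined by \<open>c\<close>, the
  pair \<open>(y, a\<^sup>-\<^sup>1 y)\<close> by \<open>a\<close>, and the pair \<open>(a\<^sup>-\<^sup>1 y, c\<^sup>-\<^sup>1 y)\<close> by \<open>b\<close> (\<open>matching_vertices\<close>).

  These pairs cut \<open>f\<close>, \<open>g\<close> and the product into blocks. The elements \<open>a\<close> belonging to one pair lie in a
  set \<open>p\<^sup>-\<^sup>1 G\<^sub>u q\<close>, with sequences \<open>p\<close> and \<open>q\<close> from \<open>u\<close> to the base vertex (\<open>double_coset\<close>), and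
  \<open>p\<^sup>-\<^sup>1 s q\<close> times \<open>q\<^sup>-\<^sup>1 t r\<close> is \<open>p\<^sup>-\<^sup>1 s t r\<close>. The convolution of two blocks is therefore a convolution in
  \<open>G\<^sub>u\<close>, to which Rapid Decay of \<open>G\<^sub>u\<close> applies (\<open>block_bounded\<close>). The radius is under control: a
  sequence of length \<open>R\<close> that represents \<open>a\<close> passes through \<open>y\<close>, and its two parts before and after
  \<open>y\<close> show that \<open>p\<close> and \<open>q\<close> can be chosen of length at most \<open>R\<close> (\<open>short_vertex_paths\<close>); then
  \<open>t = p a q\<^sup>-\<^sup>1\<close> is represented by a loop of length at most \<open>3 R\<close>, and loose polynomial distortion
  bounds the word length of \<open>t\<close> in \<open>G\<^sub>u\<close>. The blocks are put together by the Cauchy--Schwarz inequality without any loss (\<open>conv_bounded_blocks\<close>),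
  and at most \<open>(R + 1)\<^sup>2\<close> pairs \<open>(k, j)\<close> occur (\<open>ball_bounded\<close>).

  The tree itself does not appear. Choosing coset representatives of the edge groups gives every
  sequence from \<open>u\<close> to \<open>v\<close> a unique normal form \<open>(g, l)\<close> (\<open>gseq_sim_iff_nf\<close>), and changing the sequence
  by left multiplication with an element of \<open>G\<^sub>u\<close> only changes \<open>g\<close>. The list \<open>l\<close> thus names a coset of
  \<open>G\<^sub>u\<close>, that is, a vertex of the tree. The geometry of the tree enters through two facts: a normal form
  acts on such a list like a stack machine that first pops and then pushes (\<open>act_stack\<close>), and a path
  cannot avoid a vertex that separates its endpoints (\<open>suffix_of_edges\<close>).
\<close>

section \<open>Convolution as a trilinear form\<close>

text \<open>The dual form of the bound \<open>M\<close> for the \<open>\<ell>\<^sup>2\<close>-norm of the convolution of a function supported in \<open>X\<close>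
  with one supported in \<open>Y\<close>: the convolution is tested against a third function \<open>h\<close>. It involves only
  finite sums, and the set \<open>T\<close> allows some of the products \<open>a b\<close> to be left out, which is what happens
  when a convolution is cut into pieces.\<close>

definition conv_bounded :: "('a, 'm) monoid_scheme \<Rightarrow> 'a set \<Rightarrow> 'a set \<Rightarrow> real \<Rightarrow> bool" where
  "conv_bounded G X Y M \<longleftrightarrow>
    (\<forall>A B C T. \<forall>f g h :: 'a \<Rightarrow> real.
      finite A \<and> A \<subseteq> X \<and> finite B \<and> B \<subseteq> Y \<and> finite C \<and> T \<subseteq> A \<times> B \<and>
      (\<forall>(a, b)\<in>T. a \<otimes>\<^bsub>G\<^esub> b \<in> C) \<and> (\<forall>x. 0 \<le> f x) \<and> (\<forall>x. 0 \<le> g x) \<and> (\<forall>x. 0 \<le> h x) \<longrightarrow>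
      (\<Sum>(a, b)\<in>T. f a * g b * h (a \<otimes>\<^bsub>G\<^esub> b)) \<le> M * (L2_set f A * L2_set g B * L2_set h C))"

lemma conv_boundedI:
  assumes "\<And>A B C T (f :: 'a \<Rightarrow> real) g h. \<lbrakk>finite A; A \<subseteq> X; finite B; B \<subseteq> Y; finite C; T \<subseteq> A \<times> B;
      \<And>a b. (a, b) \<in> T \<Longrightarrow> a \<otimes>\<^bsub>G\<^esub> b \<in> C; \<And>x. 0 \<le> f x; \<And>x. 0 \<le> g x; \<And>x. 0 \<le> h x\<rbrakk> \<Longrightarrow>
      (\<Sum>(a, b)\<in>T. f a * g b * h (a \<otimes>\<^bsub>G\<^esub> b)) \<le> M * (L2_set f A * L2_set g B * L2_set h C)"
  shows "conv_bounded G X Y M"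
  unfolding conv_bounded_def by (intro allI impI) (rule assms; auto)

lemma conv_boundedD:
  fixes f g h :: "'a \<Rightarrow> real"
  assumes "conv_bounded G X Y M" "finite A" "A \<subseteq> X" "finite B" "B \<subseteq> Y" "finite C" "T \<subseteq> A \<times> B"
    "\<And>a b. (a, b) \<in> T \<Longrightarrow> a \<otimes>\<^bsub>G\<^esub> b \<in> C" "\<And>x. 0 \<le> f x" "\<And>x. 0 \<le> g x" "\<And>x. 0 \<le> h x"
  shows "(\<Sum>(a, b)\<in>T. f a * g b * h (a \<otimes>\<^bsub>G\<^esub> b)) \<le> M * (L2_set f A * L2_set g B * L2_set h C)"
  using assms(1)[unfolded conv_bounded_def, THEN spec[of _ A], THEN spec[of _ B], THEN spec[of _ C],
      THEN spec[of _ T], THEN spec[of _ f], THEN spec[of _ g], THEN spec[of _ h]] assms(2-) by blast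

lemma conv_bounded_mono:
  assumes "conv_bounded G X Y M" "X' \<subseteq> X" "Y' \<subseteq> Y" "M \<le> M'"
  shows "conv_bounded G X' Y' M'"
proof (rule conv_boundedI)
  fix A B C T and f g h :: "'a \<Rightarrow> real"
  assume *: "finite A" "A \<subseteq> X'" "finite B" "B \<subseteq> Y'" "finite C" "T \<subseteq> A \<times> B"
    "\<And>a b. (a, b) \<in> T \<Longrightarrow> a \<otimes>\<^bsub>G\<^esub> b \<in> C" "\<And>x. 0 \<le> f x" "\<And>x. 0 \<le> g x" "\<And>x. 0 \<le> h x"
  have "(\<Sum>(a, b)\<in>T. f a * g b * h (a \<otimes>\<^bsub>G\<^esub> b)) \<le> M * (L2_set f A * L2_set g B * L2_set h C)"
    using * assms(2,3) by (intro conv_boundedD[OF assms(1)]) auto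
  also have "\<dots> \<le> M' * (L2_set f A * L2_set g B * L2_set h C)"
    using assms(4) by (intro mult_right_mono) (auto intro!: mult_nonneg_nonneg L2_set_nonneg)
  finally show "(\<Sum>(a, b)\<in>T. f a * g b * h (a \<otimes>\<^bsub>G\<^esub> b)) \<le> M' * (L2_set f A * L2_set g B * L2_set h C)" .
qed

lemma conv_bounded_empty:
  fixes G :: "('x, 'm) monoid_scheme"
  assumes "X = {} \<or> Y = {}" "0 \<le> M"
  shows "conv_bounded G X Y M"
proof (rule conv_boundedI)
  fix A B C T and f g h :: "'x \<Rightarrow> real"
  assume "A \<subseteq> X" "B \<subseteq> Y" "T \<subseteq> A \<times> B"
  then have "T = {}" using assms by auto
  then show "(\<Sum>(a, b)\<in>T. f a * g b * h (a \<otimes>\<^bsub>G\<^esub> b)) \<le> M * (L2_set f A * L2_set g B * L2_set h C)"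
    using assms(2) by (auto intro!: mult_nonneg_nonneg L2_set_nonneg)
qed

lemma l2_norm_eq_L2_set:
  assumes "finite A" "A \<subseteq> carrier G" "\<And>x. x \<in> carrier G \<Longrightarrow> x \<notin> A \<Longrightarrow> f x = 0"
  shows "l2_norm G f = L2_set f A"
proof -
  have "(\<Sum>\<^sub>\<infinity>x\<in>carrier G. (f x)\<^sup>2) = (\<Sum>\<^sub>\<infinity>x\<in>A. (f x)\<^sup>2)"
    using assms by (intro infsum_cong_neutral) auto
  then show ?thesis using assms(1) by (simp add: l2_norm_def L2_set_def)
qed

lemma convolution_eq_sum:
  assumes "finite A" "A \<subseteq> carrier G" "\<And>x. x \<in> carrier G \<Longrightarrow> x \<notin> A \<Longrightarrow> f x = 0" "c \<in> carrier G"
  shows "convolution G f g c = (\<Sum>a\<in>A. f a * g (inv\<^bsub>G\<^esub> a \<otimes>\<^bsub>G\<^esub> c))"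
proof -
  have "(\<Sum>\<^sub>\<infinity>x\<in>carrier G. f x * g (inv\<^bsub>G\<^esub> x \<otimes>\<^bsub>G\<^esub> c)) = (\<Sum>\<^sub>\<infinity>x\<in>A. f x * g (inv\<^bsub>G\<^esub> x \<otimes>\<^bsub>G\<^esub> c))"
    using assms by (intro infsum_cong_neutral) auto
  then show ?thesis using assms(1,4) by (simp add: convolution_def)
qed

text \<open>Substituting \<open>c = a b\<close> turns the pairing of a convolution with \<open>h\<close> into a sum over pairs.\<close>

lemma convolution_dual_pairing:
  fixes f g h :: "'a \<Rightarrow> real"
  assumes "group G" and A: "finite A" "A \<subseteq> carrier G" and B: "finite B" "B \<subseteq> carrier G"
    and C: "finite C" "C \<subseteq> carrier G" "\<And>a b. a \<in> A \<Longrightarrow> b \<in> B \<Longrightarrow> a \<otimes>\<^bsub>G\<^esub> b \<in> C"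
    and f: "\<And>x. x \<in> carrier G \<Longrightarrow> x \<notin> A \<Longrightarrow> f x = 0" and g: "\<And>x. x \<in> carrier G \<Longrightarrow> x \<notin> B \<Longrightarrow> g x = 0"
  shows "(\<Sum>c\<in>C. convolution G f g c * h c) = (\<Sum>(a, b)\<in>A \<times> B. f a * g b * h (a \<otimes>\<^bsub>G\<^esub> b))"
proof -
  interpret group G by fact
  have "(\<Sum>c\<in>C. convolution G f g c * h c) = (\<Sum>c\<in>C. \<Sum>a\<in>A. f a * g (inv\<^bsub>G\<^esub> a \<otimes>\<^bsub>G\<^esub> c) * h c)"
    using A C f by (intro sum.cong) (auto simp: convolution_eq_sum[where A=A] sum_distrib_right)
  also have "\<dots> = (\<Sum>a\<in>A. \<Sum>c\<in>C. f a * g (inv\<^bsub>G\<^esub> a \<otimes>\<^bsub>G\<^esub> c) * h c)"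
    by (rule sum.swap)
  also have "\<dots> = (\<Sum>a\<in>A. \<Sum>b\<in>B. f a * g b * h (a \<otimes>\<^bsub>G\<^esub> b))"
  proof (rule sum.cong[OF refl])
    fix a assume a: "a \<in> A"
    then have ac: "a \<in> carrier G" using A by auto
    have "(\<Sum>b\<in>B. f a * g b * h (a \<otimes>\<^bsub>G\<^esub> b))
        = (\<Sum>c\<in>(\<lambda>b. a \<otimes>\<^bsub>G\<^esub> b) ` B. f a * g (inv\<^bsub>G\<^esub> a \<otimes>\<^bsub>G\<^esub> c) * h c)"
    proof (subst sum.reindex)
      show "inj_on (\<lambda>b. a \<otimes>\<^bsub>G\<^esub> b) B" using B ac by (intro inj_onI) (metis Units_eq Units_l_cancel subsetD)
      show "(\<Sum>b\<in>B. f a * g b * h (a \<otimes>\<^bsub>G\<^esub> b)) =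
        sum ((\<lambda>c. f a * g (inv\<^bsub>G\<^esub> a \<otimes>\<^bsub>G\<^esub> c) * h c) \<circ> (\<lambda>b. a \<otimes>\<^bsub>G\<^esub> b)) B"
        using B ac by (intro sum.cong) (auto simp: m_assoc[symmetric] subset_iff)
    qed
    also have "\<dots> = (\<Sum>c\<in>C. f a * g (inv\<^bsub>G\<^esub> a \<otimes>\<^bsub>G\<^esub> c) * h c)"
    proof (rule sum.mono_neutral_left)
      show "\<forall>c\<in>C - (\<lambda>b. a \<otimes>\<^bsub>G\<^esub> b) ` B. f a * g (inv\<^bsub>G\<^esub> a \<otimes>\<^bsub>G\<^esub> c) * h c = 0"
      proof
        fix c assume c: "c \<in> C - (\<lambda>b. a \<otimes>\<^bsub>G\<^esub> b) ` B"
        then have cc: "c \<in> carrier G" using C by auto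
        have "c = a \<otimes>\<^bsub>G\<^esub> (inv\<^bsub>G\<^esub> a \<otimes>\<^bsub>G\<^esub> c)" using ac cc by (simp add: m_assoc[symmetric])
        then have "inv\<^bsub>G\<^esub> a \<otimes>\<^bsub>G\<^esub> c \<notin> B" using c by auto
        then show "f a * g (inv\<^bsub>G\<^esub> a \<otimes>\<^bsub>G\<^esub> c) * h c = 0" using g ac cc by simp
      qed
    qed (use C a in auto)
    finally show "(\<Sum>c\<in>C. f a * g (inv\<^bsub>G\<^esub> a \<otimes>\<^bsub>G\<^esub> c) * h c) = (\<Sum>b\<in>B. f a * g b * h (a \<otimes>\<^bsub>G\<^esub> b))" ..
  qed
  also have "\<dots> = (\<Sum>(a, b)\<in>A \<times> B. f a * g b * h (a \<otimes>\<^bsub>G\<^esub> b))"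
    by (rule sum.cartesian_product)
  finally show ?thesis .
qed

lemma convolution_nonneg:
  assumes "\<And>x. 0 \<le> f x" "\<And>x. 0 \<le> g x"
  shows "0 \<le> convolution G f g c"
  using assms by (auto simp: convolution_def intro!: infsum_nonneg)

lemma convolution_support:
  assumes "group G" "finite A" "A \<subseteq> carrier G" "finite B" "B \<subseteq> carrier G"
    and f: "\<And>x. x \<in> carrier G \<Longrightarrow> x \<notin> A \<Longrightarrow> f x = 0" and g: "\<And>x. x \<in> carrier G \<Longrightarrow> x \<notin> B \<Longrightarrow> g x = 0"
    and c: "c \<notin> (\<lambda>(a, b). a \<otimes>\<^bsub>G\<^esub> b) ` (A \<times> B)"
  shows "convolution G f g c = 0"
proof (cases "c \<in> carrier G")
  case True
  interpret group G by fact
  have "f a * g (inv\<^bsub>G\<^esub> a \<otimes>\<^bsub>G\<^esub> c) = 0" if "a \<in> A" for a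
  proof -
    have ac: "a \<in> carrier G" using that assms by auto
    have "c = a \<otimes>\<^bsub>G\<^esub> (inv\<^bsub>G\<^esub> a \<otimes>\<^bsub>G\<^esub> c)" using ac True by (simp add: m_assoc[symmetric])
    then have "inv\<^bsub>G\<^esub> a \<otimes>\<^bsub>G\<^esub> c \<notin> B" using c that by force
    then show ?thesis using g ac True by simp
  qed
  then have "(\<Sum>a\<in>A. f a * g (inv\<^bsub>G\<^esub> a \<otimes>\<^bsub>G\<^esub> c)) = 0" by (intro sum.neutral ballI)
  then show ?thesis using convolution_eq_sum[of A G f c g] assms(2,3) f True by simp
qed (simp add: convolution_def)

lemma conv_bounded_of_l2_norm_bound:
  fixes G :: "('a, 'm) monoid_scheme"
  assumes "group G" and X: "X \<subseteq> carrier G"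
    and bound: "\<And>f g. \<lbrakk>f \<in> pos_group_ring G; g \<in> pos_group_ring G; {x. f x \<noteq> 0} \<subseteq> X\<rbrakk> \<Longrightarrow>
      l2_norm G (convolution G f g) \<le> M * l2_norm G f * l2_norm G g"
  shows "conv_bounded G X (carrier G) M"
proof (rule conv_boundedI)
  fix A B C T and f g h :: "'a \<Rightarrow> real"
  assume A: "finite A" "A \<subseteq> X" and B: "finite B" "B \<subseteq> carrier G" and C: "finite C" and T: "T \<subseteq> A \<times> B"
    and TC: "\<And>a b. (a, b) \<in> T \<Longrightarrow> a \<otimes>\<^bsub>G\<^esub> b \<in> C"
    and pos: "\<And>x. 0 \<le> f x" "\<And>x. 0 \<le> g x" "\<And>x. 0 \<le> h x"
  interpret group G by fact
  define f' g' h' where "f' = (\<lambda>x. if x \<in> A then f x else 0)" and "g' = (\<lambda>x. if x \<in> B then g x else 0)"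
    and "h' = (\<lambda>x. if x \<in> C then h x else 0)"
  define D where "D = (\<lambda>(a, b). a \<otimes>\<^bsub>G\<^esub> b) ` (A \<times> B)"
  have Ac: "A \<subseteq> carrier G" using A X by auto
  have D: "finite D" "D \<subseteq> carrier G" using A B Ac by (auto simp: D_def)
  have f': "f' \<in> pos_group_ring G" "{x. f' x \<noteq> 0} \<subseteq> X" and g': "g' \<in> pos_group_ring G"
    using A B Ac pos by (auto simp: pos_group_ring_def f'_def g'_def)
  have "(\<Sum>(a, b)\<in>T. f a * g b * h (a \<otimes>\<^bsub>G\<^esub> b)) = (\<Sum>(a, b)\<in>T. f' a * g' b * h' (a \<otimes>\<^bsub>G\<^esub> b))"
    using T TC by (intro sum.cong) (auto simp: f'_def g'_def h'_def)
  also have "\<dots> \<le> (\<Sum>(a, b)\<in>A \<times> B. f' a * g' b * h' (a \<otimes>\<^bsub>G\<^esub> b))"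
    using A B T pos by (intro sum_mono2) (auto simp: f'_def g'_def h'_def)
  also have "\<dots> = (\<Sum>c\<in>D. convolution G f' g' c * h' c)"
    using A Ac B D by (intro convolution_dual_pairing[symmetric]) (auto simp: D_def f'_def g'_def)
  also have "\<dots> \<le> (\<Sum>c\<in>D. \<bar>convolution G f' g' c\<bar> * \<bar>h' c\<bar>)"
    by (rule sum_mono) (simp only: abs_mult[symmetric] abs_ge_self)
  also have "\<dots> \<le> L2_set (convolution G f' g') D * L2_set h' D"
    by (rule L2_set_mult_ineq)
  also have "L2_set (convolution G f' g') D = l2_norm G (convolution G f' g')"
    using D A Ac B by (intro l2_norm_eq_L2_set[symmetric])
      (auto simp: D_def f'_def g'_def intro!: convolution_support[where A=A and B=B])
  also have "l2_norm G (convolution G f' g') * L2_set h' D \<le> (M * l2_norm G f' * l2_norm G g') * L2_set h C"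
  proof (rule mult_mono)
    show *: "l2_norm G (convolution G f' g') \<le> M * l2_norm G f' * l2_norm G g'"
      using f' g' by (intro bound)
    have "0 \<le> l2_norm G (convolution G f' g')"
      by (simp add: l2_norm_def infsum_nonneg)
    then show "0 \<le> M * l2_norm G f' * l2_norm G g'" using * by linarith
    have "(\<Sum>x\<in>D. (h' x)\<^sup>2) = (\<Sum>x\<in>D \<inter> C. (h x)\<^sup>2)"
      unfolding h'_def using D(1) by (intro sum.mono_neutral_cong_right) auto
    also have "\<dots> \<le> (\<Sum>x\<in>C. (h x)\<^sup>2)"
      using C by (intro sum_mono2) auto
    finally show "L2_set h' D \<le> L2_set h C" by (simp add: L2_set_def)
  qed (rule L2_set_nonneg)
  also have "l2_norm G f' = L2_set f A"
    using A Ac by (subst l2_norm_eq_L2_set[where A=A]) (auto simp: f'_def L2_set_def)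
  also have "l2_norm G g' = L2_set g B"
    using B by (subst l2_norm_eq_L2_set[where A=B]) (auto simp: g'_def L2_set_def)
  finally show "(\<Sum>(a, b)\<in>T. f a * g b * h (a \<otimes>\<^bsub>G\<^esub> b)) \<le> M * (L2_set f A * L2_set g B * L2_set h C)"
    by (simp add: mult.assoc)
qed

text \<open>Testing the convolution against itself gives back the bound for its norm.\<close>

lemma l2_norm_bound_of_conv_bounded:
  assumes "group G" and bd: "conv_bounded G X (carrier G) M" and "0 \<le> M"
    and f: "f \<in> pos_group_ring G" "{x. f x \<noteq> 0} \<subseteq> X" and g: "g \<in> pos_group_ring G"
  shows "l2_norm G (convolution G f g) \<le> M * l2_norm G f * l2_norm G g"
proof -
  interpret group G by fact
  define A B D where "A = {x. f x \<noteq> 0}" and "B = {x. g x \<noteq> 0}" and "D = (\<lambda>(a, b). a \<otimes>\<^bsub>G\<^esub> b) ` (A \<times> B)"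
  have A: "finite A" "A \<subseteq> carrier G" "A \<subseteq> X" and B: "finite B" "B \<subseteq> carrier G"
    and pos: "\<And>x. 0 \<le> f x" "\<And>x. 0 \<le> g x"
    using f g by (auto simp: A_def B_def pos_group_ring_def)
  have D: "finite D" "D \<subseteq> carrier G" using A B by (auto simp: D_def)
  let ?h = "convolution G f g" 
  have norms: "l2_norm G ?h = L2_set ?h D" "l2_norm G f = L2_set f A" "l2_norm G g = L2_set g B"
    using A B D by (auto intro!: l2_norm_eq_L2_set convolution_support[where A=A and B=B] simp: A_def B_def D_def)
  have "(L2_set ?h D)\<^sup>2 = (\<Sum>c\<in>D. ?h c * ?h c)"
    by (simp add: L2_set_def sum_nonneg power2_eq_square)
  also have "\<dots> = (\<Sum>(a, b)\<in>A \<times> B. f a * g b * ?h (a \<otimes>\<^bsub>G\<^esub> b))"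
    using A B D by (intro convolution_dual_pairing) (auto simp: D_def A_def B_def)
  also have "\<dots> \<le> M * (L2_set f A * L2_set g B * L2_set ?h D)"
    using A B D pos by (intro conv_boundedD[OF bd]) (auto simp: D_def intro!: convolution_nonneg)
  finally have *: "L2_set ?h D * L2_set ?h D \<le> (M * L2_set f A * L2_set g B) * L2_set ?h D"
    by (simp add: power2_eq_square mult.assoc)
  have "L2_set ?h D \<le> M * L2_set f A * L2_set g B"
  proof (cases "L2_set ?h D = 0")
    case True
    then show ?thesis using \<open>0 \<le> M\<close> by (auto intro!: mult_nonneg_nonneg L2_set_nonneg)
  next
    case False
    then have "0 < L2_set ?h D" using L2_set_nonneg[of ?h D] by linarith
    then show ?thesis using * by (simp add: mult_le_cancel_right)
  qed
  then show ?thesis by (simp add: norms)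
qed

text \<open>For matrices \<open>x\<close>, \<open>y\<close>, \<open>z\<close> this bounds the trace of \<open>x y z\<^sup>T\<close> by the product of the three
  Hilbert--Schmidt norms; it holds because that norm is
  submultiplicative and because the Cauchy--Schwarz inequality bounds the trace of \<open>(x y) z\<^sup>T\<close>.\<close>

lemma Cauchy_Schwarz_triple:
  fixes x :: "'i \<Rightarrow> 'j \<Rightarrow> real" and y :: "'j \<Rightarrow> 'k \<Rightarrow> real" and z :: "'i \<Rightarrow> 'k \<Rightarrow> real"
  shows "(\<Sum>p\<in>P. \<Sum>q\<in>Q. \<Sum>r\<in>R. x p q * y q r * z p r)
    \<le> L2_set (\<lambda>(p, q). x p q) (P \<times> Q) * L2_set (\<lambda>(q, r). y q r) (Q \<times> R) * L2_set (\<lambda>(p, r). z p r) (P \<times> R)"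
proof -
  let ?w = "\<lambda>(p, r). \<Sum>q\<in>Q. x p q * y q r"
  have "(\<Sum>p\<in>P. \<Sum>q\<in>Q. \<Sum>r\<in>R. x p q * y q r * z p r) = (\<Sum>p\<in>P. \<Sum>r\<in>R. (\<Sum>q\<in>Q. x p q * y q r) * z p r)"
    by (intro sum.cong refl) (subst sum.swap, simp add: sum_distrib_right)
  also have "\<dots> = (\<Sum>t\<in>P \<times> R. ?w t * (\<lambda>(p, r). z p r) t)"
    by (subst sum.cartesian_product) (simp add: split_def)
  also have "\<dots> \<le> (\<Sum>t\<in>P \<times> R. \<bar>?w t\<bar> * \<bar>(\<lambda>(p, r). z p r) t\<bar>)"
    by (rule sum_mono) (simp only: abs_mult[symmetric] abs_ge_self)
  also have "\<dots> \<le> L2_set ?w (P \<times> R) * L2_set (\<lambda>(p, r). z p r) (P \<times> R)"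
    by (rule L2_set_mult_ineq)
  also have "L2_set ?w (P \<times> R) \<le> L2_set (\<lambda>(p, q). x p q) (P \<times> Q) * L2_set (\<lambda>(q, r). y q r) (Q \<times> R)"
  proof -
    have "(\<Sum>t\<in>P \<times> R. (?w t)\<^sup>2) = (\<Sum>p\<in>P. \<Sum>r\<in>R. (\<Sum>q\<in>Q. x p q * y q r)\<^sup>2)"
      by (subst sum.cartesian_product) (simp add: split_def)
    also have "\<dots> \<le> (\<Sum>p\<in>P. \<Sum>r\<in>R. (\<Sum>q\<in>Q. (x p q)\<^sup>2) * (\<Sum>q\<in>Q. (y q r)\<^sup>2))"
      by (intro sum_mono Cauchy_Schwarz_ineq_sum)
    also have "\<dots> = (\<Sum>p\<in>P. \<Sum>q\<in>Q. (x p q)\<^sup>2) * (\<Sum>r\<in>R. \<Sum>q\<in>Q. (y q r)\<^sup>2)"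
      by (rule sum_product[symmetric])
    also have "(\<Sum>r\<in>R. \<Sum>q\<in>Q. (y q r)\<^sup>2) = (\<Sum>q\<in>Q. \<Sum>r\<in>R. (y q r)\<^sup>2)"
      by (rule sum.swap)
    finally have *: "(\<Sum>t\<in>P \<times> R. (?w t)\<^sup>2) \<le> (\<Sum>t\<in>P \<times> Q. (case t of (p, q) \<Rightarrow> x p q)\<^sup>2) *
        (\<Sum>t\<in>Q \<times> R. (case t of (q, r) \<Rightarrow> y q r)\<^sup>2)"
      by (simp add: sum.cartesian_product case_prod_unfold)
    show ?thesis
      unfolding L2_set_def real_sqrt_mult[symmetric] using * by (rule real_sqrt_le_mono)
  qed
  finally show ?thesis by (simp add: mult_right_mono L2_set_nonneg)
qed

text \<open>The blocks of a function, labelled by two indices, form a matrix of norms whose Hilbert--Schmidt norm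
  is the norm of the function.\<close>

lemma L2_set_partition:
  assumes "finite A" "finite I" "finite J" "\<And>a. a \<in> A \<Longrightarrow> i a \<in> I" "\<And>a. a \<in> A \<Longrightarrow> j a \<in> J"
  shows "L2_set (\<lambda>(p, q). L2_set f {a \<in> A. i a = p \<and> j a = q}) (I \<times> J) = L2_set f A"
proof -
  have "(\<Sum>t\<in>I \<times> J. (L2_set f {a \<in> A. i a = fst t \<and> j a = snd t})\<^sup>2) =
        (\<Sum>t\<in>I \<times> J. \<Sum>a\<in>{a \<in> A. (i a, j a) = t}. (f a)\<^sup>2)"
    by (intro sum.cong refl) (auto simp: L2_set_def sum_nonneg prod_eq_iff)
  also have "\<dots> = (\<Sum>a\<in>A. (f a)\<^sup>2)"
    using assms by (intro sum.group) auto
  finally show ?thesis by (simp add: L2_set_def[of _ "I \<times> J"] L2_set_def[of f A] case_prod_unfold)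
qed

lemma L2_set_partition_le:
  assumes "finite A" "finite I" "finite J"
  shows "L2_set (\<lambda>(p, q). L2_set f {a \<in> A. i a = p \<and> j a = q}) (I \<times> J) \<le> L2_set f A"
proof -
  let ?A = "{a \<in> A. i a \<in> I \<and> j a \<in> J}"
  have "L2_set (\<lambda>(p, q). L2_set f {a \<in> A. i a = p \<and> j a = q}) (I \<times> J)
      = L2_set (\<lambda>(p, q). L2_set f {a \<in> ?A. i a = p \<and> j a = q}) (I \<times> J)"
    by (rule L2_set_cong[OF refl]) (auto simp: conj_commute intro!: arg_cong[of _ _ "L2_set f"])
  also have "\<dots> = L2_set f ?A" using assms by (intro L2_set_partition) auto
  also have "\<dots> \<le> L2_set f A" unfolding L2_set_def using assms
    by (auto intro!: sum_mono2)
  finally show ?thesis .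
qed

text \<open>A pair in \<open>T\<close> meets the block \<open>(p, q)\<close> of \<open>f\<close>, the block \<open>(q, r)\<close> of \<open>g\<close> and the block \<open>(p, r)\<close> of
  \<open>h\<close>. The sum over \<open>T\<close> is thus at most \<open>M\<close> times a sum over \<open>p\<close>, \<open>q\<close>, \<open>r\<close> of products of three block
  norms, and by the Cauchy--Schwarz inequality for three matrices the constant of the single blocks is
  also one for their union.\<close>

lemma conv_bounded_blocks:
  fixes f g h :: "'a \<Rightarrow> real" and lam1 :: "'a \<Rightarrow> 'i" and rho1 lam2 :: "'a \<Rightarrow> 'j" and rho2 :: "'a \<Rightarrow> 'k"
  assumes blocks: "\<And>p q r. conv_bounded G {a \<in> X. lam1 a = p \<and> rho1 a = q} {b \<in> Y. lam2 b = q \<and> rho2 b = r} M"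
    and "0 \<le> M"
    and A: "finite A" "A \<subseteq> X" and B: "finite B" "B \<subseteq> Y" and C: "finite C" and T: "T \<subseteq> A \<times> B"
    and TC: "\<And>a b. (a, b) \<in> T \<Longrightarrow> a \<otimes>\<^bsub>G\<^esub> b \<in> C"
    and pos: "\<And>x. 0 \<le> f x" "\<And>x. 0 \<le> g x" "\<And>x. 0 \<le> h x"
    and match: "\<And>a b. (a, b) \<in> T \<Longrightarrow> rho1 a = lam2 b"
      "\<And>a b. (a, b) \<in> T \<Longrightarrow> lam3 (a \<otimes>\<^bsub>G\<^esub> b) = lam1 a" "\<And>a b. (a, b) \<in> T \<Longrightarrow> rho3 (a \<otimes>\<^bsub>G\<^esub> b) = rho2 b"
  shows "(\<Sum>(a, b)\<in>T. f a * g b * h (a \<otimes>\<^bsub>G\<^esub> b)) \<le> M * (L2_set f A * L2_set g B * L2_set h C)"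
proof -
  define P Q R where "P = lam1 ` A" and "Q = rho1 ` A" and "R = rho2 ` B"
  have fin: "finite P" "finite Q" "finite R" using A B by (auto simp: P_def Q_def R_def)
  have finT: "finite T" using A B T by (meson finite_SigmaI finite_subset)
  define x where "x p q = L2_set f {a \<in> A. lam1 a = p \<and> rho1 a = q}" for p q
  define y where "y q r = L2_set g {b \<in> B. lam2 b = q \<and> rho2 b = r}" for q r
  define z where "z p r = L2_set h {c \<in> C. lam3 c = p \<and> rho3 c = r}" for p r
  let ?F = "\<lambda>(a, b). f a * g b * h (a \<otimes>\<^bsub>G\<^esub> b)"
  let ?t = "\<lambda>(a, b). (lam1 a, rho1 a, rho2 b)"
  have "sum ?F T = (\<Sum>t\<in>P \<times> Q \<times> R. sum ?F {s \<in> T. ?t s = t})"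
    using T fin finT by (intro sum.group[symmetric]) (auto simp: P_def Q_def R_def)
  also have "\<dots> \<le> (\<Sum>(p, q, r)\<in>P \<times> Q \<times> R. M * (x p q * y q r * z p r))"
  proof (rule sum_mono)
    fix t assume "t \<in> P \<times> Q \<times> R"
    obtain p q r where t: "t = (p, q, r)" by (cases t)
    show "sum ?F {s \<in> T. ?t s = t} \<le> (case t of (p, q, r) \<Rightarrow> M * (x p q * y q r * z p r))"
      unfolding t x_def y_def z_def prod.case
    proof (rule conv_boundedD[OF blocks[of p q r]])
      show "{s \<in> T. ?t s = (p, q, r)} \<subseteq> {a \<in> A. lam1 a = p \<and> rho1 a = q} \<times> {b \<in> B. lam2 b = q \<and> rho2 b = r}"
        using T match(1) by auto
      show "a \<otimes>\<^bsub>G\<^esub> b \<in> {c \<in> C. lam3 c = p \<and> rho3 c = r}" if "(a, b) \<in> {s \<in> T. ?t s = (p, q, r)}" for a b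
        using that TC match(2,3) by auto
    qed (use A B C pos in auto)
  qed
  also have "\<dots> = M * (\<Sum>p\<in>P. \<Sum>q\<in>Q. \<Sum>r\<in>R. x p q * y q r * z p r)"
    by (simp only: sum.cartesian_product[symmetric] sum_distrib_left)
  also have "\<dots> \<le> M * (L2_set (\<lambda>(p, q). x p q) (P \<times> Q) * L2_set (\<lambda>(q, r). y q r) (Q \<times> R) * L2_set (\<lambda>(p, r). z p r) (P \<times> R))"
    using \<open>0 \<le> M\<close> by (intro mult_left_mono Cauchy_Schwarz_triple)
  also have "\<dots> \<le> M * (L2_set f A * L2_set g B * L2_set h C)"
  proof -
    have "L2_set (\<lambda>(p, q). x p q) (P \<times> Q) \<le> L2_set f A" "L2_set (\<lambda>(q, r). y q r) (Q \<times> R) \<le> L2_set g B"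
      "L2_set (\<lambda>(p, r). z p r) (P \<times> R) \<le> L2_set h C"
      unfolding x_def y_def z_def using A(1) B(1) C fin by (simp_all add: L2_set_partition_le)
    then show ?thesis using \<open>0 \<le> M\<close>
      by (intro mult_left_mono mult_mono) (simp_all add: L2_set_nonneg)
  qed
  finally show ?thesis .
qed

text \<open>Applied below to a vertex group \<open>H\<close> and to three parametrisations of sets \<open>p\<^sup>-\<^sup>1 H q\<close>, \<open>q\<^sup>-\<^sup>1 H r\<close>,
  \<open>p\<^sup>-\<^sup>1 H r\<close> of elements of the fundamental group; these sets are not subgroups, so that \<open>i1\<close>, \<open>i2\<close>,
  \<open>i3\<close> are different maps.\<close>

lemma conv_bounded_transfer:
  fixes i1 i2 i3 :: "'b \<Rightarrow> 'a" and G :: "('a, 'm) monoid_scheme" and H :: "('b, 'n) monoid_scheme"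
  assumes bd: "conv_bounded H X Y M" and "0 \<le> M"
    and hom: "\<And>s t. s \<in> X \<Longrightarrow> t \<in> Y \<Longrightarrow> i1 s \<otimes>\<^bsub>G\<^esub> i2 t = i3 (s \<otimes>\<^bsub>H\<^esub> t)"
    and inj: "inj_on i1 X" "inj_on i2 Y" "inj_on i3 Z" and XY: "\<And>s t. s \<in> X \<Longrightarrow> t \<in> Y \<Longrightarrow> s \<otimes>\<^bsub>H\<^esub> t \<in> Z"
  shows "conv_bounded G (i1 ` X) (i2 ` Y) M"
proof (rule conv_boundedI)
  fix A B C T and f g h :: "'a \<Rightarrow> real"
  assume A: "finite A" "A \<subseteq> i1 ` X" and B: "finite B" "B \<subseteq> i2 ` Y" and C: "finite C" and T: "T \<subseteq> A \<times> B"
    and TC: "\<And>a b. (a, b) \<in> T \<Longrightarrow> a \<otimes>\<^bsub>G\<^esub> b \<in> C"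
    and pos: "\<And>x. 0 \<le> f x" "\<And>x. 0 \<le> g x" "\<And>x. 0 \<le> h x"
  obtain A' where A': "A' \<subseteq> X" "finite A'" "A = i1 ` A'" using A by (meson finite_subset_image)
  obtain B' where B': "B' \<subseteq> Y" "finite B'" "B = i2 ` B'" using B by (meson finite_subset_image)
  define T' where "T' = {(s, t) \<in> A' \<times> B'. (i1 s, i2 t) \<in> T}"
  define C' where "C' = (\<lambda>(s, t). s \<otimes>\<^bsub>H\<^esub> t) ` T'"
  have fin: "finite T'" using A' B' by (auto simp: T'_def intro: finite_subset[of _ "A' \<times> B'"])
  have im: "T = map_prod i1 i2 ` T'"
  proof (intro equalityI subsetI)
    fix ab assume ab: "ab \<in> T"
    then obtain s t where "s \<in> A'" "t \<in> B'" "ab = (i1 s, i2 t)" using T A' B' by auto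
    then show "ab \<in> map_prod i1 i2 ` T'" using ab by (auto simp: T'_def intro!: image_eqI[of _ _ "(s, t)"])
  qed (auto simp: T'_def)
  have injT: "inj_on (map_prod i1 i2) T'"
    using inj A' B' by (intro inj_onI) (auto simp: T'_def inj_on_def subset_iff)
  have "(\<Sum>(a, b)\<in>T. f a * g b * h (a \<otimes>\<^bsub>G\<^esub> b)) = (\<Sum>(s, t)\<in>T'. (f \<circ> i1) s * (g \<circ> i2) t * (h \<circ> i3) (s \<otimes>\<^bsub>H\<^esub> t))"
    unfolding im sum.reindex[OF injT] using A' B' by (intro sum.cong refl) (auto simp: T'_def hom subset_iff)
  also have "\<dots> \<le> M * (L2_set (f \<circ> i1) A' * L2_set (g \<circ> i2) B' * L2_set (h \<circ> i3) C')"
    using A' B' fin pos by (intro conv_boundedD[OF bd]) (auto simp: T'_def C'_def)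
  also have "L2_set (f \<circ> i1) A' = L2_set f A"
    using A' inj by (simp add: L2_set_def sum.reindex inj_on_subset)
  also have "L2_set (g \<circ> i2) B' = L2_set g B"
    using B' inj by (simp add: L2_set_def sum.reindex inj_on_subset)
  also have "L2_set (h \<circ> i3) C' = L2_set h (i3 ` C')"
  proof -
    have "C' \<subseteq> Z" using A' B' XY by (auto simp: C'_def T'_def)
    then show ?thesis using inj(3) by (simp add: L2_set_def sum.reindex inj_on_subset)
  qed
  also have "L2_set h (i3 ` C') \<le> L2_set h C"
  proof -
    have "i3 ` C' \<subseteq> C" using A' B' TC by (auto simp: C'_def T'_def hom[symmetric] subset_iff)
    then show ?thesis unfolding L2_set_def using C by (auto intro!: sum_mono2)
  qed
  finally show "(\<Sum>(a, b)\<in>T. f a * g b * h (a \<otimes>\<^bsub>G\<^esub> b)) \<le> M * (L2_set f A * L2_set g B * L2_set h C)"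
    using \<open>0 \<le> M\<close> by (auto simp: mult_left_mono L2_set_nonneg)
qed

section \<open>Word lengths\<close>

context group begin

definition word_value :: "'a list \<Rightarrow> 'a" where
  "word_value w = foldr (\<otimes>) w \<one>"

lemma word_value_closed: "set w \<subseteq> carrier G \<Longrightarrow> word_value w \<in> carrier G"
  by (induction w) (auto simp: word_value_def)

lemma word_value_append:
  "set w \<subseteq> carrier G \<Longrightarrow> set w' \<subseteq> carrier G \<Longrightarrow> word_value (w @ w') = word_value w \<otimes> word_value w'"
proof (induction w)
  case (Cons x w)
  then show ?case using word_value_closed[of w] word_value_closed[of w']
    by (auto simp: word_value_def m_assoc)
qed (use word_value_closed in \<open>auto simp: word_value_def\<close>)

lemma letters_closed: "S \<subseteq> carrier G \<Longrightarrow> S \<union> m_inv G ` S \<subseteq> carrier G"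
  by auto

lemma word_value_inverse:
  "set w \<subseteq> carrier G \<Longrightarrow> word_value (rev (map (m_inv G) w)) = inv (word_value w)"
proof (induction w)
  case (Cons x w)
  then have "word_value (rev (map (m_inv G) (x # w))) = inv (word_value w) \<otimes> word_value [inv x]"
    by (simp, subst word_value_append) auto
  then show ?case using Cons word_value_closed[of w] by (auto simp: word_value_def inv_mult_group)
qed (simp add: word_value_def)

lemma word_length_le:
  "set w \<subseteq> S \<union> m_inv G ` S \<Longrightarrow> word_value w = g \<Longrightarrow> word_length G S g \<le> length w"
  unfolding word_length_def word_value_def by (rule Least_le) auto

lemma generate_words:
  assumes "S \<subseteq> carrier G" "g \<in> generate G S"
  shows "\<exists>w. set w \<subseteq> S \<union> m_inv G ` S \<and> word_value w = g"
  using assms(2)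
proof (induction rule: generate.induct)
  case one
  then show ?case by (intro exI[of _ "[]"]) (auto simp: word_value_def)
next
  case (incl h)
  then show ?case using assms(1) by (intro exI[of _ "[h]"]) (auto simp: word_value_def)
next
  case (inv h)
  then show ?case using assms(1) by (intro exI[of _ "[m_inv G h]"]) (auto simp: word_value_def)
next
  case (eng h1 h2)
  then obtain w1 w2 where "set w1 \<subseteq> S \<union> m_inv G ` S" "word_value w1 = h1"
    "set w2 \<subseteq> S \<union> m_inv G ` S" "word_value w2 = h2" by auto
  moreover from this have "set w1 \<subseteq> carrier G" "set w2 \<subseteq> carrier G" using letters_closed[OF assms(1)] by blast+
  ultimately show ?case by (intro exI[of _ "w1 @ w2"]) (simp add: word_value_append)
qed

lemma word_length_word:
  assumes "finite_generating_set G S" "g \<in> carrier G"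
  obtains w where "set w \<subseteq> S \<union> m_inv G ` S" "word_value w = g" "length w = word_length G S g"
proof -
  have "\<exists>n w. length w = n \<and> set w \<subseteq> S \<union> m_inv G ` S \<and> foldr (\<otimes>) w \<one> = g"
    using generate_words[of S g] assms by (auto simp: finite_generating_set_def word_value_def)
  from LeastI_ex[OF this] obtain w where "length w = word_length G S g"
    "set w \<subseteq> S \<union> m_inv G ` S" "foldr (\<otimes>) w \<one> = g"
    unfolding word_length_def by auto
  then show thesis using that by (auto simp: word_value_def)
qed

lemma word_length_one: "word_length G S \<one> = 0"
  using word_length_le[of "[]" S \<one>] by (simp add: word_value_def)

lemma word_length_mult:
  assumes S: "finite_generating_set G S" and "g \<in> carrier G" "h \<in> carrier G"
  shows "word_length G S (g \<otimes> h) \<le> word_length G S g + word_length G S h"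
proof -
  obtain w where w: "set w \<subseteq> S \<union> m_inv G ` S" "word_value w = g" "length w = word_length G S g"
    by (rule word_length_word[OF assms(1,2)])
  obtain w' where w': "set w' \<subseteq> S \<union> m_inv G ` S" "word_value w' = h" "length w' = word_length G S h"
    by (rule word_length_word[OF assms(1,3)])
  have "S \<union> m_inv G ` S \<subseteq> carrier G" using S letters_closed by (auto simp: finite_generating_set_def)
  then have "word_value (w @ w') = g \<otimes> h" using w w' by (subst word_value_append) auto
  then show ?thesis using word_length_le[of "w @ w'" S "g \<otimes> h"] w w' by auto
qed

lemma word_length_inv_le:
  assumes S: "finite_generating_set G S" and "g \<in> carrier G"
  shows "word_length G S (inv g) \<le> word_length G S g"
proof -
  obtain w where w: "set w \<subseteq> S \<union> m_inv G ` S" "word_value w = g" "length w = word_length G S g"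
    by (rule word_length_word[OF assms(1,2)])
  have S': "S \<subseteq> carrier G" using S by (auto simp: finite_generating_set_def)
  then have "set w \<subseteq> carrier G" using w(1) letters_closed by blast
  then have "word_value (rev (map (m_inv G) w)) = inv g" using w by (simp add: word_value_inverse)
  moreover have "set (rev (map (m_inv G) w)) \<subseteq> S \<union> m_inv G ` S"
    using w(1) S' by (auto simp: subset_iff)
  ultimately show ?thesis using word_length_le[of "rev (map (m_inv G) w)" S "inv g"] w by auto
qed

text \<open>A subadditive function is at most linear in the word length, the sum of its values on the letters
  being a possible slope. This compares word lengths for different generating sets, and the length of
  sequences with the word length in the fundamental group.\<close>

lemma length_function_bounded_by_word_length:
  fixes len :: "'a \<Rightarrow> nat"
  assumes S: "finite_generating_set G S" and one: "len \<one> = 0"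
    and mult: "\<And>x y. x \<in> carrier G \<Longrightarrow> y \<in> carrier G \<Longrightarrow> len (x \<otimes> y) \<le> len x + len y"
  shows "\<exists>C. \<forall>g\<in>carrier G. len g \<le> C * word_length G S g"
proof -
  let ?L = "S \<union> m_inv G ` S"
  define C where "C = (\<Sum>s\<in>?L. len s)"
  have fin: "finite ?L" and car: "?L \<subseteq> carrier G" using S by (auto simp: finite_generating_set_def)
  have C: "len s \<le> C" if "s \<in> ?L" for s unfolding C_def using fin that by (intro member_le_sum) auto
  have "len (word_value w) \<le> C * length w" if "set w \<subseteq> ?L" for w
    using that
  proof (induction w)
    case Nil
    then show ?case by (simp add: word_value_def one)
  next
    case (Cons x w)
    have xw: "x \<in> carrier G" "word_value w \<in> carrier G"
      using Cons.prems car word_value_closed[of w] by (auto simp del: Un_iff)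
    have "len (word_value (x # w)) \<le> len x + len (word_value w)"
      using mult[OF xw] by (simp add: word_value_def)
    also have "\<dots> \<le> C + C * length w" using Cons C[of x] by (intro add_mono) auto
    finally show ?case by simp
  qed
  then show ?thesis using word_length_word[OF S] by metis
qed

end

section \<open>Polynomial bounds\<close>

text \<open>Bounds are going to be composed and evaluated at larger arguments, so the polynomials of the
  hypotheses are replaced by monotone, non-negative ones.\<close>

definition poly_bound :: "real poly \<Rightarrow> bool" where
  "poly_bound Q \<longleftrightarrow> (\<forall>x\<ge>0. 0 \<le> poly Q x) \<and> (\<forall>x y. 0 \<le> x \<longrightarrow> x \<le> y \<longrightarrow> poly Q x \<le> poly Q y)"

lemma poly_bound_nonneg: "poly_bound Q \<Longrightarrow> 0 \<le> x \<Longrightarrow> 0 \<le> poly Q x"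
  by (simp add: poly_bound_def)

lemma poly_bound_mono: "poly_bound Q \<Longrightarrow> 0 \<le> x \<Longrightarrow> x \<le> y \<Longrightarrow> poly Q x \<le> poly Q y"
  by (simp add: poly_bound_def)

lemma poly_bound_exists: "\<exists>Q. poly_bound Q \<and> (\<forall>x\<ge>0. poly P x \<le> poly Q x)"
proof (induction P)
  case 0
  then show ?case by (intro exI[of _ 0]) (simp add: poly_bound_def)
next
  case (pCons a p)
  then obtain Q where Q: "poly_bound Q" "\<And>x. 0 \<le> x \<Longrightarrow> poly p x \<le> poly Q x" by auto
  \<comment> \<open>taking absolute values of the coefficients\<close>
  have "poly_bound (pCons \<bar>a\<bar> Q)"
    using Q(1) by (auto simp: poly_bound_def intro!: add_nonneg_nonneg mult_mono)
  moreover have "poly (pCons a p) x \<le> poly (pCons \<bar>a\<bar> Q) x" if "0 \<le> x" for x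
    using Q(2)[OF that] that by (auto intro!: add_mono mult_left_mono)
  ultimately show ?case by blast
qed

lemma poly_bound_pcompose: "poly_bound P \<Longrightarrow> poly_bound Q \<Longrightarrow> poly_bound (pcompose P Q)"
  by (auto simp: poly_bound_def poly_pcompose)

lemma poly_bound_linear: "0 \<le> a \<Longrightarrow> 0 \<le> b \<Longrightarrow> poly_bound [:a, b:]"
  by (auto simp: poly_bound_def intro: mult_right_mono mult_left_mono)

lemma poly_bound_mult: "poly_bound P \<Longrightarrow> poly_bound Q \<Longrightarrow> poly_bound (P * Q)"
  by (auto simp: poly_bound_def intro!: mult_mono)

lemma poly_bound_exists_uniform:
  assumes "finite V"
  shows "\<exists>Q. poly_bound Q \<and> (\<forall>v\<in>V. \<forall>x\<ge>0. poly (P v) x \<le> poly Q x)"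
  using assms
proof (induction V)
  case empty
  show ?case by (intro exI[of _ 0]) (simp add: poly_bound_def)
next
  case (insert v V)
  then obtain Q where Q: "poly_bound Q" "\<forall>v\<in>V. \<forall>x\<ge>0. poly (P v) x \<le> poly Q x" by auto
  obtain R where R: "poly_bound R" "\<forall>x\<ge>0. poly (P v) x \<le> poly R x" using poly_bound_exists by blast
  have "poly_bound (Q + R)" using Q R by (auto simp: poly_bound_def intro: add_mono)
  moreover have "\<forall>w\<in>insert v V. \<forall>x\<ge>0. poly (P w) x \<le> poly (Q + R) x"
  proof (intro ballI allI impI)
    fix w x assume "w \<in> insert v V" "0 \<le> (x::real)"
    then show "poly (P w) x \<le> poly (Q + R) x"
      using Q R poly_bound_nonneg[OF Q(1), of x] poly_bound_nonneg[OF R(1), of x]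
      by (auto intro: add_increasing add_increasing2)
  qed
  ultimately show ?case by blast
qed

text \<open>The generating set that witnesses Rapid Decay can be exchanged for any other one: balls of radius \<open>D\<close>
  for the new word length are contained in balls of radius \<open>C D\<close> for the old one.\<close>

lemma rapid_decay_conv_bounded:
  assumes "rapid_decay G" and S: "finite_generating_set G S"
  shows "\<exists>P. \<forall>D\<ge>0. conv_bounded G {g \<in> carrier G. real (word_length G S g) \<le> D} (carrier G) (poly P D)"
proof -
  have G: "group G" using assms by (simp add: rapid_decay_def)
  interpret group G by (rule G)
  obtain S' P where S': "finite_generating_set G S'"
    and P: "\<And>r f g. \<lbrakk>0 < r; f \<in> pos_group_ring G; g \<in> pos_group_ring G;
       {x. f x \<noteq> 0} \<subseteq> {x \<in> carrier G. real (word_length G S' x) \<le> r}\<rbrakk> \<Longrightarrow>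
       l2_norm G (convolution G f g) \<le> poly P r * l2_norm G f * l2_norm G g"
    using assms(1) unfolding rapid_decay_def by blast
  obtain C where C: "\<And>g. g \<in> carrier G \<Longrightarrow> word_length G S' g \<le> C * word_length G S g"
    using length_function_bounded_by_word_length[OF S, of "word_length G S'", OF word_length_one word_length_mult[OF S']]
    by auto
  \<comment> \<open>the summand 1 keeps the radius positive when \<open>D = 0\<close>\<close>
  have "conv_bounded G {g \<in> carrier G. real (word_length G S g) \<le> D} (carrier G) (poly (pcompose P [:1, real C:]) D)" if "0 \<le> D" for D
  proof -
    let ?r = "1 + real C * D"
    have r: "0 < ?r" using that by (simp add: add_pos_nonneg)
    have "conv_bounded G {g \<in> carrier G. real (word_length G S' g) \<le> ?r} (carrier G) (poly P ?r)"
      using P[OF r] by (intro conv_bounded_of_l2_norm_bound G) auto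
    moreover have "{g \<in> carrier G. real (word_length G S g) \<le> D} \<subseteq> {g \<in> carrier G. real (word_length G S' g) \<le> ?r}"
    proof clarify
      fix g assume g: "g \<in> carrier G" "real (word_length G S g) \<le> D"
      have "real (word_length G S' g) \<le> real C * real (word_length G S g)"
        using C[OF g(1)] by (metis of_nat_le_iff of_nat_mult)
      also have "\<dots> \<le> real C * D" using g(2) by (intro mult_left_mono) auto
      finally show "real (word_length G S' g) \<le> ?r" by simp
    qed
    ultimately show ?thesis by (auto simp: poly_pcompose mult.commute intro: conv_bounded_mono)
  qed
  then show ?thesis by blast
qed

section \<open>Normal forms of sequences\<close>

context graph_of_groups begin

abbreviation "VG \<equiv> vertex_group \<G>"
abbreviation "EG \<equiv> edge_group \<G>"
abbreviation "src \<equiv> tail (base_graph \<G>)"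
abbreviation "tgt \<equiv> head (base_graph \<G>)"
abbreviation "bar \<equiv> rev_arc \<G>"
abbreviation "inc \<equiv> edge_map \<G>"
abbreviation "Vs \<equiv> verts (base_graph \<G>)"
abbreviation "Es \<equiv> arcs (base_graph \<G>)"

lemma group_VG: "v \<in> Vs \<Longrightarrow> group (VG v)"
  using vertex_group_fg by (auto simp: finitely_generated_group_def)

lemma group_EG: "e \<in> Es \<Longrightarrow> group (EG e)"
  using edge_group_fg by (auto simp: finitely_generated_group_def)

lemma group_hom_inc: "e \<in> Es \<Longrightarrow> group_hom (EG e) (VG (tgt e)) (inc e)"
  using group_EG group_VG edge_map_hom by (simp add: group_hom_def group_hom_axioms_def)

lemma group_hom_inc_bar: "e \<in> Es \<Longrightarrow> group_hom (EG e) (VG (src e)) (inc (bar e))"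
  using group_hom_inc[of "bar e"] edge_group_rev[of e] by simp

lemma gseqs_Nil [simp]: "(g, []) \<in> gseqs \<G> u v \<longleftrightarrow> u = v \<and> u \<in> Vs \<and> g \<in> carrier (VG u)"
  by (auto simp: gseqs_def awalk_Nil_iff)

lemma gseqs_Cons [simp]:
  "(g, (e, x) # l) \<in> gseqs \<G> u v \<longleftrightarrow>
    e \<in> Es \<and> src e = u \<and> g \<in> carrier (VG u) \<and> (x, l) \<in> gseqs \<G> (tgt e) v"
  by (auto simp: gseqs_def awalk_Cons_iff)

lemma gseqs_verts: "(g, l) \<in> gseqs \<G> u v \<Longrightarrow> u \<in> Vs \<and> v \<in> Vs"
proof (induction l arbitrary: g u)
  case (Cons a l)
  then show ?case by (cases a) auto
qed auto

lemma gseqs_closed: "(g, l) \<in> gseqs \<G> u v \<Longrightarrow> g \<in> carrier (VG u)"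
  by (cases l) (auto split: prod.splits)

lemma gseqs_change_head:
  "(g, l) \<in> gseqs \<G> u v \<Longrightarrow> h \<in> carrier (VG u) \<Longrightarrow> (h, l) \<in> gseqs \<G> u v"
  by (cases l) (auto split: prod.splits)

subsection \<open>Coset representatives\<close>

definition edge_sub :: "'e \<Rightarrow> 'a set" where
  "edge_sub e = inc e ` carrier (EG e)"

text \<open>Representatives of the right cosets of the edge group. The edge group itself is represented by \<open>1\<close>,
  so that a backtracking can be recognised by its representative alone.\<close>

definition coset_rep :: "'e \<Rightarrow> 'a \<Rightarrow> 'a" where
  "coset_rep e y = (if y \<in> edge_sub e then \<one>\<^bsub>VG (tgt e)\<^esub> else SOME z. z \<in> edge_sub e #>\<^bsub>VG (tgt e)\<^esub> y)"

definition edge_part :: "'e \<Rightarrow> 'a \<Rightarrow> 'b" where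
  "edge_part e y = (THE h. h \<in> carrier (EG e) \<and> y = inc e h \<otimes>\<^bsub>VG (tgt e)\<^esub> coset_rep e y)"

lemma coset_rep_ex:
  assumes e: "e \<in> Es" and y: "y \<in> carrier (VG (tgt e))"
  shows "coset_rep e y \<in> carrier (VG (tgt e)) \<and> (\<exists>!h. h \<in> carrier (EG e) \<and> y = inc e h \<otimes>\<^bsub>VG (tgt e)\<^esub> coset_rep e y)"
proof -
  interpret group_hom "EG e" "VG (tgt e)" "inc e" using e by (rule group_hom_inc)
  have sub: "subgroup (edge_sub e) (VG (tgt e))" unfolding edge_sub_def by (rule img_is_subgroup)
  have "\<exists>k\<in>carrier (EG e). coset_rep e y = inc e k \<otimes>\<^bsub>VG (tgt e)\<^esub> y"
  proof (cases "y \<in> edge_sub e")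
    case True
    then obtain k where k: "k \<in> carrier (EG e)" "y = inc e k" by (auto simp: edge_sub_def)
    then have "coset_rep e y = inc e (inv\<^bsub>EG e\<^esub> k) \<otimes>\<^bsub>VG (tgt e)\<^esub> y"
      using True by (simp add: coset_rep_def)
    then show ?thesis using k by blast
  next
    case False
    have "y \<in> edge_sub e #>\<^bsub>VG (tgt e)\<^esub> y" using H.rcos_self[OF y sub] .
    then have "coset_rep e y \<in> edge_sub e #>\<^bsub>VG (tgt e)\<^esub> y"
      using False unfolding coset_rep_def by (auto intro: someI)
    then show ?thesis by (auto simp: edge_sub_def r_coset_def)
  qed
  then obtain k where k: "k \<in> carrier (EG e)" "coset_rep e y = inc e k \<otimes>\<^bsub>VG (tgt e)\<^esub> y" by blast
  have rc: "coset_rep e y \<in> carrier (VG (tgt e))" using k y by simp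
  have "y = inc e (inv\<^bsub>EG e\<^esub> k) \<otimes>\<^bsub>VG (tgt e)\<^esub> coset_rep e y"
    using k y by (simp add: H.m_assoc[symmetric])
  moreover have "h = h'" if "h \<in> carrier (EG e)" "y = inc e h \<otimes>\<^bsub>VG (tgt e)\<^esub> coset_rep e y"
    "h' \<in> carrier (EG e)" "y = inc e h' \<otimes>\<^bsub>VG (tgt e)\<^esub> coset_rep e y" for h h'
  proof -
    have "inc e h = inc e h'" using that rc by (metis H.right_cancel hom_closed)
    then show ?thesis using edge_map_inj[OF e] that by (auto dest: inj_onD)
  qed
  ultimately show ?thesis using rc k(1) by blast
qed

lemma coset_rep_closed [simp]:
  "e \<in> Es \<Longrightarrow> y \<in> carrier (VG (tgt e)) \<Longrightarrow> coset_rep e y \<in> carrier (VG (tgt e))"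
  using coset_rep_ex by blast

lemma edge_part:
  assumes "e \<in> Es" "y \<in> carrier (VG (tgt e))"
  shows "edge_part e y \<in> carrier (EG e)" "inc e (edge_part e y) \<otimes>\<^bsub>VG (tgt e)\<^esub> coset_rep e y = y"
  using theI'[OF coset_rep_ex[OF assms, THEN conjunct2]] by (simp_all add: edge_part_def)

lemma edge_part_unique:
  assumes "e \<in> Es" "y \<in> carrier (VG (tgt e))" "h \<in> carrier (EG e)"
    "y = inc e h \<otimes>\<^bsub>VG (tgt e)\<^esub> coset_rep e y"
  shows "edge_part e y = h"
  using assms coset_rep_ex[OF assms(1,2)] edge_part[OF assms(1,2)] by metis

text \<open>Both points hold because the representative depends on the coset only.\<close>

lemma coset_rep_translate:
  assumes e: "e \<in> Es" and y: "y \<in> carrier (VG (tgt e))" and h: "h \<in> carrier (EG e)"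
  shows "coset_rep e (inc e h \<otimes>\<^bsub>VG (tgt e)\<^esub> y) = coset_rep e y"
    "edge_part e (inc e h \<otimes>\<^bsub>VG (tgt e)\<^esub> y) = h \<otimes>\<^bsub>EG e\<^esub> edge_part e y"
proof -
  interpret group_hom "EG e" "VG (tgt e)" "inc e" using e by (rule group_hom_inc)
  have sub: "subgroup (edge_sub e) (VG (tgt e))" unfolding edge_sub_def by (rule img_is_subgroup)
  let ?y = "inc e h \<otimes>\<^bsub>VG (tgt e)\<^esub> y"
  have hs: "inc e h \<in> edge_sub e" using h by (simp add: edge_sub_def)
  have iff: "?y \<in> edge_sub e \<longleftrightarrow> y \<in> edge_sub e"
  proof
    assume "?y \<in> edge_sub e"
    then have "inv\<^bsub>VG (tgt e)\<^esub> (inc e h) \<otimes>\<^bsub>VG (tgt e)\<^esub> ?y \<in> edge_sub e"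
      using sub hs by (meson subgroup.m_closed subgroup.m_inv_closed)
    then show "y \<in> edge_sub e" using h y by (simp add: H.m_assoc[symmetric] del: hom_inv)
  qed (use sub hs in \<open>auto intro: subgroup.m_closed\<close>)
  have "?y \<in> edge_sub e #>\<^bsub>VG (tgt e)\<^esub> y" using hs by (auto simp: r_coset_def)
  then have "edge_sub e #>\<^bsub>VG (tgt e)\<^esub> y = edge_sub e #>\<^bsub>VG (tgt e)\<^esub> ?y"
    using H.repr_independence y sub by blast
  then show *: "coset_rep e ?y = coset_rep e y"
    by (simp add: coset_rep_def iff)
  show "edge_part e ?y = h \<otimes>\<^bsub>EG e\<^esub> edge_part e y"
  proof (rule edge_part_unique)
    show "?y = inc e (h \<otimes>\<^bsub>EG e\<^esub> edge_part e y) \<otimes>\<^bsub>VG (tgt e)\<^esub> coset_rep e ?y"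
      using edge_part[OF e y] h y e by (simp add: * H.m_assoc)
  qed (use e y h edge_part in auto)
qed

lemma coset_rep_one [simp]: 
  assumes e: "e \<in> Es" 
  shows "coset_rep e \<one>\<^bsub>VG (tgt e)\<^esub> = \<one>\<^bsub>VG (tgt e)\<^esub>" "edge_part e \<one>\<^bsub>VG (tgt e)\<^esub> = \<one>\<^bsub>EG e\<^esub>"
proof -
  interpret group_hom "EG e" "VG (tgt e)" "inc e" using e by (rule group_hom_inc)
  have "\<one>\<^bsub>VG (tgt e)\<^esub> = inc e \<one>\<^bsub>EG e\<^esub>" by simp
  then have "\<one>\<^bsub>VG (tgt e)\<^esub> \<in> edge_sub e" unfolding edge_sub_def by blast
  then show *: "coset_rep e \<one>\<^bsub>VG (tgt e)\<^esub> = \<one>\<^bsub>VG (tgt e)\<^esub>" by (simp add: coset_rep_def)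
  show "edge_part e \<one>\<^bsub>VG (tgt e)\<^esub> = \<one>\<^bsub>EG e\<^esub>"
    using e by (intro edge_part_unique) (auto simp: *)
qed

lemma coset_rep_inc:
  assumes e: "e \<in> Es" and h: "h \<in> carrier (EG e)"
  shows "coset_rep e (inc e h) = \<one>\<^bsub>VG (tgt e)\<^esub>" "edge_part e (inc e h) = h"
proof -
  interpret group_hom "EG e" "VG (tgt e)" "inc e" using e by (rule group_hom_inc)
  show "coset_rep e (inc e h) = \<one>\<^bsub>VG (tgt e)\<^esub>" "edge_part e (inc e h) = h"
    using coset_rep_translate[OF e H.one_closed h] e h by auto
qed

lemma coset_rep_idem:
  assumes e: "e \<in> Es" and y: "y \<in> carrier (VG (tgt e))"
  shows "coset_rep e (coset_rep e y) = coset_rep e y"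
proof -
  interpret group_hom "EG e" "VG (tgt e)" "inc e" using e by (rule group_hom_inc)
  show ?thesis using coset_rep_translate(1)[OF e coset_rep_closed[OF e y] edge_part(1)[OF e y]] edge_part[OF e y] by simp
qed

lemma edge_part_of_rep:
  assumes e: "e \<in> Es" and y: "y \<in> carrier (VG (tgt e))" and "coset_rep e y = y"
  shows "edge_part e y = \<one>\<^bsub>EG e\<^esub>"
proof -
  interpret group_hom "EG e" "VG (tgt e)" "inc e" using e by (rule group_hom_inc)
  show ?thesis using assms by (intro edge_part_unique) auto
qed

subsection \<open>The action on normal sequences\<close>

definition lmul :: "'v \<Rightarrow> 'a \<Rightarrow> ('a, 'e) gseq \<Rightarrow> ('a, 'e) gseq" where
  "lmul v g n = (g \<otimes>\<^bsub>VG v\<^esub> fst n, snd n)"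

text \<open>In a normal form \<open>(g, l)\<close> the first entry is arbitrary and every later entry is the chosen
  representative of its right coset; the last conjunct excludes a subsequence \<open>(e, 1, bar e)\<close>.\<close>

fun normal_tail :: "('e \<times> 'a) list \<Rightarrow> bool" where
  "normal_tail [] \<longleftrightarrow> True"
| "normal_tail ((e, x) # l) \<longleftrightarrow> coset_rep e x = x \<and> normal_tail l \<and>
     \<not> (x = \<one>\<^bsub>VG (tgt e)\<^esub> \<and> l \<noteq> [] \<and> fst (hd l) = bar e)"

definition normal_seqs :: "'v \<Rightarrow> 'v \<Rightarrow> ('a, 'e) gseq set" where
  "normal_seqs u v = {s \<in> gseqs \<G> u v. normal_tail (snd s)}"

text \<open>Multiplication from the left by the edge \<open>e\<close>. Writing the first entry as \<open>inc e h \<otimes> z\<close> with a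
  representative \<open>z\<close>, the factor from the edge group is moved to the other side of \<open>e\<close>, where it becomes
  \<open>inc (bar e) h\<close>. Then \<open>e\<close> and a following \<open>bar e\<close> cancel if and only if \<open>z = 1\<close>.\<close>

definition push :: "'e \<Rightarrow> ('a, 'e) gseq \<Rightarrow> ('a, 'e) gseq" where
  "push e n =
    (if coset_rep e (fst n) = \<one>\<^bsub>VG (tgt e)\<^esub> \<and> snd n \<noteq> [] \<and> fst (hd (snd n)) = bar e
     then (inc (bar e) (edge_part e (fst n)) \<otimes>\<^bsub>VG (src e)\<^esub> snd (hd (snd n)), tl (snd n))
     else (inc (bar e) (edge_part e (fst n)), (e, coset_rep e (fst n)) # snd n))"

text \<open>The action of all sequences on the normal ones. Since it respects the elementary moves, the normal
  form \<open>nf\<close>, obtained by acting on the trivial sequence, is an invariant of the class of a sequence: this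
  is van der Waerden's proof of the normal form theorem, which avoids a discussion of confluence.\<close>

fun act :: "'v \<Rightarrow> ('a, 'e) gseq \<Rightarrow> ('a, 'e) gseq \<Rightarrow> ('a, 'e) gseq" where
  "act v (g, []) n = lmul v g n"
| "act v (g, (e, x) # l) n = lmul (src e) g (push e (act v (x, l) n))"

definition nf :: "'v \<Rightarrow> ('a, 'e) gseq \<Rightarrow> ('a, 'e) gseq" where
  "nf v s = act v s (\<one>\<^bsub>VG v\<^esub>, [])"

lemma normal_seqs_gseqs: "n \<in> normal_seqs u v \<Longrightarrow> n \<in> gseqs \<G> u v"
  by (simp add: normal_seqs_def)

lemma normal_seqs_fst: "n \<in> normal_seqs u v \<Longrightarrow> fst n \<in> carrier (VG u)"
  by (cases n) (auto simp: normal_seqs_def dest: gseqs_closed)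

lemma normal_seqs_verts: "n \<in> normal_seqs u v \<Longrightarrow> u \<in> Vs" "n \<in> normal_seqs u v \<Longrightarrow> v \<in> Vs"
  by (cases n; auto simp: normal_seqs_def dest: gseqs_verts)+

lemma lmul_normal: "g \<in> carrier (VG u) \<Longrightarrow> n \<in> normal_seqs u v \<Longrightarrow> lmul u g n \<in> normal_seqs u v"
proof -
  assume g: "g \<in> carrier (VG u)" and n: "n \<in> normal_seqs u v"
  interpret group "VG u" using normal_seqs_verts(1)[OF n] by (rule group_VG)
  show ?thesis using g n normal_seqs_fst[OF n]
    by (cases n) (auto simp: normal_seqs_def lmul_def elim: gseqs_change_head)
qed

lemma lmul_lmul:
  assumes "g \<in> carrier (VG u)" "h \<in> carrier (VG u)" "n \<in> normal_seqs u v"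
  shows "lmul u g (lmul u h n) = lmul u (g \<otimes>\<^bsub>VG u\<^esub> h) n"
proof -
  interpret group "VG u" using normal_seqs_verts(1)[OF assms(3)] by (rule group_VG)
  show ?thesis using assms normal_seqs_fst[OF assms(3)] by (simp add: lmul_def m_assoc)
qed

lemma lmul_one: 
  assumes "n \<in> normal_seqs u v"
  shows "lmul u \<one>\<^bsub>VG u\<^esub> n = n"
proof -
  interpret group "VG u" using normal_seqs_verts(1)[OF assms] by (rule group_VG)
  show ?thesis using normal_seqs_fst[OF assms] by (simp add: lmul_def)
qed

lemma normal_seqs_Cons: "(g, (e, x) # l) \<in> normal_seqs u v \<longleftrightarrow>
    e \<in> Es \<and> src e = u \<and> g \<in> carrier (VG u) \<and> (x, l) \<in> normal_seqs (tgt e) v \<and> coset_rep e x = x \<and>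
    \<not> (x = \<one>\<^bsub>VG (tgt e)\<^esub> \<and> l \<noteq> [] \<and> fst (hd l) = bar e)"
  by (auto simp: normal_seqs_def)

lemma push_normal:
  assumes e: "e \<in> Es" and n: "n \<in> normal_seqs (tgt e) v"
  shows "push e n \<in> normal_seqs (src e) v"
proof -
  interpret b: group_hom "EG e" "VG (src e)" "inc (bar e)" using e by (rule group_hom_inc_bar)
  obtain y m where ym: "n = (y, m)" by (cases n)
  have y: "y \<in> carrier (VG (tgt e))" using normal_seqs_fst[OF n] ym by simp
  show ?thesis
  proof (cases "coset_rep e y = \<one>\<^bsub>VG (tgt e)\<^esub> \<and> m \<noteq> [] \<and> fst (hd m) = bar e")
    case True
    then obtain z m' where m: "m = (bar e, z) # m'" by (cases m) auto
    then have "(z, m') \<in> normal_seqs (src e) v" using n ym e by (simp add: normal_seqs_Cons)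
    then show ?thesis using True m ym lmul_normal[of "inc (bar e) (edge_part e y)" "src e" "(z, m')" v]
        edge_part[OF e y] e by (simp add: push_def lmul_def)
  next
    case False
    have "(coset_rep e y, m) \<in> normal_seqs (tgt e) v"
      using n ym e y by (auto simp: normal_seqs_def elim: gseqs_change_head)
    moreover have "push e n = (inc (bar e) (edge_part e y), (e, coset_rep e y) # m)"
      using False ym by (auto simp: push_def)
    ultimately show ?thesis
      using False e y edge_part[OF e y] coset_rep_idem[OF e y] by (auto simp: normal_seqs_Cons)
  qed
qed

text \<open>This identity makes the action compatible with sliding.\<close>

lemma push_lmul_inc:
  assumes e: "e \<in> Es" and n: "n \<in> normal_seqs (tgt e) v" and h: "h \<in> carrier (EG e)"
  shows "push e (lmul (tgt e) (inc e h) n) = lmul (src e) (inc (bar e) h) (push e n)"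
proof -
  interpret b: group_hom "EG e" "VG (src e)" "inc (bar e)" using e by (rule group_hom_inc_bar)
  have y: "fst n \<in> carrier (VG (tgt e))" using normal_seqs_fst[OF n] .
  have z: "snd (hd (snd n)) \<in> carrier (VG (src e))" if z: "snd n \<noteq> []" "fst (hd (snd n)) = bar e"
  proof -
    obtain p m' where p: "snd n = p # m'" using z(1) by (cases "snd n") auto
    define g z where "g = fst n" and "z = snd p"
    have m: "n = (g, (bar e, z) # m')" using p z(2) by (simp add: prod_eq_iff g_def z_def)
    then have "(z, m') \<in> normal_seqs (src e) v" using n e by (simp add: normal_seqs_Cons)
    then show ?thesis using m normal_seqs_fst by fastforce
  qed
  show ?thesis
    using e h y z edge_part[OF e y]
    by (auto simp: push_def lmul_def coset_rep_translate b.H.m_assoc)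
qed

text \<open>This identity makes the action compatible with cancelling. If the inner step pops the head \<open>(e, z)\<close> of
  the list, then normality of the list prevents the outer step from popping once more, and
  pushing \<open>e\<close> restores the head.\<close>

lemma push_push_bar:
  assumes e: "e \<in> Es" and n: "n \<in> normal_seqs (src e) v"
  shows "push e (push (bar e) n) = n"
proof -
  interpret i: group_hom "EG e" "VG (tgt e)" "inc e" using e by (rule group_hom_inc)
  interpret b: group_hom "EG e" "VG (src e)" "inc (bar e)" using e by (rule group_hom_inc_bar)
  obtain y m where ym: "n = (y, m)" by (cases n)
  have be: "bar e \<in> Es" "tgt (bar e) = src e" "src (bar e) = tgt e" "bar (bar e) = e" "EG (bar e) = EG e"
    using e edge_group_rev by auto
  have y: "y \<in> carrier (VG (tgt (bar e)))" using normal_seqs_fst[OF n] ym be by simp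
  note p = edge_part[OF be(1) y, unfolded be]
  show ?thesis
  proof (cases "coset_rep (bar e) y = \<one>\<^bsub>VG (src e)\<^esub> \<and> m \<noteq> [] \<and> fst (hd m) = e")
    case True
    then obtain z m' where m: "m = (e, z) # m'" by (cases m) auto
    then have z: "(z, m') \<in> normal_seqs (tgt e) v" "coset_rep e z = z"
      "\<not> (z = \<one>\<^bsub>VG (tgt e)\<^esub> \<and> m' \<noteq> [] \<and> fst (hd m') = bar e)" using n ym e by (auto simp: normal_seqs_Cons)
    have zc: "z \<in> carrier (VG (tgt e))" using normal_seqs_fst[OF z(1)] by simp
    have "push (bar e) n = (inc e (edge_part (bar e) y) \<otimes>\<^bsub>VG (tgt e)\<^esub> z, m')"
      using True m ym be by (simp add: push_def)
    then have "push e (push (bar e) n) = (inc (bar e) (edge_part (bar e) y), (e, z) # m')"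
      using z zc e p edge_part_of_rep[OF e zc z(2)] by (auto simp: push_def coset_rep_translate)
    also have "inc (bar e) (edge_part (bar e) y) = y" using True p by simp
    finally show ?thesis using ym m by simp
  next
    case False
    have "push (bar e) n = (inc e (edge_part (bar e) y), (bar e, coset_rep (bar e) y) # m)"
      using False ym be by (auto simp: push_def)
    then show ?thesis using p e ym by (simp add: push_def coset_rep_inc)
  qed
qed

lemma act_normal: "s \<in> gseqs \<G> u v \<Longrightarrow> n \<in> normal_seqs v w \<Longrightarrow> act v s n \<in> normal_seqs u w"
proof (induction v s n arbitrary: u rule: act.induct)
  case (2 v g e x l n)
  then show ?case by (auto intro!: lmul_normal push_normal)
qed (auto intro: lmul_normal)

lemma act_lmul:
  assumes "(x, l) \<in> gseqs \<G> u v" "g \<in> carrier (VG u)" "n \<in> normal_seqs v w"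
  shows "act v (g \<otimes>\<^bsub>VG u\<^esub> x, l) n = lmul u g (act v (x, l) n)"
proof (cases l)
  case Nil
  then show ?thesis using assms lmul_lmul[of g v x n w] by auto
next
  case (Cons a m)
  obtain e y where a: "a = (e, y)" by (cases a)
  have m: "(y, m) \<in> gseqs \<G> (tgt e) v" "e \<in> Es" "src e = u" "x \<in> carrier (VG u)" using assms Cons a by auto
  show ?thesis using Cons a m assms lmul_lmul[OF assms(2) m(4) push_normal[OF m(2) act_normal[OF m(1) assms(3)], unfolded m(3)]]
    by simp
qed

text \<open>The elementary moves act trivially.\<close>

lemma act_step:
  assumes "gseq_step \<G> s s'" "s \<in> gseqs \<G> u v" "s' \<in> gseqs \<G> u v" "n \<in> normal_seqs v w"
  shows "act v s n = act v s' n"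
  using assms
proof (induction arbitrary: u rule: gseq_step.induct)
  case (slide h e g g' l)
  then have e: "e \<in> Es" "src e = u" "g \<in> carrier (VG u)" "(g', l) \<in> gseqs \<G> (tgt e) v" by auto
  interpret i: group_hom "EG e" "VG (tgt e)" "inc e" using e(1) by (rule group_hom_inc)
  interpret b: group_hom "EG e" "VG (src e)" "inc (bar e)" using e(1) by (rule group_hom_inc_bar)
  have h: "h \<in> carrier (EG e)" by fact
  have N: "act v (g', l) n \<in> normal_seqs (tgt e) w" using act_normal[OF e(4)] slide by blast
  have P: "push e (act v (g', l) n) \<in> normal_seqs (src e) w" using push_normal[OF e(1) N] .
  have "act v (g \<otimes>\<^bsub>VG (src e)\<^esub> inc (bar e) h, (e, inc e (inv\<^bsub>EG e\<^esub> h) \<otimes>\<^bsub>VG (tgt e)\<^esub> g') # l) n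
      = lmul (src e) (g \<otimes>\<^bsub>VG (src e)\<^esub> inc (bar e) h) (push e (lmul (tgt e) (inc e (inv\<^bsub>EG e\<^esub> h)) (act v (g', l) n)))"
    using act_lmul[OF e(4) _ slide.prems(3), of "inc e (inv\<^bsub>EG e\<^esub> h)"] h by simp
  also have "push e (lmul (tgt e) (inc e (inv\<^bsub>EG e\<^esub> h)) (act v (g', l) n))
      = lmul (src e) (inc (bar e) (inv\<^bsub>EG e\<^esub> h)) (push e (act v (g', l) n))"
    using push_lmul_inc[OF e(1) N, of "inv\<^bsub>EG e\<^esub> h"] h by simp
  also have "lmul (src e) (g \<otimes>\<^bsub>VG (src e)\<^esub> inc (bar e) h) \<dots> = lmul (src e) g (push e (act v (g', l) n))"
    using e h by (subst lmul_lmul[OF _ _ P]) (auto simp: b.H.m_assoc simp del: b.hom_inv, simp)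
  finally show ?case by simp
next
  case (cancel g e k l)
  then have e: "e \<in> Es" "src e = u" "g \<in> carrier (VG u)" "(k, l) \<in> gseqs \<G> u v" by auto
  have k: "k \<in> carrier (VG u)" using gseqs_closed e by blast
  have N: "act v (k, l) n \<in> normal_seqs (src e) w" using act_normal[OF e(4)] cancel e by blast
  have P: "push (bar e) (act v (k, l) n) \<in> normal_seqs (tgt e) w"
    using push_normal[of "bar e"] N e by simp
  have "act v (g, (e, \<one>\<^bsub>VG (tgt e)\<^esub>) # (bar e, k) # l) n = lmul u g (push e (push (bar e) (act v (k, l) n)))"
    using e lmul_one[OF P] by simp
  also have "\<dots> = act v (g \<otimes>\<^bsub>VG (src e)\<^esub> k, l) n"
    using act_lmul[OF e(4) e(3) cancel.prems(3)] push_push_bar[OF e(1) N] e by simp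
  finally show ?case .
next
  case (later g l g' l' x e)
  then show ?case by auto
qed

subsection \<open>Equivalence of sequences\<close>

lemma gseq_sim_refl: "s \<in> gseqs \<G> u v \<Longrightarrow> (s, s) \<in> gseq_sim \<G> u v"
  by (simp add: gseq_sim_def equivclp_def)

lemma gseq_sim_sym: "(s, t) \<in> gseq_sim \<G> u v \<Longrightarrow> (t, s) \<in> gseq_sim \<G> u v"
  by (auto simp: gseq_sim_def intro: equivclp_sym)

lemma gseq_sim_trans: "(s, t) \<in> gseq_sim \<G> u v \<Longrightarrow> (t, r) \<in> gseq_sim \<G> u v \<Longrightarrow> (s, r) \<in> gseq_sim \<G> u v"
  by (auto simp: gseq_sim_def dest: transpD[OF transp_equivclp])

lemma gseq_sim_step:
  "gseq_step \<G> s t \<Longrightarrow> s \<in> gseqs \<G> u v \<Longrightarrow> t \<in> gseqs \<G> u v \<Longrightarrow> (s, t) \<in> gseq_sim \<G> u v"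
  by (auto simp: gseq_sim_def equivclp_def symclp_def intro!: r_into_rtranclp)

lemma gseq_sim_induct [consumes 1, case_names base step]:
  assumes "(s, t) \<in> gseq_sim \<G> u v" "P s"
    and "\<And>x y. (s, x) \<in> gseq_sim \<G> u v \<Longrightarrow> x \<in> gseqs \<G> u v \<Longrightarrow> y \<in> gseqs \<G> u v \<Longrightarrow>
      gseq_step \<G> x y \<or> gseq_step \<G> y x \<Longrightarrow> P x \<Longrightarrow> P y"
  shows "P t"
proof -
  let ?r = "\<lambda>s t. s \<in> gseqs \<G> u v \<and> t \<in> gseqs \<G> u v \<and> gseq_step \<G> s t"
  have s: "s \<in> gseqs \<G> u v" using assms by (simp add: gseq_sim_def)
  have "(symclp ?r)\<^sup>*\<^sup>* s t" using assms(1) by (simp add: gseq_sim_def equivclp_def)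
  then have "P t \<and> (s, t) \<in> gseq_sim \<G> u v"
  proof (induction rule: rtranclp_induct)
    case base
    then show ?case using assms(2) s gseq_sim_refl by simp
  next
    case (step x y)
    then have "x \<in> gseqs \<G> u v" "y \<in> gseqs \<G> u v" "gseq_step \<G> x y \<or> gseq_step \<G> y x"
      by (auto simp: symclp_def)
    moreover from this have "(x, y) \<in> gseq_sim \<G> u v" using gseq_sim_step gseq_sim_sym by blast
    ultimately show ?case using step assms(3) gseq_sim_trans by blast
  qed
  then show ?thesis ..
qed

lemma act_sim:
  assumes "(s, t) \<in> gseq_sim \<G> u v" "n \<in> normal_seqs v w"
  shows "act v s n = act v t n"
  using assms(1)
proof (induction rule: gseq_sim_induct)
  case (step x y)
  then show ?case using act_step assms(2) by metis
qed simp

lemma gseq_sim_Cons: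
  assumes "(s, t) \<in> gseq_sim \<G> (tgt e) v" "e \<in> Es" "g \<in> carrier (VG (src e))"
  shows "((g, (e, fst s) # snd s), (g, (e, fst t) # snd t)) \<in> gseq_sim \<G> (src e) v"
  using assms(1)
proof (induction rule: gseq_sim_induct)
  case base
  have "s \<in> gseqs \<G> (tgt e) v" using assms by (simp add: gseq_sim_def)
  then show ?case using assms by (intro gseq_sim_refl) simp
next
  case (step x y)
  have "(g, (e, fst x) # snd x) \<in> gseqs \<G> (src e) v" "(g, (e, fst y) # snd y) \<in> gseqs \<G> (src e) v"
    using step assms by simp_all
  moreover have "gseq_step \<G> (g, (e, fst x) # snd x) (g, (e, fst y) # snd y) \<or>
      gseq_step \<G> (g, (e, fst y) # snd y) (g, (e, fst x) # snd x)"
    using step(4) gseq_step.later[of \<G> "fst x" "snd x" "fst y" "snd y" g e]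
      gseq_step.later[of \<G> "fst y" "snd y" "fst x" "snd x" g e] by auto
  ultimately show ?case using step gseq_sim_step gseq_sim_sym gseq_sim_trans by meson
qed

lemma unit_normal: "v \<in> Vs \<Longrightarrow> (\<one>\<^bsub>VG v\<^esub>, []) \<in> normal_seqs v v"
  using group_VG[of v] by (simp add: normal_seqs_def group.is_monoid monoid.one_closed)

lemma nf_normal: "s \<in> gseqs \<G> u v \<Longrightarrow> nf v s \<in> normal_seqs u v"
  unfolding nf_def using act_normal unit_normal gseqs_verts by (cases s) blast

text \<open>A slide, followed by a cancellation if the list is popped.\<close>

lemma gseq_sim_push:
  assumes e: "e \<in> Es" and n: "(y, m) \<in> normal_seqs (tgt e) v" and g: "g \<in> carrier (VG (src e))"
  shows "((g, (e, y) # m), lmul (src e) g (push e (y, m))) \<in> gseq_sim \<G> (src e) v"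
proof -
  interpret i: group_hom "EG e" "VG (tgt e)" "inc e" using e by (rule group_hom_inc)
  interpret b: group_hom "EG e" "VG (src e)" "inc (bar e)" using e by (rule group_hom_inc_bar)
  have y: "y \<in> carrier (VG (tgt e))" using normal_seqs_fst[OF n] by simp
  let ?h = "edge_part e y" and ?z = "coset_rep e y"
  have h: "?h \<in> carrier (EG e)" "inc e ?h \<otimes>\<^bsub>VG (tgt e)\<^esub> ?z = y" using edge_part[OF e y] by auto
  have yz: "inc e (inv\<^bsub>EG e\<^esub> ?h) \<otimes>\<^bsub>VG (tgt e)\<^esub> y = ?z"
    using h y e by (metis i.H.inv_solve_left i.hom_closed i.hom_inv coset_rep_closed)
  let ?t = "(g \<otimes>\<^bsub>VG (src e)\<^esub> inc (bar e) ?h, (e, ?z) # m)"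
  have "gseq_step \<G> (g, (e, y) # m) ?t"
    using gseq_step.slide[OF h(1), of g y m] yz by simp
  moreover have s: "(g, (e, y) # m) \<in> gseqs \<G> (src e) v" using n e g by (auto simp: normal_seqs_def)
  moreover have t: "?t \<in> gseqs \<G> (src e) v"
    using n e g h y by (auto simp: normal_seqs_def elim: gseqs_change_head)
  ultimately have st: "((g, (e, y) # m), ?t) \<in> gseq_sim \<G> (src e) v" by (rule gseq_sim_step)
  show ?thesis
  proof (cases "?z = \<one>\<^bsub>VG (tgt e)\<^esub> \<and> m \<noteq> [] \<and> fst (hd m) = bar e")
    case True
    then obtain x m' where m: "m = (bar e, x) # m'" by (cases m) auto
    have x: "(x, m') \<in> gseqs \<G> (src e) v" using t m e by simp
    then have xc: "x \<in> carrier (VG (src e))" using gseqs_closed by blast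
    have eq: "lmul (src e) g (push e (y, m)) = (g \<otimes>\<^bsub>VG (src e)\<^esub> inc (bar e) ?h \<otimes>\<^bsub>VG (src e)\<^esub> x, m')"
      using True m g h xc by (simp add: push_def lmul_def b.H.m_assoc)
    have "gseq_step \<G> ?t (g \<otimes>\<^bsub>VG (src e)\<^esub> inc (bar e) ?h \<otimes>\<^bsub>VG (src e)\<^esub> x, m')"
      using True m gseq_step.cancel[of \<G> "g \<otimes>\<^bsub>VG (src e)\<^esub> inc (bar e) ?h" e x m'] by simp
    moreover have "(g \<otimes>\<^bsub>VG (src e)\<^esub> inc (bar e) ?h \<otimes>\<^bsub>VG (src e)\<^esub> x, m') \<in> gseqs \<G> (src e) v"
      using x xc g h by (auto elim: gseqs_change_head)
    ultimately show ?thesis using st t gseq_sim_step gseq_sim_trans eq by metis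
  next
    case False
    then have "lmul (src e) g (push e (y, m)) = ?t" by (auto simp: push_def lmul_def)
    then show ?thesis using st by simp
  qed
qed

lemma gseq_sim_nf: "s \<in> gseqs \<G> u v \<Longrightarrow> (s, nf v s) \<in> gseq_sim \<G> u v"
proof (cases s)
  case (Pair g l)
  assume "s \<in> gseqs \<G> u v"
  then show ?thesis unfolding Pair
  proof (induction l arbitrary: g u)
    case Nil
    then have v: "u = v" "u \<in> Vs" "g \<in> carrier (VG v)" by auto
    interpret group "VG v" using v group_VG by simp
    have "nf v (g, []) = (g, [])" using v by (simp add: nf_def lmul_def)
    then show ?case using gseq_sim_refl[OF Nil] v by simp
  next
    case (Cons a l)
    obtain e x where a: "a = (e, x)" by (cases a)
    have e: "e \<in> Es" "src e = u" "g \<in> carrier (VG (src e))" "(x, l) \<in> gseqs \<G> (tgt e) v" using Cons a by auto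
    obtain y m where ym: "nf v (x, l) = (y, m)" by (cases "nf v (x, l)")
    have "((x, l), (y, m)) \<in> gseq_sim \<G> (tgt e) v" using Cons.IH[OF e(4)] ym by simp
    from gseq_sim_Cons[OF this e(1,3)]
    have 1: "((g, (e, x) # l), (g, (e, y) # m)) \<in> gseq_sim \<G> u v" using e by simp
    have "(y, m) \<in> normal_seqs (tgt e) v" using nf_normal[OF e(4)] ym by simp
    from gseq_sim_push[OF e(1) this e(3)]
    have 2: "((g, (e, y) # m), nf v (g, (e, x) # l)) \<in> gseq_sim \<G> u v" using e ym by (simp add: nf_def)
    show ?case using gseq_sim_trans[OF 1 2] a by simp
  qed
qed

lemma gseq_sim_gseqs: "(s, t) \<in> gseq_sim \<G> u v \<Longrightarrow> s \<in> gseqs \<G> u v" "(s, t) \<in> gseq_sim \<G> u v \<Longrightarrow> t \<in> gseqs \<G> u v"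
  by (auto simp: gseq_sim_def)

text \<open>The normal form theorem: equivalent sequences act in the same way and so have the same normal form;
  conversely every sequence is equivalent to its normal form.\<close>

theorem gseq_sim_iff_nf:
  "(s, t) \<in> gseq_sim \<G> u v \<longleftrightarrow> s \<in> gseqs \<G> u v \<and> t \<in> gseqs \<G> u v \<and> nf v s = nf v t"
proof
  assume st: "(s, t) \<in> gseq_sim \<G> u v"
  then have "v \<in> Vs" using gseq_sim_gseqs gseqs_verts by (cases s) blast
  then show "s \<in> gseqs \<G> u v \<and> t \<in> gseqs \<G> u v \<and> nf v s = nf v t"
    using act_sim[OF st unit_normal] gseq_sim_gseqs[OF st] by (simp add: nf_def)
next
  assume "s \<in> gseqs \<G> u v \<and> t \<in> gseqs \<G> u v \<and> nf v s = nf v t"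
  then show "(s, t) \<in> gseq_sim \<G> u v"
    using gseq_sim_nf gseq_sim_sym gseq_sim_trans by metis
qed

lemma nf_of_normal: "n \<in> normal_seqs u v \<Longrightarrow> nf v n = n"
proof (cases n)
  case (Pair g l)
  assume "n \<in> normal_seqs u v"
  then show ?thesis unfolding Pair
  proof (induction l arbitrary: g u)
    case Nil
    then have v: "u = v" "u \<in> Vs" "g \<in> carrier (VG v)" by (auto simp: normal_seqs_def)
    interpret group "VG v" using v group_VG by simp
    show ?case using v by (simp add: nf_def lmul_def)
  next
    case (Cons a l)
    obtain e x where a: "a = (e, x)" by (cases a)
    have e: "e \<in> Es" "src e = u" "g \<in> carrier (VG (src e))" "(x, l) \<in> normal_seqs (tgt e) v"
      and x: "coset_rep e x = x" "\<not> (x = \<one>\<^bsub>VG (tgt e)\<^esub> \<and> l \<noteq> [] \<and> fst (hd l) = bar e)"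
      using Cons a by (auto simp: normal_seqs_Cons)
    interpret b: group_hom "EG e" "VG (src e)" "inc (bar e)" using e(1) by (rule group_hom_inc_bar)
    have xc: "x \<in> carrier (VG (tgt e))" using normal_seqs_fst[OF e(4)] by simp
    have "act v (x, l) (\<one>\<^bsub>VG v\<^esub>, []) = (x, l)" using Cons.IH[OF e(4)] by (simp add: nf_def)
    then show ?case using a x e edge_part_of_rep[OF e(1) xc x(1)] by (auto simp: nf_def push_def lmul_def)
  qed
qed

subsection \<open>Concatenation\<close>

lemma concat_Cons: "gseq_concat \<G> v (g, (e, x) # l) t =
    (g, (e, fst (gseq_concat \<G> v (x, l) t)) # snd (gseq_concat \<G> v (x, l) t))"
  by (simp add: split_def Let_def)

lemma concat_gseqs:
  assumes "s \<in> gseqs \<G> u v" "t \<in> gseqs \<G> v w"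
  shows "gseq_concat \<G> v s t \<in> gseqs \<G> u w"
proof -
  obtain g l where s: "s = (g, l)" by (cases s)
  obtain g' l' where t: "t = (g', l')" by (cases t)
  show ?thesis using assms(1) unfolding s
  proof (induction l arbitrary: g u)
    case Nil
    then have v: "v \<in> Vs" "g \<in> carrier (VG v)" "u = v" by auto
    interpret group "VG v" using v group_VG by simp
    have "g' \<in> carrier (VG v)" using assms(2) t gseqs_closed by blast
    then show ?case using assms(2) t v by (auto elim: gseqs_change_head)
  next
    case (Cons a l)
    then show ?case by (cases a) (simp add: concat_Cons del: gseq_concat.simps)
  qed
qed

lemma act_concat:
  assumes "s \<in> gseqs \<G> u v" "t \<in> gseqs \<G> v w" "n \<in> normal_seqs w z"
  shows "act w (gseq_concat \<G> v s t) n = act v s (act w t n)"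
proof -
  obtain g l where s: "s = (g, l)" by (cases s)
  obtain g' l' where t: "t = (g', l')" by (cases t)
  show ?thesis using assms(1) unfolding s
  proof (induction l arbitrary: g u)
    case Nil
    then show ?case using act_lmul[of g' l' v w g n z] assms t by auto
  next
    case (Cons a l)
    obtain e x where a: "a = (e, x)" by (cases a)
    then have "(x, l) \<in> gseqs \<G> (tgt e) v" using Cons.prems by simp
    from Cons.IH[OF this] show ?case using a by (simp add: concat_Cons del: gseq_concat.simps)
  qed
qed

lemma nf_concat:
  assumes "s \<in> gseqs \<G> u v" "t \<in> gseqs \<G> v w"
  shows "nf w (gseq_concat \<G> v s t) = act v s (nf w t)"
proof -
  have "w \<in> Vs" using assms(2) gseqs_verts by (cases t) blast
  then show ?thesis unfolding nf_def by (rule act_concat[OF assms unit_normal])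
qed

section \<open>Cancellation in products\<close>

text \<open>
  Left multiplication of \<open>s\<close> by the group at its initial vertex \<open>u\<close> does not change \<open>edges v s\<close>, and two
  sequences with the same \<open>edges\<close> differ by such a multiplication (\<open>edges_eq_imp_translate\<close> below). The
  list stands for the coset \<open>G\<^sub>u s\<close>.\<close>

abbreviation "edges v s \<equiv> snd (nf v s)"

text \<open>The edges of a normal form are applied from the last one to the first one, each of them popping an
  entry of the list of \<open>n\<close> or pushing one. The pops come first: if \<open>bar e\<close> has just been pushed and \<open>e\<close> is
  applied next, then popping would force the entry between these two edges of the normal form to be
  trivial, which contradicts normality. So \<open>j\<close> pops are followed by \<open>length k\<close> pushes. The last conjunct
  is what the induction needs to know about the edge pushed last.\<close>

lemma act_stack:
  assumes "(g, l) \<in> normal_seqs u v" "n \<in> normal_seqs v w"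
  shows "\<exists>j k. snd (act v (g, l) n) = k @ drop j (snd n) \<and> j \<le> length (snd n) \<and> length k + j = length l \<and>
    (k \<noteq> [] \<longrightarrow> fst (hd k) = fst (hd l) \<and>
      (\<exists>h\<in>carrier (EG (fst (hd l))). fst (act v (g, l) n) = g \<otimes>\<^bsub>VG u\<^esub> inc (bar (fst (hd l))) h))"
  using assms(1)
proof (induction l arbitrary: g u)
  case Nil
  then show ?case by (intro exI[of _ 0] exI[of _ "[]"]) (simp add: lmul_def)
next
  case (Cons a l)
  obtain e x where a: "a = (e, x)" by (cases a)
  have e: "e \<in> Es" "src e = u" "g \<in> carrier (VG u)" "(x, l) \<in> normal_seqs (tgt e) v"
    and x: "coset_rep e x = x" "\<not> (x = \<one>\<^bsub>VG (tgt e)\<^esub> \<and> l \<noteq> [] \<and> fst (hd l) = bar e)"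
    using Cons.prems a by (auto simp: normal_seqs_Cons)
  interpret i: group_hom "EG e" "VG (tgt e)" "inc e" using e(1) by (rule group_hom_inc)
  obtain y m where ym: "act v (x, l) n = (y, m)" by (cases "act v (x, l) n")
  have N: "(y, m) \<in> normal_seqs (tgt e) v'" if "v' = w" for v'
    using act_normal[OF normal_seqs_gseqs[OF e(4)] assms(2)] ym that by simp
  have yc: "y \<in> carrier (VG (tgt e))" using normal_seqs_fst[OF N[OF refl]] by simp
  have xc: "x \<in> carrier (VG (tgt e))" using normal_seqs_fst[OF e(4)] by simp
  obtain j k where jk: "m = k @ drop j (snd n)" "j \<le> length (snd n)" "length k + j = length l"
    "k \<noteq> [] \<Longrightarrow> fst (hd k) = fst (hd l)"
    "k \<noteq> [] \<Longrightarrow> \<exists>h\<in>carrier (EG (fst (hd l))). y = x \<otimes>\<^bsub>VG (tgt e)\<^esub> inc (bar (fst (hd l))) h"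
    using Cons.IH[OF e(4)] ym by auto
  have act: "act v (g, a # l) n = lmul u g (push e (y, m))" using a e ym by simp
  show ?case
  proof (cases "coset_rep e y = \<one>\<^bsub>VG (tgt e)\<^esub> \<and> m \<noteq> [] \<and> fst (hd m) = bar e")
    case True
    \<comment> \<open>popping an edge that was pushed before would make \<open>x\<close> trivial\<close>
    have "k = []"
    proof (rule ccontr)
      assume k: "k \<noteq> []"
      then have l: "l \<noteq> []" "fst (hd l) = bar e" using jk(1,3,4) True by auto
      obtain h where h: "h \<in> carrier (EG e)" "y = x \<otimes>\<^bsub>VG (tgt e)\<^esub> inc e h"
        using jk(5)[OF k] l e edge_group_rev by auto
      obtain k' where k': "k' \<in> carrier (EG e)" "y = inc e k'"
        using edge_part[OF e(1) yc] True by auto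
      have "x = inc e k' \<otimes>\<^bsub>VG (tgt e)\<^esub> inv\<^bsub>VG (tgt e)\<^esub> inc e h"
        using h k' xc by (intro i.H.inv_solve_right[THEN iffD2]) auto
      also have "\<dots> = inc e (k' \<otimes>\<^bsub>EG e\<^esub> inv\<^bsub>EG e\<^esub> h)" using h k' by simp
      finally have "coset_rep e x = \<one>\<^bsub>VG (tgt e)\<^esub>"
        using coset_rep_inc(1)[OF e(1), of "k' \<otimes>\<^bsub>EG e\<^esub> inv\<^bsub>EG e\<^esub> h"] h k' by simp
      then have "x = \<one>\<^bsub>VG (tgt e)\<^esub>" using x by simp
      then show False using x l by simp
    qed
    moreover from this have "m = drop j (snd n)" "j = length l" using jk by auto
    moreover from this have "j < length (snd n)" using True by (metis drop_all not_le_imp_less)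
    ultimately show ?thesis using True
      by (intro exI[of _ "Suc j"] exI[of _ "[]"]) (simp add: act lmul_def push_def drop_Suc tl_drop)
  next
    case False
    then have "push e (y, m) = (inc (bar e) (edge_part e y), (e, coset_rep e y) # m)"
      by (auto simp: push_def)
    then have p: "act v (g, a # l) n = (g \<otimes>\<^bsub>VG u\<^esub> inc (bar e) (edge_part e y), (e, coset_rep e y) # m)"
      by (simp add: act lmul_def)
    show ?thesis
      unfolding p using jk(1-3) edge_part(1)[OF e(1) yc] a
      by (intro exI[of _ j] exI[of _ "(e, coset_rep e y) # k"]) auto
  qed
qed

lemma act_nf:
  assumes "s \<in> gseqs \<G> u v" "n \<in> normal_seqs v w"
  shows "act v (nf v s) n = act v s n"
  using act_sim[OF gseq_sim_nf[OF assms(1)] assms(2)] by simp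

lemma act_edges:
  assumes "s \<in> gseqs \<G> u v" "n \<in> normal_seqs v w"
  obtains j k where "snd (act v s n) = k @ drop j (snd n)" "j \<le> length (snd n)"
    "length k + j = length (edges v s)"
proof -
  obtain g l where gl: "nf v s = (g, l)" by (cases "nf v s")
  have "(g, l) \<in> normal_seqs u v" using nf_normal[OF assms(1)] gl by simp
  from act_stack[OF this assms(2)] show thesis using act_nf[OF assms] gl that by auto
qed

lemma edges_concat:
  assumes "s \<in> gseqs \<G> u v" "t \<in> gseqs \<G> v w"
  obtains j k where "edges w (gseq_concat \<G> v s t) = k @ drop j (edges w t)" "j \<le> length (edges w t)"
    "length k + j = length (edges v s)"
  by (rule act_edges[OF assms(1) nf_normal[OF assms(2)]]) (use nf_concat[OF assms] that in auto)

lemma length_edges_le: "s \<in> gseqs \<G> u v \<Longrightarrow> length (edges v s) \<le> length (snd s)"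
proof (cases s)
  case (Pair g l)
  have *: "length (snd (push e n)) \<le> Suc (length (snd n))" for e n by (auto simp: push_def)
  have "length (edges v (g, l)) \<le> length l" for g l
  proof (induction l arbitrary: g)
    case (Cons a l)
    obtain e x where a: "a = (e, x)" by (cases a)
    show ?case using *[of e "act v (x, l) (\<one>\<^bsub>VG v\<^esub>, [])"] Cons[of x] a
      by (simp add: nf_def lmul_def)
  qed (simp add: nf_def lmul_def)
  then show ?thesis using Pair by simp
qed

text \<open>The list of \<open>s\<close> arises from the empty list by pushing and popping one entry at a time, one step for
  each edge of \<open>s\<close>. Hence each of its suffixes is the complete list at some stage, that is, the list of a
  final part of \<open>s\<close>. In the tree of spaces: a path meets all vertex spaces that separate its endpoints.\<close>

lemma suffix_of_edges:
  assumes "s \<in> gseqs \<G> u v"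
  shows "\<exists>u' s'. s' \<in> gseqs \<G> u' v \<and> edges v s' = drop i (edges v s) \<and>
    gseq_length \<G> S u' s' \<le> gseq_length \<G> S u s"
proof (cases s)
  case (Pair g l)
  show ?thesis using assms unfolding Pair
  proof (induction l arbitrary: g u i)
    case Nil
    then show ?case by (intro exI[of _ u] exI[of _ "(g, [])"]) (auto simp: nf_def lmul_def)
  next
    case (Cons a l)
    obtain e x where a: "a = (e, x)" by (cases a)
    have xl: "(x, l) \<in> gseqs \<G> (tgt e) v" using Cons.prems a by simp
    have len: "gseq_length \<G> S (tgt e) (x, l) \<le> gseq_length \<G> S u (g, a # l)" using a by simp
    have IH: "\<exists>u' s'. s' \<in> gseqs \<G> u' v \<and> edges v s' = drop i (edges v (x, l)) \<and>
      gseq_length \<G> S u' s' \<le> gseq_length \<G> S u (g, a # l)" for i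
      using Cons.IH[OF xl, of i] len le_trans by blast
    have "edges v (g, a # l) = snd (push e (nf v (x, l)))" using a by (simp add: nf_def lmul_def)
    then consider "edges v (g, a # l) = drop 1 (edges v (x, l))"
      | z where "edges v (g, a # l) = z # edges v (x, l)"
      by (auto simp: push_def drop_Suc split: if_splits)
    then show ?case
    proof cases
      case 1
      then show ?thesis using IH[of "i + 1"] by simp
    next
      case 2
      show ?thesis
      proof (cases i)
        case 0
        then show ?thesis using Cons.prems by (intro exI[of _ u] exI[of _ "(g, a # l)"]) auto
      next
        case (Suc i')
        then show ?thesis using 2 IH[of i'] by simp
      qed
    qed
  qed
qed

lemma edges_determine_start:
  assumes "s \<in> gseqs \<G> u v" "t \<in> gseqs \<G> u' v" "edges v s = edges v t"
  shows "u = u'"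
proof -
  have "nf v s \<in> gseqs \<G> u v" "nf v t \<in> gseqs \<G> u' v" using nf_normal normal_seqs_gseqs assms by blast+
  then show ?thesis using assms(3) by (cases "nf v s"; cases "nf v t"; cases "edges v s") auto
qed

lemma edges_eq_imp_translate:
  assumes "s \<in> gseqs \<G> u v" "t \<in> gseqs \<G> u v" "edges v s = edges v t"
  shows "\<exists>g\<in>carrier (VG u). nf v s = lmul u g (nf v t)"
proof -
  have s: "nf v s \<in> normal_seqs u v" and t: "nf v t \<in> normal_seqs u v" using nf_normal assms by auto
  interpret group "VG u" using normal_seqs_verts(1)[OF s] by (rule group_VG)
  note c = normal_seqs_fst[OF s] normal_seqs_fst[OF t]
  show ?thesis
    using c assms(3) by (intro bexI[of _ "fst (nf v s) \<otimes>\<^bsub>VG u\<^esub> inv\<^bsub>VG u\<^esub> fst (nf v t)"])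
      (auto simp: lmul_def m_assoc prod_eq_iff)
qed

section \<open>Inverse sequences\<close>

text \<open>The sequence \<open>(g\<^sub>k\<^sup>-\<^sup>1, bar e\<^sub>k, \<dots>, bar e\<^sub>1, g\<^sub>0\<^sup>-\<^sup>1)\<close>.\<close>

fun gseq_inv :: "'v \<Rightarrow> ('a, 'e) gseq \<Rightarrow> ('a, 'e) gseq" where
  "gseq_inv v (g, []) = (inv\<^bsub>VG v\<^esub> g, [])"
| "gseq_inv v (g, (e, x) # l) =
    gseq_concat \<G> (tgt e) (gseq_inv v (x, l)) (\<one>\<^bsub>VG (tgt e)\<^esub>, [(bar e, inv\<^bsub>VG (src e)\<^esub> g)])"

lemma length_concat: "length (snd (gseq_concat \<G> v s t)) = length (snd s) + length (snd t)"
proof (cases s; cases t)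
  fix g l g' l' assume st: "s = (g, l)" "t = (g', l')"
  have "length (snd (gseq_concat \<G> v (g, l) t)) = length l + length (snd t)" for g
  proof (induction l arbitrary: g)
    case (Cons a l)
    then show ?case by (cases a) (simp add: concat_Cons del: gseq_concat.simps)
  qed (simp add: st)
  then show ?thesis by (simp add: st)
qed

lemma length_inv: "length (snd (gseq_inv v s)) = length (snd s)"
proof (cases s)
  case (Pair g l)
  have "length (snd (gseq_inv v (g, l))) = length l" for g
  proof (induction l arbitrary: g)
    case (Cons a l)
    then show ?case by (cases a) (simp add: length_concat)
  qed simp
  then show ?thesis by (simp add: Pair)
qed

lemma back_edge_gseqs:
  assumes "e \<in> Es" "g \<in> carrier (VG (src e))"
  shows "(\<one>\<^bsub>VG (tgt e)\<^esub>, [(bar e, inv\<^bsub>VG (src e)\<^esub> g)]) \<in> gseqs \<G> (tgt e) (src e)"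
proof -
  interpret i: group_hom "EG e" "VG (tgt e)" "inc e" using assms(1) by (rule group_hom_inc)
  interpret b: group_hom "EG e" "VG (src e)" "inc (bar e)" using assms(1) by (rule group_hom_inc_bar)
  show ?thesis using assms by simp
qed

lemma gseq_inv_gseqs:
  assumes "s \<in> gseqs \<G> u v"
  shows "gseq_inv v s \<in> gseqs \<G> v u"
proof (cases s)
  case (Pair g l)
  show ?thesis using assms unfolding Pair
  proof (induction l arbitrary: g u)
    case Nil
    then have v: "v \<in> Vs" "g \<in> carrier (VG v)" "u = v" by auto
    interpret group "VG v" using v group_VG by simp
    show ?case using v by simp
  next
    case (Cons a l)
    obtain e x where a: "a = (e, x)" by (cases a)
    have e: "e \<in> Es" "g \<in> carrier (VG (src e))" "src e = u" "(x, l) \<in> gseqs \<G> (tgt e) v" using Cons.prems a by auto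
    show ?case using concat_gseqs[OF Cons.IH[OF e(4)] back_edge_gseqs[OF e(1,2)]] a e by simp
  qed
qed

lemma act_back_edge:
  assumes e: "e \<in> Es" "g \<in> carrier (VG (src e))" and n: "n \<in> normal_seqs (src e) w"
  shows "act (src e) (\<one>\<^bsub>VG (tgt e)\<^esub>, [(bar e, inv\<^bsub>VG (src e)\<^esub> g)]) n
    = push (bar e) (lmul (src e) (inv\<^bsub>VG (src e)\<^esub> g) n)"
proof -
  interpret b: group_hom "EG e" "VG (src e)" "inc (bar e)" using e(1) by (rule group_hom_inc_bar)
  have "push (bar e) (lmul (src e) (inv\<^bsub>VG (src e)\<^esub> g) n) \<in> normal_seqs (tgt e) w"
    using push_normal[of "bar e" "lmul (src e) (inv\<^bsub>VG (src e)\<^esub> g) n" w] lmul_normal[OF _ n] e by simp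
  then show ?thesis using e lmul_one by simp
qed

lemma act_inv:
  assumes "s \<in> gseqs \<G> u v"
  shows "n \<in> normal_seqs v w \<Longrightarrow> act u (gseq_inv v s) (act v s n) = n" (is "?N n \<Longrightarrow> ?P s n")
    and "n \<in> normal_seqs u w \<Longrightarrow> act v s (act u (gseq_inv v s) n) = n"
proof -
  obtain g l where gl: "s = (g, l)" by (cases s)
  have "(n \<in> normal_seqs v w \<longrightarrow> act u (gseq_inv v (g, l)) (act v (g, l) n) = n) \<and>
    (n \<in> normal_seqs u w \<longrightarrow> act v (g, l) (act u (gseq_inv v (g, l)) n) = n)" for n
    using assms unfolding gl
  proof (induction l arbitrary: g u n)
    case Nil
    then have v: "v \<in> Vs" "g \<in> carrier (VG v)" "u = v" by auto
    interpret group "VG v" using v group_VG by simp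
    show ?case using v by (auto simp: lmul_lmul[where v = w] lmul_one)
  next
    case (Cons a l)
    obtain e x where a: "a = (e, x)" by (cases a)
    have e: "e \<in> Es" "g \<in> carrier (VG (src e))" "src e = u" "(x, l) \<in> gseqs \<G> (tgt e) v" using Cons.prems a by auto
    interpret b: group_hom "EG e" "VG (src e)" "inc (bar e)" using e(1) by (rule group_hom_inc_bar)
    have ig: "inv\<^bsub>VG (src e)\<^esub> g \<in> carrier (VG (src e))" "inv\<^bsub>VG (src e)\<^esub> g \<otimes>\<^bsub>VG (src e)\<^esub> g = \<one>\<^bsub>VG (src e)\<^esub>"
      "g \<otimes>\<^bsub>VG (src e)\<^esub> inv\<^bsub>VG (src e)\<^esub> g = \<one>\<^bsub>VG (src e)\<^esub>" using e(2) by simp_all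
    have inv: "gseq_inv v (x, l) \<in> gseqs \<G> v (tgt e)" using e by (intro gseq_inv_gseqs)
    have *: "act u (gseq_inv v (g, a # l)) m = act (tgt e) (gseq_inv v (x, l)) (push (bar e) (lmul (src e) (inv\<^bsub>VG (src e)\<^esub> g) m))"
      if "m \<in> normal_seqs u w" for m
      using act_concat[OF inv back_edge_gseqs[OF e(1,2)], of m w] act_back_edge[OF e(1,2), of m w] that a e by simp
    show ?case
    proof (intro conjI impI)
      assume n: "n \<in> normal_seqs v w"
      have A: "act v (x, l) n \<in> normal_seqs (tgt e) w" using act_normal[OF e(4) n] .
      have B: "push e (act v (x, l) n) \<in> normal_seqs (src e) w" using push_normal[OF e(1) A] .
      have "act u (gseq_inv v (g, a # l)) (act v (g, a # l) n) =
        act (tgt e) (gseq_inv v (x, l)) (push (bar e) (lmul (src e) (inv\<^bsub>VG (src e)\<^esub> g) (lmul (src e) g (push e (act v (x, l) n)))))"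
        using * lmul_normal[OF e(2) B] a e by simp
      also have "lmul (src e) (inv\<^bsub>VG (src e)\<^esub> g) (lmul (src e) g (push e (act v (x, l) n))) = push e (act v (x, l) n)"
        using lmul_lmul[OF ig(1) e(2) B] ig(2) lmul_one[OF B] by simp
      also have "push (bar e) \<dots> = act v (x, l) n"
        using push_push_bar[of "bar e" "act v (x, l) n" w] A e by simp
      finally show "act u (gseq_inv v (g, a # l)) (act v (g, a # l) n) = n" using Cons.IH[OF e(4)] n by simp
    next
      assume n: "n \<in> normal_seqs u w"
      then have n': "n \<in> normal_seqs (src e) w" using e by simp
      have A: "lmul (src e) (inv\<^bsub>VG (src e)\<^esub> g) n \<in> normal_seqs (src e) w" using lmul_normal[OF ig(1) n'] .
      have B: "push (bar e) (lmul (src e) (inv\<^bsub>VG (src e)\<^esub> g) n) \<in> normal_seqs (tgt e) w"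
        using push_normal[of "bar e"] A e by simp
      have "act v (g, a # l) (act u (gseq_inv v (g, a # l)) n)
        = lmul (src e) g (push e (act v (x, l) (act (tgt e) (gseq_inv v (x, l)) (push (bar e) (lmul (src e) (inv\<^bsub>VG (src e)\<^esub> g) n)))))"
        using *[OF n] a by simp
      also have "act v (x, l) (act (tgt e) (gseq_inv v (x, l)) (push (bar e) (lmul (src e) (inv\<^bsub>VG (src e)\<^esub> g) n)))
        = push (bar e) (lmul (src e) (inv\<^bsub>VG (src e)\<^esub> g) n)" using Cons.IH[OF e(4)] B by blast
      also have "push e \<dots> = lmul (src e) (inv\<^bsub>VG (src e)\<^esub> g) n" using push_push_bar[OF e(1) A] .
      also have "lmul (src e) g \<dots> = n" using lmul_lmul[OF e(2) ig(1) n'] ig(3) lmul_one[OF n'] by simp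
      finally show "act v (g, a # l) (act u (gseq_inv v (g, a # l)) n) = n" .
    qed
  qed
  then show "n \<in> normal_seqs v w \<Longrightarrow> ?P s n" "n \<in> normal_seqs u w \<Longrightarrow> act v s (act u (gseq_inv v s) n) = n"
    using gl by auto
qed

text \<open>The inverse of the normal form has the same number of edges as the normal form, and normalising it
  cannot increase this number. This gives one inequality; the other one is obtained from it for the
  inverse sequence.\<close>

lemma length_edges_inv:
  assumes s: "s \<in> gseqs \<G> u v"
  shows "length (edges u (gseq_inv v s)) = length (edges v s)"
proof -
  have le: "length (edges u (gseq_inv v s)) \<le> length (edges v s)" if s: "s \<in> gseqs \<G> u v" for s u v
  proof -
    have N: "nf v s \<in> gseqs \<G> u v" using nf_normal[OF s] by (rule normal_seqs_gseqs)
    have "u \<in> Vs" using gseqs_verts s by (cases s) blast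
    then have 1: "(\<one>\<^bsub>VG u\<^esub>, []) \<in> normal_seqs u u" by (rule unit_normal)
    have i: "gseq_inv v s \<in> gseqs \<G> v u" using gseq_inv_gseqs[OF s] .
    have "nf u (gseq_inv v (nf v s)) = nf u (gseq_inv v s)"
    proof -
      have "act u (gseq_inv v s) (\<one>\<^bsub>VG u\<^esub>, []) \<in> normal_seqs v u" using act_normal[OF i 1] .
      then show ?thesis
        using act_inv(1)[OF N, of "act u (gseq_inv v s) (\<one>\<^bsub>VG u\<^esub>, [])" u] act_inv(2)[OF s 1] act_nf[OF s]
        unfolding nf_def by simp
    qed
    then have "edges u (gseq_inv v s) = edges u (gseq_inv v (nf v s))" by simp
    also have "length \<dots> \<le> length (snd (gseq_inv v (nf v s)))" using gseq_inv_gseqs[OF N] by (rule length_edges_le)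
    finally show ?thesis by (simp add: length_inv)
  qed
  have i: "gseq_inv v s \<in> gseqs \<G> v u" using gseq_inv_gseqs[OF s] .
  have "v \<in> Vs" using gseqs_verts s by (cases s) blast
  then have 1: "(\<one>\<^bsub>VG v\<^esub>, []) \<in> normal_seqs v v" by (rule unit_normal)
  have "act v s (\<one>\<^bsub>VG v\<^esub>, []) \<in> normal_seqs u v" using act_normal[OF s 1] .
  then have "act v (gseq_inv u (gseq_inv v s)) (\<one>\<^bsub>VG v\<^esub>, []) = act v s (\<one>\<^bsub>VG v\<^esub>, [])"
    using act_inv(1)[OF i, of "act v s (\<one>\<^bsub>VG v\<^esub>, [])" v] act_inv(1)[OF s 1] by simp
  then have "length (edges v s) \<le> length (edges u (gseq_inv v s))" using le[OF i] by (simp add: nf_def)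
  then show ?thesis using le[OF s] by simp
qed

section \<open>Lengths of sequences\<close>

definition vertex_generators :: "('v \<Rightarrow> 'a set) \<Rightarrow> bool" where
  "vertex_generators S \<longleftrightarrow> (\<forall>v\<in>Vs. finite_generating_set (VG v) (S v))"

lemma gseq_length_Cons:
  "gseq_length \<G> S u (g, (e, x) # l) = Suc (word_length (VG u) (S u) g + gseq_length \<G> S (tgt e) (x, l))"
  by simp

lemma gseq_length_concat:
  assumes S: "vertex_generators S" and "s \<in> gseqs \<G> u v" "t \<in> gseqs \<G> v w"
  shows "gseq_length \<G> S u (gseq_concat \<G> v s t) \<le> gseq_length \<G> S u s + gseq_length \<G> S v t"
proof -
  obtain g l where s: "s = (g, l)" by (cases s)
  obtain g' l' where t: "t = (g', l')" by (cases t)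
  show ?thesis using assms(2) unfolding s
  proof (induction l arbitrary: g u)
    case Nil
    then have v: "v \<in> Vs" "g \<in> carrier (VG v)" "u = v" by auto
    have "g' \<in> carrier (VG v)" using assms(3) t gseqs_closed by blast
    then show ?case using v t S group.word_length_mult[OF group_VG[OF v(1)], of "S v" g g']
      by (simp add: vertex_generators_def)
  next
    case (Cons a l)
    obtain e x where a: "a = (e, x)" by (cases a)
    then have "(x, l) \<in> gseqs \<G> (tgt e) v" using Cons.prems by simp
    from Cons.IH[OF this] show ?case using a
      by (simp add: concat_Cons gseq_length_Cons del: gseq_concat.simps gseq_length.simps)
  qed
qed

lemma gseq_length_inv:
  assumes S: "vertex_generators S" and "s \<in> gseqs \<G> u v"
  shows "gseq_length \<G> S v (gseq_inv v s) \<le> gseq_length \<G> S u s"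
proof -
  obtain g l where s: "s = (g, l)" by (cases s)
  show ?thesis using assms(2) unfolding s
  proof (induction l arbitrary: g u)
    case Nil
    then have v: "v \<in> Vs" "g \<in> carrier (VG v)" "u = v" by auto
    then show ?case using S group.word_length_inv_le[OF group_VG[OF v(1)], of "S v" g]
      by (simp add: vertex_generators_def)
  next
    case (Cons a l)
    obtain e x where a: "a = (e, x)" by (cases a)
    have e: "e \<in> Es" "g \<in> carrier (VG (src e))" "src e = u" "(x, l) \<in> gseqs \<G> (tgt e) v" using Cons.prems a by auto
    have "gseq_length \<G> S v (gseq_inv v (g, a # l)) \<le> gseq_length \<G> S v (gseq_inv v (x, l)) +
       gseq_length \<G> S (tgt e) (\<one>\<^bsub>VG (tgt e)\<^esub>, [(bar e, inv\<^bsub>VG (src e)\<^esub> g)])"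
      using gseq_length_concat[OF S gseq_inv_gseqs[OF e(4)] back_edge_gseqs[OF e(1,2)]] a by simp
    also have "gseq_length \<G> S (tgt e) (\<one>\<^bsub>VG (tgt e)\<^esub>, [(bar e, inv\<^bsub>VG (src e)\<^esub> g)]) \<le> Suc (word_length (VG u) (S u) g)"
      using e S group.word_length_inv_le[OF group_VG, of u "S u" g] group.word_length_one[OF group_VG, of "tgt e" "S (tgt e)"]
      by (auto simp: vertex_generators_def)
    also have "gseq_length \<G> S v (gseq_inv v (x, l)) \<le> gseq_length \<G> S (tgt e) (x, l)" using Cons.IH[OF e(4)] .
    finally show ?case using a by (simp add: gseq_length_Cons del: gseq_length.simps)
  qed
qed

end

section \<open>The fundamental group\<close>

locale pointed_graph_of_groups = graph_of_groups \<G> for \<G> :: "('v, 'e, 'a, 'b) graph_of_groups" +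
  fixes v0 :: 'v
  assumes v0: "v0 \<in> Vs"
begin

abbreviation "loops \<equiv> gseqs \<G> v0 v0"
abbreviation "PG \<equiv> pi1 \<G> v0"
abbreviation "triv \<equiv> (\<one>\<^bsub>VG v0\<^esub>, [])"

definition cls :: "('a, 'e) gseq \<Rightarrow> ('a, 'e) gseq set" where
  "cls s = gseq_sim \<G> v0 v0 `` {s}"

lemma triv_normal: "triv \<in> normal_seqs v0 v0" using v0 by (rule unit_normal)

lemma triv_loop: "triv \<in> loops" using triv_normal by (rule normal_seqs_gseqs)

lemma in_cls_iff: "t \<in> cls s \<longleftrightarrow> s \<in> loops \<and> t \<in> loops \<and> nf v0 s = nf v0 t"
  by (auto simp: cls_def gseq_sim_iff_nf)

lemma cls_eq_iff:
  assumes "s \<in> loops" "t \<in> loops"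
  shows "cls s = cls t \<longleftrightarrow> nf v0 s = nf v0 t"
proof
  assume "cls s = cls t"
  then have "s \<in> cls t" using assms in_cls_iff[of s s] by simp
  then show "nf v0 s = nf v0 t" by (simp add: in_cls_iff)
next
  assume "nf v0 s = nf v0 t"
  then show "cls s = cls t" using assms by (auto simp: in_cls_iff)
qed

lemma carrier_pi1: "carrier PG = cls ` loops"
  by (auto simp: pi1_def quotient_def cls_def)

lemma one_pi1: "\<one>\<^bsub>PG\<^esub> = cls triv"
  by (simp add: pi1_def cls_def)

lemma mult_pi1:
  assumes "s \<in> loops" "t \<in> loops"
  shows "cls s \<otimes>\<^bsub>PG\<^esub> cls t = cls (gseq_concat \<G> v0 s t)"
proof -
  have "cls (gseq_concat \<G> v0 s' t') = cls (gseq_concat \<G> v0 s t)" if "s' \<in> cls s" "t' \<in> cls t" for s' t'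
  proof -
    have st: "s' \<in> loops" "t' \<in> loops" "nf v0 s' = nf v0 s" "nf v0 t' = nf v0 t"
      using that by (auto simp: in_cls_iff)
    then have "act v0 s' (nf v0 t') = act v0 s (nf v0 t)"
      using act_nf[OF _ nf_normal] assms by metis
    then show ?thesis using st assms by (simp add: cls_eq_iff concat_gseqs nf_concat)
  qed
  moreover have "s \<in> cls s" "t \<in> cls t" using assms by (auto simp: in_cls_iff)
  ultimately have "(\<Union>s'\<in>cls s. \<Union>t'\<in>cls t. cls (gseq_concat \<G> v0 s' t')) = cls (gseq_concat \<G> v0 s t)"
    by blast
  then show ?thesis by (simp add: pi1_def cls_def)
qed

lemma act_triv: "n \<in> normal_seqs v0 w \<Longrightarrow> act v0 triv n = n"
  using lmul_one by simp

lemma mult_inv_pi1: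
  assumes s: "s \<in> loops" shows "cls (gseq_inv v0 s) \<otimes>\<^bsub>PG\<^esub> cls s = \<one>\<^bsub>PG\<^esub>"
proof -
  have i: "gseq_inv v0 s \<in> loops" using s by (rule gseq_inv_gseqs)
  have "nf v0 (gseq_concat \<G> v0 (gseq_inv v0 s) s) = nf v0 triv"
    unfolding nf_concat[OF i s] unfolding nf_def using act_inv(1)[OF s triv_normal] act_triv[OF triv_normal] by (simp del: act.simps)
  then show ?thesis using concat_gseqs[OF i s] triv_loop i s by (simp only: mult_pi1 one_pi1 cls_eq_iff)
qed

lemma group_pi1: "group PG"
proof (rule groupI)
  fix x y assume "x \<in> carrier PG" "y \<in> carrier PG"
  then show "x \<otimes>\<^bsub>PG\<^esub> y \<in> carrier PG" by (auto simp: carrier_pi1 mult_pi1 intro: concat_gseqs)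
next
  show "\<one>\<^bsub>PG\<^esub> \<in> carrier PG" using triv_loop by (auto simp: one_pi1 carrier_pi1)
next
  fix x y z assume "x \<in> carrier PG" "y \<in> carrier PG" "z \<in> carrier PG"
  then obtain s t r where s: "s \<in> loops" "x = cls s" and t: "t \<in> loops" "y = cls t" and r: "r \<in> loops" "z = cls r"
    by (auto simp: carrier_pi1)
  note st = concat_gseqs[OF s(1) t(1)] and tr = concat_gseqs[OF t(1) r(1)]
  have "nf v0 (gseq_concat \<G> v0 (gseq_concat \<G> v0 s t) r) = nf v0 (gseq_concat \<G> v0 s (gseq_concat \<G> v0 t r))"
    unfolding nf_concat[OF st r(1)] nf_concat[OF s(1) tr] nf_concat[OF t(1) r(1)]
    using act_concat[OF s(1) t(1) nf_normal[OF r(1)]] .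
  then show "x \<otimes>\<^bsub>PG\<^esub> y \<otimes>\<^bsub>PG\<^esub> z = x \<otimes>\<^bsub>PG\<^esub> (y \<otimes>\<^bsub>PG\<^esub> z)"
    using s t r st tr by (simp add: mult_pi1 cls_eq_iff concat_gseqs)
next
  fix x assume "x \<in> carrier PG"
  then obtain s where s: "s \<in> loops" "x = cls s" by (auto simp: carrier_pi1)
  have "nf v0 s \<in> normal_seqs v0 v0" using nf_normal s by blast
  then show "\<one>\<^bsub>PG\<^esub> \<otimes>\<^bsub>PG\<^esub> x = x"
    using s triv_loop act_triv by (simp add: mult_pi1 one_pi1 concat_gseqs cls_eq_iff nf_concat del: act.simps gseq_concat.simps)
  show "\<exists>y\<in>carrier PG. y \<otimes>\<^bsub>PG\<^esub> x = \<one>\<^bsub>PG\<^esub>"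
    using s mult_inv_pi1 gseq_inv_gseqs by (intro bexI[of _ "cls (gseq_inv v0 s)"]) (auto simp: carrier_pi1)
qed

lemma inv_pi1: "s \<in> loops \<Longrightarrow> inv\<^bsub>PG\<^esub> (cls s) = cls (gseq_inv v0 s)"
  using mult_inv_pi1 gseq_inv_gseqs by (intro group.inv_equality[OF group_pi1]) (auto simp: carrier_pi1)

subsection \<open>Finite generation\<close>

lemma path_exists:
  assumes "v \<in> Vs"
  shows "\<exists>p. p \<in> gseqs \<G> v0 v"
proof -
  have "strongly_connected (base_graph \<G>)"
    using symmetric_connected_imp_strongly_connected sym_arcs connected_base by blast
  then have "v0 \<rightarrow>\<^sup>*\<^bsub>base_graph \<G>\<^esub> v" using assms v0 by (auto simp: strongly_connected_def)
  then obtain p where p: "awalk v0 p v" using reachable_awalk by blast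
  have "(\<one>\<^bsub>VG v0\<^esub>, map (\<lambda>e. (e, \<one>\<^bsub>VG (tgt e)\<^esub>)) p) \<in> gseqs \<G> v0 v"
    using p v0
  proof (induction p arbitrary: v0)
    case Nil
    then show ?case using group_VG by (auto simp: awalk_Nil_iff group.is_monoid monoid.one_closed)
  next
    case (Cons e p)
    then have "tgt e \<in> Vs" "awalk (tgt e) p v" "e \<in> Es" "src e = v0" "v0 \<in> Vs" by (auto simp: awalk_Cons_iff)
    then show ?case using Cons.IH[of "tgt e"] group_VG[of v0] by (simp add: group.is_monoid monoid.one_closed)
  qed
  then show ?thesis by blast
qed

definition base_path :: "'v \<Rightarrow> ('a, 'e) gseq" where
  "base_path v = (if v = v0 then triv else SOME p. p \<in> gseqs \<G> v0 v)"

lemma base_path: "v \<in> Vs \<Longrightarrow> base_path v \<in> gseqs \<G> v0 v"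
  using path_exists[of v] someI_ex[of "\<lambda>p. p \<in> gseqs \<G> v0 v"] triv_loop by (auto simp: base_path_def)

text \<open>Conjugation by the base paths makes every sequence a loop at \<open>v0\<close>, multiplicatively. Since the base
  path of \<open>v0\<close> is trivial, a loop at \<open>v0\<close> is then a product of the loops belonging to its entries and
  edges, and these are generated by finitely many.\<close>

definition based_loop :: "'v \<Rightarrow> 'v \<Rightarrow> ('a, 'e) gseq \<Rightarrow> ('a, 'e) gseq" where
  "based_loop u v s = gseq_concat \<G> v (gseq_concat \<G> u (base_path u) s) (gseq_inv v (base_path v))"

lemma gseqs_ends: "s \<in> gseqs \<G> u v \<Longrightarrow> u \<in> Vs" "s \<in> gseqs \<G> u v \<Longrightarrow> v \<in> Vs"
  by (cases s; auto dest: gseqs_verts)+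

lemma based_loop: 
  assumes "s \<in> gseqs \<G> u v" 
  shows "based_loop u v s \<in> loops"
    "n \<in> normal_seqs v0 w \<Longrightarrow> act v0 (based_loop u v s) n = act u (base_path u) (act v s (act v0 (gseq_inv v (base_path v)) n))"
proof -
  have u: "base_path u \<in> gseqs \<G> v0 u" and v: "gseq_inv v (base_path v) \<in> gseqs \<G> v v0"
    using base_path gseqs_ends[OF assms] gseq_inv_gseqs by auto
  show "based_loop u v s \<in> loops" using u v assms unfolding based_loop_def by (blast intro: concat_gseqs)
  show "act v0 (based_loop u v s) n = act u (base_path u) (act v s (act v0 (gseq_inv v (base_path v)) n))"
    if n: "n \<in> normal_seqs v0 w"
    unfolding based_loop_def act_concat[OF concat_gseqs[OF u assms] v n] act_concat[OF u assms act_normal[OF v n]] ..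
qed

lemma based_loop_concat:
  assumes "s \<in> gseqs \<G> u v" "t \<in> gseqs \<G> v w"
  shows "cls (based_loop u w (gseq_concat \<G> v s t)) = cls (based_loop u v s) \<otimes>\<^bsub>PG\<^esub> cls (based_loop v w t)"
proof -
  have p: "base_path v \<in> gseqs \<G> v0 v" and q: "gseq_inv w (base_path w) \<in> gseqs \<G> w v0"
    using base_path gseqs_ends[OF assms(2)] gseq_inv_gseqs by auto
  have st: "gseq_concat \<G> v s t \<in> gseqs \<G> u w" using assms by (rule concat_gseqs)
  let ?n = "act v0 (gseq_inv w (base_path w)) triv"
  have n: "?n \<in> normal_seqs w v0" using q triv_normal by (rule act_normal)
  have m: "act v (base_path v) (act w t ?n) \<in> normal_seqs v0 v0" "act w t ?n \<in> normal_seqs v v0"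
    using act_normal[OF p act_normal[OF assms(2) n]] act_normal[OF assms(2) n] by auto
  have "nf v0 (based_loop u w (gseq_concat \<G> v s t)) = act u (base_path u) (act v s (act w t ?n))"
    unfolding nf_def based_loop(2)[OF st triv_normal] using act_concat[OF assms n] by simp
  moreover have "nf v0 (gseq_concat \<G> v0 (based_loop u v s) (based_loop v w t)) = act u (base_path u) (act v s (act w t ?n))"
    unfolding nf_concat[OF based_loop(1)[OF assms(1)] based_loop(1)[OF assms(2)]]
    unfolding nf_def based_loop(2)[OF assms(2) triv_normal]
    unfolding based_loop(2)[OF assms(1) m(1)] using act_inv(1)[OF p m(2)] by simp
  ultimately show ?thesis
    using based_loop(1) assms st by (simp add: mult_pi1 cls_eq_iff concat_gseqs)
qed

lemma based_loop_base: "s \<in> loops \<Longrightarrow> cls (based_loop v0 v0 s) = cls s"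
proof -
  assume s: "s \<in> loops"
  interpret group "VG v0" using v0 by (rule group_VG)
  have "gseq_inv v0 (base_path v0) = triv" "base_path v0 = triv" by (simp_all add: base_path_def)
  then have "nf v0 (based_loop v0 v0 s) = nf v0 s"
    unfolding nf_def based_loop(2)[OF s triv_normal] using act_normal[OF s triv_normal] act_triv triv_normal
    by (simp del: act.simps)
  then show ?thesis using s based_loop(1)[OF s] by (simp add: cls_eq_iff)
qed

definition pi1_generators :: "('v \<Rightarrow> 'a set) \<Rightarrow> ('a, 'e) gseq set set" where
  "pi1_generators S = (\<Union>v\<in>Vs. (\<lambda>g. cls (based_loop v v (g, []))) ` S v) \<union>
    (\<lambda>e. cls (based_loop (src e) (tgt e) (\<one>\<^bsub>VG (src e)\<^esub>, [(e, \<one>\<^bsub>VG (tgt e)\<^esub>)]))) ` Es"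

lemma edge_gseqs: "e \<in> Es \<Longrightarrow> (\<one>\<^bsub>VG (src e)\<^esub>, [(e, \<one>\<^bsub>VG (tgt e)\<^esub>)]) \<in> gseqs \<G> (src e) (tgt e)"
  using group_VG by (auto simp: group.is_monoid monoid.one_closed)

lemma vertex_loop_hom:
  assumes "v \<in> Vs"
  shows "(\<lambda>g. cls (based_loop v v (g, []))) \<in> hom (VG v) PG"
proof (rule homI)
  fix g assume "g \<in> carrier (VG v)"
  then show "cls (based_loop v v (g, [])) \<in> carrier PG"
    using assms based_loop(1)[of "(g, [])" v v] by (auto simp: carrier_pi1)
next
  fix g h assume "g \<in> carrier (VG v)" "h \<in> carrier (VG v)"
  then show "cls (based_loop v v (g \<otimes>\<^bsub>VG v\<^esub> h, [])) = cls (based_loop v v (g, [])) \<otimes>\<^bsub>PG\<^esub> cls (based_loop v v (h, []))"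
    using assms based_loop_concat[of "(g, [])" v v "(h, [])" v] by simp
qed

lemma finite_generating_set_pi1:
  assumes S: "vertex_generators S"
  shows "finite_generating_set PG (pi1_generators S)"
proof -
  interpret P: group PG by (rule group_pi1)
  let ?X = "pi1_generators S"
  have SV: "finite (S v)" "S v \<subseteq> carrier (VG v)" "generate (VG v) (S v) = carrier (VG v)" if "v \<in> Vs" for v
    using S that by (auto simp: vertex_generators_def finite_generating_set_def)
  have fin: "finite ?X" using SV by (auto simp: pi1_generators_def)
  have car: "?X \<subseteq> carrier PG"
  proof
    fix x assume "x \<in> ?X"
    then consider v g where "v \<in> Vs" "g \<in> S v" "x = cls (based_loop v v (g, []))"
      | e where "e \<in> Es" "x = cls (based_loop (src e) (tgt e) (\<one>\<^bsub>VG (src e)\<^esub>, [(e, \<one>\<^bsub>VG (tgt e)\<^esub>)]))"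
      by (auto simp: pi1_generators_def)
    then show "x \<in> carrier PG"
    proof cases
      case 1
      then have "(g, []) \<in> gseqs \<G> v v" using SV by auto
      then show ?thesis using 1 based_loop(1) by (auto simp: carrier_pi1)
    next
      case 2
      then show ?thesis using based_loop(1)[OF edge_gseqs] by (auto simp: carrier_pi1)
    qed
  qed
  have sub: "subgroup (generate PG ?X) PG" using car by (rule P.generate_is_subgroup)
  have vert: "cls (based_loop v v (g, [])) \<in> generate PG ?X" if "v \<in> Vs" "g \<in> carrier (VG v)" for v g
  proof -
    let ?f = "\<lambda>g. cls (based_loop v v (g, []))"
    interpret h: group_hom "VG v" PG ?f
      using group_VG[OF that(1)] group_pi1 vertex_loop_hom[OF that(1)] by (simp add: group_hom_def group_hom_axioms_def)
    have "?f g \<in> ?f ` generate (VG v) (S v)" using SV that by auto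
    also have "\<dots> = generate PG (?f ` S v)" using h.generate_img SV(2)[OF that(1)] by simp
    also have "\<dots> \<subseteq> generate PG ?X" using that by (intro P.mono_generate) (auto simp: pi1_generators_def)
    finally show ?thesis .
  qed
  have gen: "cls (based_loop u v (g, l)) \<in> generate PG ?X" if "(g, l) \<in> gseqs \<G> u v" for g l u v
    using that
  proof (induction l arbitrary: g u)
    case Nil
    then show ?case using vert by auto
  next
    case (Cons a l)
    obtain e x where a: "a = (e, x)" by (cases a)
    have e: "e \<in> Es" "g \<in> carrier (VG (src e))" "src e = u" "u \<in> Vs" "(x, l) \<in> gseqs \<G> (tgt e) v" using Cons.prems a by auto
    interpret s: group "VG (src e)" using e by (simp add: group_VG)
    interpret t: group "VG (tgt e)" using e by (simp add: group_VG)
    let ?e = "(\<one>\<^bsub>VG (src e)\<^esub>, [(e, \<one>\<^bsub>VG (tgt e)\<^esub>)])"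
    have x: "x \<in> carrier (VG (tgt e))" using gseqs_closed e by blast
    have ex: "gseq_concat \<G> (tgt e) ?e (x, l) = (\<one>\<^bsub>VG (src e)\<^esub>, a # l)" using x a by simp
    have "gseq_concat \<G> u (g, []) (\<one>\<^bsub>VG (src e)\<^esub>, a # l) = (g, a # l)" using e by auto
    moreover have "(g, []) \<in> gseqs \<G> u u" using e by simp
    moreover have "(\<one>\<^bsub>VG (src e)\<^esub>, a # l) \<in> gseqs \<G> u v" using e a by auto
    ultimately have "cls (based_loop u v (g, a # l)) = cls (based_loop u u (g, [])) \<otimes>\<^bsub>PG\<^esub> cls (based_loop u v (\<one>\<^bsub>VG (src e)\<^esub>, a # l))"
      using based_loop_concat[of "(g, [])" u u "(\<one>\<^bsub>VG (src e)\<^esub>, a # l)" v] by (simp del: gseq_concat.simps)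
    also have "cls (based_loop u v (\<one>\<^bsub>VG (src e)\<^esub>, a # l)) = cls (based_loop (src e) (tgt e) ?e) \<otimes>\<^bsub>PG\<^esub> cls (based_loop (tgt e) v (x, l))"
      using based_loop_concat[OF edge_gseqs[OF e(1)] e(5)] ex e(3) by simp
    finally show ?case
      using vert[of u g] e Cons.IH[OF e(5)] subgroup.m_closed[OF sub]
        generate.incl[of "cls (based_loop (src e) (tgt e) ?e)" ?X PG]
      by (auto simp: pi1_generators_def)
  qed
  have "carrier PG \<subseteq> generate PG ?X"
  proof
    fix x assume "x \<in> carrier PG"
    then obtain g l where "(g, l) \<in> loops" "x = cls (g, l)" by (auto simp: carrier_pi1)
    then show "x \<in> generate PG ?X" using gen[of g l v0 v0] based_loop_base by simp
  qed
  then show ?thesis using fin car P.generate_incl[OF car] by (auto simp: finite_generating_set_def)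
qed

subsection \<open>Length and edges of an element\<close>

text \<open>Distances in the fundamental group are measured by \<open>gseq_length\<close>, the length that occurs in loose
  polynomial distortion. By subadditivity it is at most a multiple of the word length.\<close>

definition pi1_length :: "('v \<Rightarrow> 'a set) \<Rightarrow> ('a, 'e) gseq set \<Rightarrow> nat" where
  "pi1_length S x = (LEAST n. \<exists>s\<in>loops. cls s = x \<and> gseq_length \<G> S v0 s = n)"

lemma pi1_length_le: "s \<in> loops \<Longrightarrow> pi1_length S (cls s) \<le> gseq_length \<G> S v0 s"
  unfolding pi1_length_def by (rule Least_le) auto

lemma pi1_length_rep:
  assumes "x \<in> carrier PG"
  obtains s where "s \<in> loops" "cls s = x" "gseq_length \<G> S v0 s = pi1_length S x"
proof -
  have "\<exists>n. \<exists>s\<in>loops. cls s = x \<and> gseq_length \<G> S v0 s = n" using assms by (auto simp: carrier_pi1)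
  from LeastI_ex[OF this] show thesis using that unfolding pi1_length_def by auto
qed

lemma pi1_length_one: "pi1_length S \<one>\<^bsub>PG\<^esub> = 0"
proof -
  have "gseq_length \<G> S v0 triv = 0" using group.word_length_one[OF group_VG[OF v0]] by simp
  then show ?thesis using pi1_length_le[OF triv_loop, of S] by (simp add: one_pi1)
qed

lemma pi1_length_mult:
  assumes S: "vertex_generators S" and "x \<in> carrier PG" "y \<in> carrier PG"
  shows "pi1_length S (x \<otimes>\<^bsub>PG\<^esub> y) \<le> pi1_length S x + pi1_length S y"
proof -
  obtain s where s: "s \<in> loops" "cls s = x" "gseq_length \<G> S v0 s = pi1_length S x" using pi1_length_rep assms by metis
  obtain t where t: "t \<in> loops" "cls t = y" "gseq_length \<G> S v0 t = pi1_length S y" using pi1_length_rep assms by metis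
  have "pi1_length S (x \<otimes>\<^bsub>PG\<^esub> y) \<le> gseq_length \<G> S v0 (gseq_concat \<G> v0 s t)"
    using pi1_length_le[OF concat_gseqs[OF s(1) t(1)]] mult_pi1[OF s(1) t(1)] s t by simp
  then show ?thesis using gseq_length_concat[OF S s(1) t(1)] s t by simp
qed

definition pi1_edges :: "('a, 'e) gseq set \<Rightarrow> ('e \<times> 'a) list" where
  "pi1_edges x = edges v0 (SOME s. s \<in> x)"

lemma pi1_edges_cls: "s \<in> loops \<Longrightarrow> pi1_edges (cls s) = edges v0 s"
proof -
  assume "s \<in> loops"
  then have "s \<in> cls s" by (simp add: in_cls_iff)
  then have "(SOME t. t \<in> cls s) \<in> cls s" by (rule someI)
  then have "nf v0 s = nf v0 (SOME t. t \<in> cls s)" by (rule in_cls_iff[THEN iffD1, THEN conjunct2, THEN conjunct2])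
  then show ?thesis by (simp add: pi1_edges_def)
qed

lemma pi1_edges_mult:
  assumes "x \<in> carrier PG" "y \<in> carrier PG"
  obtains j k where "pi1_edges (x \<otimes>\<^bsub>PG\<^esub> y) = k @ drop j (pi1_edges y)" "j \<le> length (pi1_edges y)"
    "length k + j = length (pi1_edges x)"
proof -
  obtain s t where s: "s \<in> loops" "x = cls s" and t: "t \<in> loops" "y = cls t" using assms by (auto simp: carrier_pi1)
  then show thesis using edges_concat[OF s(1) t(1)] that mult_pi1[OF s(1) t(1)] pi1_edges_cls concat_gseqs by metis
qed

lemma length_pi1_edges_inv:
  assumes "x \<in> carrier PG" shows "length (pi1_edges (inv\<^bsub>PG\<^esub> x)) = length (pi1_edges x)"
  using assms length_edges_inv gseq_inv_gseqs by (auto simp: carrier_pi1 inv_pi1 pi1_edges_cls)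

lemma length_pi1_edges_le:
  assumes "x \<in> carrier PG" shows "length (pi1_edges x) \<le> pi1_length S x"
proof -
  obtain s where s: "s \<in> loops" "cls s = x" "gseq_length \<G> S v0 s = pi1_length S x" using pi1_length_rep assms by metis
  have "length (snd s) \<le> gseq_length \<G> S v0 s" by (cases s) simp
  then show ?thesis using length_edges_le[OF s(1)] s pi1_edges_cls[OF s(1)] by simp
qed

section \<open>Double cosets of vertex groups\<close>

text \<open>The sequence \<open>p\<^sup>-\<^sup>1 t q\<close> for \<open>t\<close> in the group at \<open>u\<close>.\<close>

definition bridge :: "'v \<Rightarrow> ('a, 'e) gseq \<Rightarrow> ('a, 'e) gseq \<Rightarrow> 'a \<Rightarrow> ('a, 'e) gseq" where
  "bridge u p q t = gseq_concat \<G> u (gseq_inv v0 p) (lmul u t q)"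

lemma lmul_gseqs: "q \<in> gseqs \<G> u v \<Longrightarrow> t \<in> carrier (VG u) \<Longrightarrow> lmul u t q \<in> gseqs \<G> u v"
proof (cases q)
  case (Pair g l)
  assume q: "q \<in> gseqs \<G> u v" and t: "t \<in> carrier (VG u)"
  then have "u \<in> Vs" "g \<in> carrier (VG u)" using gseqs_ends gseqs_closed Pair by blast+
  then have "t \<otimes>\<^bsub>VG u\<^esub> g \<in> carrier (VG u)" using t group_VG[of u] by (simp add: group.is_monoid monoid.m_closed)
  then show ?thesis using q Pair gseqs_change_head by (simp add: lmul_def)
qed

lemma act_lmul_gseq: "q \<in> gseqs \<G> u v \<Longrightarrow> t \<in> carrier (VG u) \<Longrightarrow> n \<in> normal_seqs v w \<Longrightarrow>
    act v (lmul u t q) n = lmul u t (act v q n)"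
  using act_lmul[of "fst q" "snd q" u v t n w] by (simp add: lmul_def)

lemma bridge:
  assumes p: "p \<in> gseqs \<G> u v0" and q: "q \<in> gseqs \<G> u v0" and t: "t \<in> carrier (VG u)"
  shows "bridge u p q t \<in> loops"
    "n \<in> normal_seqs v0 w \<Longrightarrow> act v0 (bridge u p q t) n = act u (gseq_inv v0 p) (lmul u t (act v0 q n))"
proof -
  have i: "gseq_inv v0 p \<in> gseqs \<G> v0 u" using p by (rule gseq_inv_gseqs)
  have l: "lmul u t q \<in> gseqs \<G> u v0" using q t by (rule lmul_gseqs)
  show "bridge u p q t \<in> loops" unfolding bridge_def using i l by (rule concat_gseqs)
  show "act v0 (bridge u p q t) n = act u (gseq_inv v0 p) (lmul u t (act v0 q n))" if n: "n \<in> normal_seqs v0 w"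
    unfolding bridge_def act_concat[OF i l n] act_lmul_gseq[OF q t n] ..
qed

lemma bridge_mult:
  assumes p: "p \<in> gseqs \<G> u v0" and q: "q \<in> gseqs \<G> u v0" and r: "r \<in> gseqs \<G> u v0"
    and s: "s \<in> carrier (VG u)" and t: "t \<in> carrier (VG u)"
  shows "cls (bridge u p q s) \<otimes>\<^bsub>PG\<^esub> cls (bridge u q r t) = cls (bridge u p r (s \<otimes>\<^bsub>VG u\<^esub> t))"
proof -
  have u: "u \<in> Vs" using gseqs_ends p by blast
  interpret group "VG u" using u by (rule group_VG)
  have n: "act v0 r triv \<in> normal_seqs u v0" using act_normal[OF r triv_normal] .
  have m: "lmul u t (act v0 r triv) \<in> normal_seqs u v0" using t n by (rule lmul_normal)
  have k: "act u (gseq_inv v0 q) (lmul u t (act v0 r triv)) \<in> normal_seqs v0 v0"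
    using act_normal[OF gseq_inv_gseqs[OF q] m] .
  have "nf v0 (gseq_concat \<G> v0 (bridge u p q s) (bridge u q r t)) = nf v0 (bridge u p r (s \<otimes>\<^bsub>VG u\<^esub> t))"
    unfolding nf_concat[OF bridge(1)[OF p q s] bridge(1)[OF q r t]]
    unfolding nf_def bridge(2)[OF q r t triv_normal] bridge(2)[OF p r m_closed[OF s t] triv_normal]
      bridge(2)[OF p q s k] act_inv(2)[OF q m] lmul_lmul[OF s t n] ..
  then show ?thesis
    using bridge(1)[OF p q s] bridge(1)[OF q r t] bridge(1)[OF p r m_closed[OF s t]]
    by (simp add: mult_pi1 cls_eq_iff concat_gseqs)
qed

lemma bridge_inj:
  assumes p: "p \<in> gseqs \<G> u v0" and q: "q \<in> gseqs \<G> u v0"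
  shows "inj_on (\<lambda>t. cls (bridge u p q t)) (carrier (VG u))"
proof (rule inj_onI)
  fix s t assume s: "s \<in> carrier (VG u)" and t: "t \<in> carrier (VG u)"
    and eq: "cls (bridge u p q s) = cls (bridge u p q t)"
  have u: "u \<in> Vs" using gseqs_ends p by blast
  interpret group "VG u" using u by (rule group_VG)
  have n: "act v0 q triv \<in> normal_seqs u v0" using act_normal[OF q triv_normal] .
  have "act u (gseq_inv v0 p) (lmul u s (act v0 q triv)) = act u (gseq_inv v0 p) (lmul u t (act v0 q triv))"
    using eq unfolding cls_eq_iff[OF bridge(1)[OF p q s] bridge(1)[OF p q t]]
    unfolding nf_def bridge(2)[OF p q s triv_normal] bridge(2)[OF p q t triv_normal] .
  from arg_cong[OF this, of "act v0 p"] have "lmul u s (act v0 q triv) = lmul u t (act v0 q triv)"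
    unfolding act_inv(2)[OF p lmul_normal[OF s n]] act_inv(2)[OF p lmul_normal[OF t n]] .
  then show "s = t" using s t normal_seqs_fst[OF n] by (simp add: lmul_def)
qed

text \<open>If \<open>s\<close> represents \<open>p\<^sup>-\<^sup>1 t q\<close>, then \<open>p s q\<^sup>-\<^sup>1\<close> is a loop that represents \<open>t\<close>.\<close>

lemma bridge_length:
  assumes S: "vertex_generators S"
    and p: "p \<in> gseqs \<G> u v0" and q: "q \<in> gseqs \<G> u v0" and t: "t \<in> carrier (VG u)"
    and s: "s \<in> loops" "cls s = cls (bridge u p q t)"
  shows "\<exists>c\<in>gseqs \<G> u u. (c, (t, [])) \<in> gseq_sim \<G> u u \<and>
    gseq_length \<G> S u c \<le> gseq_length \<G> S u p + gseq_length \<G> S v0 s + gseq_length \<G> S u q"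
proof
  let ?c = "gseq_concat \<G> v0 (gseq_concat \<G> v0 p s) (gseq_inv v0 q)"
  have u: "u \<in> Vs" using gseqs_ends p by blast
  interpret group "VG u" using u by (rule group_VG)
  have iq: "gseq_inv v0 q \<in> gseqs \<G> v0 u" using q by (rule gseq_inv_gseqs)
  have ps: "gseq_concat \<G> v0 p s \<in> gseqs \<G> u v0" using p s(1) by (rule concat_gseqs)
  show c: "?c \<in> gseqs \<G> u u" using ps iq by (rule concat_gseqs)
  let ?o = "(\<one>\<^bsub>VG u\<^esub>, [])"
  have 1: "?o \<in> normal_seqs u u" using u by (rule unit_normal)
  have n: "act u (gseq_inv v0 q) ?o \<in> normal_seqs v0 u" using act_normal[OF iq 1] .
  have "nf v0 s = nf v0 (bridge u p q t)" using s bridge(1)[OF p q t] by (simp add: cls_eq_iff)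
  then have "(s, bridge u p q t) \<in> gseq_sim \<G> v0 v0" using s(1) bridge(1)[OF p q t] by (simp add: gseq_sim_iff_nf)
  from act_sim[OF this n] have sb: "act v0 s (act u (gseq_inv v0 q) ?o) = act u (gseq_inv v0 p) (lmul u t ?o)"
    unfolding bridge(2)[OF p q t n] act_inv(2)[OF q 1] .
  have "nf u ?c = lmul u t ?o"
    unfolding nf_def act_concat[OF ps iq 1] act_concat[OF p s(1) n] sb act_inv(2)[OF p lmul_normal[OF t 1]] ..
  also have "\<dots> = nf u (t, [])" by (simp add: nf_def)
  finally have "(?c, (t, [])) \<in> gseq_sim \<G> u u" using c u t by (simp add: gseq_sim_iff_nf)
  moreover have "gseq_length \<G> S u ?c \<le> gseq_length \<G> S u p + gseq_length \<G> S v0 s + gseq_length \<G> S u q"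
    using gseq_length_concat[OF S ps iq] gseq_length_concat[OF S p s(1)] gseq_length_inv[OF S q] by simp
  ultimately show "(?c, (t, [])) \<in> gseq_sim \<G> u u \<and>
    gseq_length \<G> S u ?c \<le> gseq_length \<G> S u p + gseq_length \<G> S v0 s + gseq_length \<G> S u q" ..
qed

lemma split_gseq:
  assumes "(g, l) \<in> gseqs \<G> u w" "i \<le> length l"
  shows "\<exists>v n1 n2. n1 \<in> gseqs \<G> u v \<and> n2 \<in> gseqs \<G> v w \<and> length (snd n1) = i \<and> snd n2 = drop i l \<and>
    gseq_concat \<G> v n1 n2 = (g, l)"
  using assms
proof (induction i arbitrary: g l u)
  case 0
  have "u \<in> Vs" "g \<in> carrier (VG u)" using 0 gseqs_verts gseqs_closed by blast+
  moreover from this interpret group "VG u" by (simp add: group_VG)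
  have "(\<one>\<^bsub>VG u\<^esub>, l) \<in> gseqs \<G> u w" using 0 gseqs_change_head by blast
  ultimately show ?case by (intro exI[of _ u] exI[of _ "(g, [])"] exI[of _ "(\<one>\<^bsub>VG u\<^esub>, l)"]) simp
next
  case (Suc i)
  then obtain e x l' where l: "l = (e, x) # l'" by (cases l) auto
  then have e: "e \<in> Es" "src e = u" "g \<in> carrier (VG u)" "(x, l') \<in> gseqs \<G> (tgt e) w" "i \<le> length l'"
    using Suc.prems by auto
  obtain v n1 n2 where n: "n1 \<in> gseqs \<G> (tgt e) v" "n2 \<in> gseqs \<G> v w" "length (snd n1) = i"
    "snd n2 = drop i l'" "gseq_concat \<G> v n1 n2 = (x, l')"
    using Suc.IH[OF e(4,5)] by blast
  have "(g, (e, fst n1) # snd n1) \<in> gseqs \<G> u v" using e n by simp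
  moreover have "gseq_concat \<G> v (g, (e, fst n1) # snd n1) n2 = (g, l)"
    using n l by (simp add: concat_Cons del: gseq_concat.simps)
  ultimately show ?case using n l
    by (intro exI[of _ v] exI[of _ "(g, (e, fst n1) # snd n1)"] exI[of _ n2]) simp
qed

lemma normal_tail_drop: "normal_tail l \<Longrightarrow> normal_tail (drop i l)"
proof (induction l arbitrary: i)
  case (Cons a l)
  then show ?case by (cases a; cases i) auto
qed simp

lemma nf_inv_concat:
  assumes s: "s \<in> loops" and n1: "n1 \<in> gseqs \<G> v0 u" and n2: "n2 \<in> gseqs \<G> u v0"
    and eq: "nf v0 s = gseq_concat \<G> u n1 n2"
  shows "nf v0 (gseq_inv v0 s) = nf v0 (gseq_concat \<G> u (gseq_inv v0 n2) (gseq_inv u n1))"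
proof -
  have i1: "gseq_inv u n1 \<in> gseqs \<G> u v0" and i2: "gseq_inv v0 n2 \<in> gseqs \<G> v0 u"
    using gseq_inv_gseqs n1 n2 by auto
  let ?m = "act v0 (gseq_inv u n1) triv"
  have m: "?m \<in> normal_seqs u v0" using act_normal[OF i1 triv_normal] .
  let ?y = "act u (gseq_inv v0 n2) ?m"
  have y: "?y \<in> normal_seqs v0 v0" using act_normal[OF i2 m] .
  have "act v0 s ?y = triv"
    using act_nf[OF s y] unfolding eq act_concat[OF n1 n2 y] act_inv(2)[OF n2 m] act_inv(2)[OF n1 triv_normal] by simp
  then have "act v0 (gseq_inv v0 s) triv = ?y" using act_inv(1)[OF s y] by simp
  then show ?thesis unfolding nf_def act_concat[OF i2 i1 triv_normal] .
qed

text \<open>The normal form is cut after its first \<open>i\<close> edges. The second half \<open>n2\<close> is normal again, so its list is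
  read off directly. For the first half the inverse \<open>n2\<^sup>-\<^sup>1 n1\<^sup>-\<^sup>1\<close> is considered: counting edges shows
  that nothing cancels in this product, and therefore its list ends with the list of \<open>n1\<^sup>-\<^sup>1\<close>.\<close>

lemma split_loop:
  assumes s: "s \<in> loops" and i: "i \<le> length (edges v0 s)"
  obtains u n1 n2 where "n1 \<in> gseqs \<G> v0 u" "n2 \<in> gseqs \<G> u v0"
    "nf v0 s = gseq_concat \<G> u n1 n2"
    "edges v0 n2 = drop i (edges v0 s)"
    "edges v0 (gseq_inv u n1) = drop (length (edges v0 s) - i) (edges v0 (gseq_inv v0 s))"
proof -
  let ?k = "length (edges v0 s)"
  obtain g l where gl: "nf v0 s = (g, l)" by (cases "nf v0 s")
  have N: "(g, l) \<in> normal_seqs v0 v0" using nf_normal[OF s] gl by simp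
  then have G: "(g, l) \<in> loops" and nt: "normal_tail l" by (auto simp: normal_seqs_def)
  obtain u n1 n2 where n: "n1 \<in> gseqs \<G> v0 u" "n2 \<in> gseqs \<G> u v0" "length (snd n1) = i"
    "snd n2 = drop i l" "gseq_concat \<G> u n1 n2 = (g, l)"
    using split_gseq[OF G, of i] i gl by auto
  have "n2 \<in> normal_seqs u v0" using n nt normal_tail_drop by (simp add: normal_seqs_def)
  then have e2: "edges v0 n2 = drop i (edges v0 s)" using nf_of_normal n gl by simp
  have i1: "gseq_inv u n1 \<in> gseqs \<G> u v0" and i2: "gseq_inv v0 n2 \<in> gseqs \<G> v0 u"
    using gseq_inv_gseqs n by auto
  have "nf v0 (gseq_inv v0 s) = nf v0 (gseq_concat \<G> u (gseq_inv v0 n2) (gseq_inv u n1))"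
    using nf_inv_concat[OF s n(1,2)] gl n by simp
  moreover obtain j k where jk: "edges v0 (gseq_concat \<G> u (gseq_inv v0 n2) (gseq_inv u n1)) = k @ drop j (edges v0 (gseq_inv u n1))"
     "j \<le> length (edges v0 (gseq_inv u n1))" "length k + j = length (edges u (gseq_inv v0 n2))"
    by (rule edges_concat[OF i2 i1])
  ultimately have *: "edges v0 (gseq_inv v0 s) = k @ drop j (edges v0 (gseq_inv u n1))" by simp
  have k: "length k + j = ?k - i" using jk(3) length_edges_inv[OF n(2)] e2 by simp
  have "length (edges v0 (gseq_inv u n1)) \<le> i"
    using length_edges_le[OF n(1)] length_edges_inv[OF n(1)] n(3) by simp
  moreover have "length (edges v0 (gseq_inv v0 s)) = ?k" using length_edges_inv[OF s] .
  \<comment> \<open>both factors together have only \<open>i + (?k - i)\<close> edges, and all \<open>?k\<close> of them survive\<close>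
  ultimately have "j = 0" using arg_cong[OF *, of length] k jk(2) i by simp
  then have "edges v0 (gseq_inv u n1) = drop (?k - i) (edges v0 (gseq_inv v0 s))" using * k by simp
  then show thesis using that n e2 gl by simp
qed

text \<open>Let \<open>y\<close> be the vertex number \<open>i\<close> on the geodesic in the Bass--Serre tree from the base vertex \<open>x\<^sub>0\<close> to
  \<open>x x\<^sub>0\<close>. Then \<open>left_vertex i x\<close> names \<open>y\<close> and \<open>right_vertex i x\<close> names \<open>x\<^sup>-\<^sup>1 y\<close>, where the list of a
  sequence \<open>s\<close> from \<open>u\<close> to \<open>v0\<close> names the vertex \<open>s\<^sup>-\<^sup>1 G\<^sub>u\<close>.\<close>

definition right_vertex :: "nat \<Rightarrow> ('a, 'e) gseq set \<Rightarrow> ('e \<times> 'a) list" where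
  "right_vertex i x = drop i (pi1_edges x)"

definition left_vertex :: "nat \<Rightarrow> ('a, 'e) gseq set \<Rightarrow> ('e \<times> 'a) list" where
  "left_vertex i x = drop (length (pi1_edges x) - i) (pi1_edges (inv\<^bsub>PG\<^esub> x))"

text \<open>Cut \<open>x = n\<^sub>1 n\<^sub>2\<close> after \<open>i\<close> edges. The lists of \<open>n\<^sub>1\<^sup>-\<^sup>1\<close> and \<open>p\<close> agree, and so do those of \<open>n\<^sub>2\<close> and
  \<open>q\<close>; hence \<open>n\<^sub>1\<^sup>-\<^sup>1 = t\<^sub>1 p\<close> and \<open>n\<^sub>2 = t\<^sub>2 q\<close> with \<open>t\<^sub>1\<close>, \<open>t\<^sub>2\<close> in the vertex group, and
  \<open>x = p\<^sup>-\<^sup>1 t\<^sub>1\<^sup>-\<^sup>1 t\<^sub>2 q\<close>.\<close>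

lemma double_coset:
  assumes x: "x \<in> carrier PG" and i: "i \<le> length (pi1_edges x)"
    and p: "p \<in> gseqs \<G> u v0" "edges v0 p = left_vertex i x"
    and q: "q \<in> gseqs \<G> u' v0" "edges v0 q = right_vertex i x"
  shows "u' = u \<and> (\<exists>t\<in>carrier (VG u). x = cls (bridge u p q t))"
proof -
  obtain s where s: "s \<in> loops" "x = cls s" using x by (auto simp: carrier_pi1)
  have inl: "gseq_inv v0 s \<in> loops" using s gseq_inv_gseqs by blast
  have E: "pi1_edges x = edges v0 s" "pi1_edges (inv\<^bsub>PG\<^esub> x) = edges v0 (gseq_inv v0 s)"
    using s inl by (simp_all add: inv_pi1 pi1_edges_cls)
  have "i \<le> length (edges v0 s)" using i E by simp
  then obtain w n1 n2 where n: "n1 \<in> gseqs \<G> v0 w" "n2 \<in> gseqs \<G> w v0" "nf v0 s = gseq_concat \<G> w n1 n2"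
    "edges v0 n2 = edges v0 q" "edges v0 (gseq_inv w n1) = edges v0 p"
    using split_loop[OF s(1)] E p q unfolding left_vertex_def right_vertex_def by metis
  have i1: "gseq_inv w n1 \<in> gseqs \<G> w v0" using gseq_inv_gseqs[OF n(1)] .
  have wu: "w = u" "w = u'" using edges_determine_start[OF i1 p(1) n(5)] edges_determine_start[OF n(2) q(1) n(4)] by auto
  have uV: "u \<in> Vs" using gseqs_ends p by blast
  interpret group "VG u" using uV by (rule group_VG)
  note n = n[unfolded wu(1)] and i1 = i1[unfolded wu(1)] and q = q[folded wu(2), unfolded wu(1)]
  obtain t2 where t2: "t2 \<in> carrier (VG u)" "nf v0 n2 = lmul u t2 (nf v0 q)"
    using edges_eq_imp_translate[OF n(2) q(1) n(4)] by blast
  obtain t1 where t1: "t1 \<in> carrier (VG u)" "nf v0 (gseq_inv u n1) = lmul u t1 (nf v0 p)"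
    using edges_eq_imp_translate[OF i1 p(1) n(5)] by blast
  let ?t = "inv\<^bsub>VG u\<^esub> t1 \<otimes>\<^bsub>VG u\<^esub> t2"
  have it: "inv\<^bsub>VG u\<^esub> t1 \<in> carrier (VG u)" "?t \<in> carrier (VG u)" using t1 t2 by auto
  have q': "nf v0 q \<in> normal_seqs u v0" and p': "nf v0 p \<in> normal_seqs u v0" using nf_normal p q by auto
  let ?N = "lmul u t2 (nf v0 q)"
  have N: "?N \<in> normal_seqs u v0" using lmul_normal[OF t2(1) q'] .
  let ?Z = "act u n1 ?N"
  have Z: "?Z \<in> normal_seqs v0 v0" using act_normal[OF n(1) N] .
  have pZ: "act v0 p ?Z \<in> normal_seqs u v0" using act_normal[OF p(1) Z] .
  have "?N = act v0 (nf v0 (gseq_inv u n1)) ?Z"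
    using act_inv(1)[OF n(1) N] act_nf[OF i1 Z] by simp
  also have "\<dots> = lmul u t1 (act v0 p ?Z)"
    unfolding t1(2) act_lmul_gseq[OF normal_seqs_gseqs[OF p'] t1(1) Z] act_nf[OF p(1) Z] ..
  finally have "lmul u (inv\<^bsub>VG u\<^esub> t1) ?N = lmul u (inv\<^bsub>VG u\<^esub> t1) (lmul u t1 (act v0 p ?Z))" by simp
  then have "act v0 p ?Z = lmul u ?t (nf v0 q)"
    using lmul_lmul[OF it(1) t2(1) q'] lmul_lmul[OF it(1) t1(1) pZ] t1(1) lmul_one[OF pZ] by simp
  then have "?Z = act u (gseq_inv v0 p) (lmul u ?t (nf v0 q))" using act_inv(1)[OF p(1) Z] by simp
  also have "\<dots> = nf v0 (bridge u p q ?t)" using bridge(2)[OF p(1) q(1) it(2) triv_normal] by (simp add: nf_def)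
  finally have "nf v0 (bridge u p q ?t) = act u n1 (nf v0 n2)" using t2 by simp
  also have "\<dots> = nf v0 (gseq_concat \<G> u n1 n2)" using nf_concat[OF n(1,2)] by simp
  also have "\<dots> = nf v0 s" using nf_of_normal[OF nf_normal[OF s(1)]] n(3) by simp
  finally have "x = cls (bridge u p q ?t)" using s bridge(1)[OF p(1) q(1) it(2)] by (simp add: cls_eq_iff)
  then show ?thesis using it(2) wu by blast
qed

text \<open>A shortest sequence that represents \<open>x\<close>, or its inverse, has a final part whose list is the one
  of the vertex.\<close>

lemma short_vertex_paths:
  assumes S: "vertex_generators S" and x: "x \<in> carrier PG"
  shows "\<exists>u p. p \<in> gseqs \<G> u v0 \<and> edges v0 p = left_vertex i x \<and> gseq_length \<G> S u p \<le> pi1_length S x"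
    and "\<exists>u q. q \<in> gseqs \<G> u v0 \<and> edges v0 q = right_vertex i x \<and> gseq_length \<G> S u q \<le> pi1_length S x"
proof -
  obtain s where s: "s \<in> loops" "cls s = x" "gseq_length \<G> S v0 s = pi1_length S x" using pi1_length_rep x by metis
  have inl: "gseq_inv v0 s \<in> loops" using s gseq_inv_gseqs by blast
  have E: "pi1_edges x = edges v0 s" "pi1_edges (inv\<^bsub>PG\<^esub> x) = edges v0 (gseq_inv v0 s)"
    using s inl by (auto simp: inv_pi1 pi1_edges_cls)
  show "\<exists>u q. q \<in> gseqs \<G> u v0 \<and> edges v0 q = right_vertex i x \<and> gseq_length \<G> S u q \<le> pi1_length S x"
    using suffix_of_edges[OF s(1), of i S] s(3) E by (simp add: right_vertex_def)
  show "\<exists>u p. p \<in> gseqs \<G> u v0 \<and> edges v0 p = left_vertex i x \<and> gseq_length \<G> S u p \<le> pi1_length S x"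
    using suffix_of_edges[OF inl, of "length (pi1_edges x) - i" S] s(3) E gseq_length_inv[OF S s(1)]
    unfolding left_vertex_def by (metis le_trans)
qed

section \<open>Convolution bounds\<close>

text \<open>On a block the convolution is one in the group at \<open>u\<close>. The sequences \<open>sp\<close> and \<open>sq\<close> are short because
  they are found on a shortest representative of one element \<open>x0\<close> of the block; for every other element
  \<open>p\<^sup>-\<^sup>1 t q\<close> of the block the loop for \<open>t\<close> then has length at most \<open>R + R + R\<close>.\<close>

lemma block_bounded:
  assumes S: "vertex_generators S"
    and dist: "\<And>v g c. v \<in> Vs \<Longrightarrow> g \<in> carrier (VG v) \<Longrightarrow> c \<in> gseqs \<G> v v \<Longrightarrow> (c, (g, [])) \<in> gseq_sim \<G> v v \<Longrightarrow>
      gseq_length \<G> S v c \<le> 3 * R \<Longrightarrow> real (word_length (VG v) (S v) g) \<le> D"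
    and vert: "\<And>v. v \<in> Vs \<Longrightarrow> conv_bounded (VG v) {g \<in> carrier (VG v). real (word_length (VG v) (S v) g) \<le> D} (carrier (VG v)) M"
    and M: "0 \<le> M"
  shows "conv_bounded PG
    {x \<in> {x \<in> carrier PG. i \<le> length (pi1_edges x) \<and> pi1_length S x \<le> R}. left_vertex i x = p \<and> right_vertex i x = q}
    {y \<in> {y \<in> carrier PG. j \<le> length (pi1_edges y)}. left_vertex j y = q \<and> right_vertex j y = r} M"
    (is "conv_bounded PG ?X ?Y M")
proof (cases "?X = {} \<or> ?Y = {}")
  case True
  then show ?thesis using M by (rule conv_bounded_empty)
next
  case False
  then obtain x0 y0 where x0: "x0 \<in> ?X" and y0: "y0 \<in> ?Y" by blast
  obtain u sp where sp: "sp \<in> gseqs \<G> u v0" "edges v0 sp = p" "gseq_length \<G> S u sp \<le> R"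
    using short_vertex_paths(1)[OF S, of x0 i] x0 by force
  obtain u1 sq where sq1: "sq \<in> gseqs \<G> u1 v0" "edges v0 sq = q" "gseq_length \<G> S u1 sq \<le> R"
    using short_vertex_paths(2)[OF S, of x0 i] x0 by force
  obtain u2 sr where sr2: "sr \<in> gseqs \<G> u2 v0" "edges v0 sr = r"
    using short_vertex_paths(2)[OF S, of y0 j] y0 by force
  have u1: "u1 = u" using double_coset[of x0 i sp u sq u1] x0 sp sq1 by simp
  note sq = sq1[unfolded u1]
  have u2: "u2 = u" using double_coset[of y0 j sq u sr u2] y0 sq sr2 by simp
  note sr = sr2[unfolded u2]
  have u: "u \<in> Vs" using gseqs_ends sp by blast
  interpret group "VG u" using u by (rule group_VG)
  let ?B = "{g \<in> carrier (VG u). real (word_length (VG u) (S u) g) \<le> D}"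
  let ?i1 = "\<lambda>t. cls (bridge u sp sq t)" and ?i2 = "\<lambda>t. cls (bridge u sq sr t)" and ?i3 = "\<lambda>t. cls (bridge u sp sr t)"
  have "conv_bounded PG (?i1 ` ?B) (?i2 ` carrier (VG u)) M"
  proof (rule conv_bounded_transfer[OF vert[OF u] M])
    show "inj_on ?i1 ?B" using bridge_inj[OF sp(1) sq(1)] by (rule inj_on_subset) auto
    show "inj_on ?i2 (carrier (VG u))" using bridge_inj[OF sq(1) sr(1)] .
    show "inj_on ?i3 (carrier (VG u))" using bridge_inj[OF sp(1) sr(1)] .
  qed (use bridge_mult[OF sp(1) sq(1) sr(1)] in auto)
  moreover have "?X \<subseteq> ?i1 ` ?B"
  proof
    fix x assume x: "x \<in> ?X"
    then obtain t where t: "t \<in> carrier (VG u)" "x = ?i1 t"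
      using double_coset[of x i sp u sq u] sp sq by auto
    obtain s where s: "s \<in> loops" "cls s = x" "gseq_length \<G> S v0 s = pi1_length S x" using pi1_length_rep x by blast
    obtain c where c: "c \<in> gseqs \<G> u u" "(c, (t, [])) \<in> gseq_sim \<G> u u"
      "gseq_length \<G> S u c \<le> gseq_length \<G> S u sp + gseq_length \<G> S v0 s + gseq_length \<G> S u sq"
      using bridge_length[OF S sp(1) sq(1) t(1) s(1)] s t by blast
    then have "gseq_length \<G> S u c \<le> 3 * R" using sp(3) sq(3) s(3) x by auto
    then have "t \<in> ?B" using dist[OF u t(1) c(1,2)] t by simp
    then show "x \<in> ?i1 ` ?B" using t by blast
  qed
  moreover have "?Y \<subseteq> ?i2 ` carrier (VG u)"
  proof
    fix y assume y: "y \<in> ?Y"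
    then obtain t where "t \<in> carrier (VG u)" "y = ?i2 t"
      using double_coset[of y j sq u sr u] sq sr by auto
    then show "y \<in> ?i2 ` carrier (VG u)" by blast
  qed
  ultimately show ?thesis by (blast intro: conv_bounded_mono)
qed

text \<open>The centre of the tripod, with \<open>j\<close> the number of edges cancelled in \<open>a b\<close>. Each equation says that the
  lists of a product and of its right factor have a common suffix, for one of the products \<open>a b\<close>,
  \<open>b\<^sup>-\<^sup>1 a\<^sup>-\<^sup>1\<close> and \<open>(a b) b\<^sup>-\<^sup>1\<close>; comparing lengths expresses the numbers of cancelled edges in the
  latter two by \<open>j\<close>.\<close>

lemma matching_vertices:
  assumes a: "a \<in> carrier PG" and b: "b \<in> carrier PG"
  obtains j where "j \<le> length (pi1_edges a)" "j \<le> length (pi1_edges b)"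
    "length (pi1_edges (a \<otimes>\<^bsub>PG\<^esub> b)) + 2 * j = length (pi1_edges a) + length (pi1_edges b)"
    "right_vertex (length (pi1_edges a) - j) a = left_vertex j b"
    "left_vertex (length (pi1_edges a) - j) (a \<otimes>\<^bsub>PG\<^esub> b) = left_vertex (length (pi1_edges a) - j) a"
    "right_vertex (length (pi1_edges a) - j) (a \<otimes>\<^bsub>PG\<^esub> b) = right_vertex j b"
proof -
  interpret group PG by (rule group_pi1)
  let ?c = "a \<otimes>\<^bsub>PG\<^esub> b"
  have c: "?c \<in> carrier PG" using a b by simp
  have i: "inv\<^bsub>PG\<^esub> a \<in> carrier PG" "inv\<^bsub>PG\<^esub> b \<in> carrier PG" using a b by auto
  note len = length_pi1_edges_inv[OF a] length_pi1_edges_inv[OF b] length_pi1_edges_inv[OF c]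
  obtain j k where 1: "pi1_edges ?c = k @ drop j (pi1_edges b)" "j \<le> length (pi1_edges b)"
    "length k + j = length (pi1_edges a)" by (rule pi1_edges_mult[OF a b])
  have "inv\<^bsub>PG\<^esub> ?c = inv\<^bsub>PG\<^esub> b \<otimes>\<^bsub>PG\<^esub> inv\<^bsub>PG\<^esub> a" using a b by (rule inv_mult_group)
  then obtain j' k' where 2: "pi1_edges (inv\<^bsub>PG\<^esub> ?c) = k' @ drop j' (pi1_edges (inv\<^bsub>PG\<^esub> a))"
    "j' \<le> length (pi1_edges a)" "length k' + j' = length (pi1_edges b)"
    using pi1_edges_mult[OF i(2,1)] len by metis
  have "a = ?c \<otimes>\<^bsub>PG\<^esub> inv\<^bsub>PG\<^esub> b" using a b by (simp add: m_assoc)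
  then obtain j'' k'' where 3: "pi1_edges a = k'' @ drop j'' (pi1_edges (inv\<^bsub>PG\<^esub> b))"
    "j'' \<le> length (pi1_edges b)" "length k'' + j'' = length (pi1_edges ?c)"
    using pi1_edges_mult[OF c i(2)] len by metis
  have L1: "length (pi1_edges ?c) = length k + (length (pi1_edges b) - j)" using arg_cong[OF 1(1), of length] by simp
  have L2: "length (pi1_edges ?c) = length k' + (length (pi1_edges a) - j')" using arg_cong[OF 2(1), of length] len by simp
  have L3: "length (pi1_edges a) = length k'' + (length (pi1_edges b) - j'')" using arg_cong[OF 3(1), of length] len by simp
  have j': "j' = j" using L1 L2 1 2 by linarith
  have j'': "j'' = length (pi1_edges b) - j" "length k'' = length (pi1_edges a) - j" using L1 L3 1 3 by linarith+
  show thesis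
  proof
    show "j \<le> length (pi1_edges a)" "j \<le> length (pi1_edges b)" using 1 by auto
    show "length (pi1_edges ?c) + 2 * j = length (pi1_edges a) + length (pi1_edges b)" using L1 1 by linarith
    show "right_vertex (length (pi1_edges a) - j) a = left_vertex j b"
      unfolding right_vertex_def left_vertex_def using 3(1) j'' by simp
    have "length (pi1_edges ?c) - (length (pi1_edges a) - j) = length k'" using L1 1 2 j' by linarith
    moreover have "length (pi1_edges a) - (length (pi1_edges a) - j) = j" using 1 by simp
    ultimately show "left_vertex (length (pi1_edges a) - j) ?c = left_vertex (length (pi1_edges a) - j) a"
      unfolding left_vertex_def using 2(1) j' by simp
    have "length (pi1_edges a) - j = length k" using 1 by simp
    then show "right_vertex (length (pi1_edges a) - j) ?c = right_vertex j b"
      unfolding right_vertex_def using 1(1) by simp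
  qed
qed

text \<open>The pairs \<open>(a, b)\<close> are sorted by the edge-length \<open>k\<close> of \<open>a\<close> and the number \<open>j\<close> of cancelled edges. For
  fixed \<open>k\<close> and \<open>j\<close> the blocks given by the vertices match, and \<open>j \<le> k \<le> R\<close> leaves at most
  \<open>(R + 1)\<^sup>2\<close> cases.\<close>

lemma ball_bounded:
  assumes S: "vertex_generators S"
    and dist: "\<And>v g c. v \<in> Vs \<Longrightarrow> g \<in> carrier (VG v) \<Longrightarrow> c \<in> gseqs \<G> v v \<Longrightarrow> (c, (g, [])) \<in> gseq_sim \<G> v v \<Longrightarrow>
      gseq_length \<G> S v c \<le> 3 * R \<Longrightarrow> real (word_length (VG v) (S v) g) \<le> D"
    and vert: "\<And>v. v \<in> Vs \<Longrightarrow> conv_bounded (VG v) {g \<in> carrier (VG v). real (word_length (VG v) (S v) g) \<le> D} (carrier (VG v)) M"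
    and M: "0 \<le> M"
  shows "conv_bounded PG {x \<in> carrier PG. pi1_length S x \<le> R} (carrier PG) ((real R + 1)\<^sup>2 * M)"
proof (rule conv_boundedI)
  fix A B C T and f g h :: "('a, 'e) gseq set \<Rightarrow> real"
  assume A: "finite A" "A \<subseteq> {x \<in> carrier PG. pi1_length S x \<le> R}" and B: "finite B" "B \<subseteq> carrier PG"
    and C: "finite C" and T: "T \<subseteq> A \<times> B" and TC: "\<And>a b. (a, b) \<in> T \<Longrightarrow> a \<otimes>\<^bsub>PG\<^esub> b \<in> C"
    and pos: "\<And>x. 0 \<le> f x" "\<And>x. 0 \<le> g x" "\<And>x. 0 \<le> h x"
  let ?F = "\<lambda>(a, b). f a * g b * h (a \<otimes>\<^bsub>PG\<^esub> b)"
  let ?K = "M * (L2_set f A * L2_set g B * L2_set h C)"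
  let ?len = "\<lambda>x. length (pi1_edges x)"
  \<comment> \<open>each cancelled edge of \<open>a\<close> cancels against one of \<open>b\<close>\<close>
  let ?t = "\<lambda>(a, b). (?len a, (?len a + ?len b - ?len (a \<otimes>\<^bsub>PG\<^esub> b)) div 2)"
  have finT: "finite T" using A B T by (meson finite_SigmaI finite_subset)
  have range: "?t ` T \<subseteq> {..R} \<times> {..R}"
  proof
    fix z assume "z \<in> ?t ` T"
    then obtain a b where ab: "(a, b) \<in> T" "z = ?t (a, b)" by auto
    then have c: "a \<in> carrier PG" "b \<in> carrier PG" "?len a \<le> R"
      using T A B length_pi1_edges_le[of a S] by fastforce+
    obtain j where "j \<le> ?len a" "?len (a \<otimes>\<^bsub>PG\<^esub> b) + 2 * j = ?len a + ?len b" by (rule matching_vertices[OF c(1,2)])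
    then show "z \<in> {..R} \<times> {..R}" using ab c(3) by auto
  qed
  have block: "sum ?F {s \<in> T. ?t s = (k, j)} \<le> ?K" for k j
  proof -
    let ?T = "{s \<in> T. ?t s = (k, j)}"
    let ?A = "{a \<in> A. k - j \<le> ?len a}" and ?B = "{b \<in> B. j \<le> ?len b}"
    have *: "k - j \<le> ?len a \<and> j \<le> ?len b \<and> right_vertex (k - j) a = left_vertex j b \<and>
        left_vertex (k - j) (a \<otimes>\<^bsub>PG\<^esub> b) = left_vertex (k - j) a \<and>
        right_vertex (k - j) (a \<otimes>\<^bsub>PG\<^esub> b) = right_vertex j b" if "(a, b) \<in> ?T" for a b
    proof -
      have c: "a \<in> carrier PG" "b \<in> carrier PG" using that T A B by auto
      obtain j' where j': "j' \<le> ?len a" "j' \<le> ?len b" "?len (a \<otimes>\<^bsub>PG\<^esub> b) + 2 * j' = ?len a + ?len b"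
        "right_vertex (?len a - j') a = left_vertex j' b"
        "left_vertex (?len a - j') (a \<otimes>\<^bsub>PG\<^esub> b) = left_vertex (?len a - j') a"
        "right_vertex (?len a - j') (a \<otimes>\<^bsub>PG\<^esub> b) = right_vertex j' b"
        by (rule matching_vertices[OF c])
      have "k = ?len a" "j = j'" using that j'(3) by auto
      then show ?thesis using j' by simp
    qed
    have "sum ?F ?T \<le> M * (L2_set f ?A * L2_set g ?B * L2_set h C)"
    proof (rule conv_bounded_blocks[OF block_bounded[OF S dist vert M, where i = "k - j" and j = j] M])
      show "?A \<subseteq> {x \<in> carrier PG. k - j \<le> length (pi1_edges x) \<and> pi1_length S x \<le> R}" using A by auto
      show "?B \<subseteq> {y \<in> carrier PG. j \<le> length (pi1_edges y)}" using B by auto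
      show "?T \<subseteq> ?A \<times> ?B"
      proof
        fix s assume s: "s \<in> ?T"
        obtain a b where ab: "s = (a, b)" by (cases s)
        show "s \<in> ?A \<times> ?B" using *[of a b] s T unfolding ab by auto
      qed
      show "right_vertex (k - j) a = left_vertex j b" if "(a, b) \<in> ?T" for a b using *[OF that] by simp
      show "left_vertex (k - j) (a \<otimes>\<^bsub>PG\<^esub> b) = left_vertex (k - j) a" if "(a, b) \<in> ?T" for a b using *[OF that] by simp
      show "right_vertex (k - j) (a \<otimes>\<^bsub>PG\<^esub> b) = right_vertex j b" if "(a, b) \<in> ?T" for a b using *[OF that] by simp
    qed (use A B C TC pos in auto)
    also have "\<dots> \<le> ?K"
    proof -
      have "L2_set f ?A \<le> L2_set f A" "L2_set g ?B \<le> L2_set g B"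
        unfolding L2_set_def using A(1) B(1) by (auto intro!: sum_mono2)
      then show ?thesis using M by (intro mult_left_mono mult_mono) (auto intro!: mult_nonneg_nonneg)
    qed
    finally show ?thesis .
  qed
  have "sum ?F T = (\<Sum>z\<in>{..R} \<times> {..R}. sum ?F {s \<in> T. ?t s = z})"
    using finT range by (intro sum.group[symmetric]) auto
  also have "\<dots> \<le> (\<Sum>z\<in>{..R} \<times> {..R}. ?K)"
  proof (rule sum_mono)
    fix z :: "nat \<times> nat"
    show "sum ?F {s \<in> T. ?t s = z} \<le> ?K" using block[of "fst z" "snd z"] by simp
  qed
  also have "\<dots> = (real R + 1)\<^sup>2 * ?K"
    by (simp add: power2_eq_square algebra_simps)
  finally show "sum ?F T \<le> (real R + 1)\<^sup>2 * M * (L2_set f A * L2_set g B * L2_set h C)"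
    by (simp add: mult.assoc)
qed

end

theorem proposition1p3:
  fixes \<G> :: "('v, 'e, 'a, 'b) graph_of_groups" and v0 :: 'v
  assumes "graph_of_groups \<G>"
    and "loose_polynomial_distortion \<G>"
    and "\<And>v. v \<in> verts (base_graph \<G>) \<Longrightarrow> rapid_decay (vertex_group \<G> v)"
    and "v0 \<in> verts (base_graph \<G>)"
  shows "rapid_decay (pi1 \<G> v0)"
proof -
  interpret pointed_graph_of_groups \<G> v0
    using assms(1,4) by (simp add: pointed_graph_of_groups_def pointed_graph_of_groups_axioms_def)
  interpret P: group PG by (rule group_pi1)
  obtain S P where SP: "\<forall>v\<in>Vs. finite_generating_set (VG v) (S v)"
    "\<forall>v\<in>Vs. \<forall>g\<in>carrier (VG v). \<forall>s\<in>gseqs \<G> v v. (s, (g, [])) \<in> gseq_sim \<G> v v \<longrightarrow>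
        real (word_length (VG v) (S v) g) \<le> poly P (real (gseq_length \<G> S v s))"
    using assms(2) unfolding loose_polynomial_distortion_def by blast
  have S: "vertex_generators S" using SP(1) by (simp add: vertex_generators_def)
  note P = SP(2)[rule_format]
  obtain Q where Q: "poly_bound Q" "\<And>x. 0 \<le> x \<Longrightarrow> poly P x \<le> poly Q x" using poly_bound_exists by blast
  have "\<exists>p. \<forall>D\<ge>0. conv_bounded (VG v) {g \<in> carrier (VG v). real (word_length (VG v) (S v) g) \<le> D} (carrier (VG v)) (poly p D)"
    if "v \<in> Vs" for v
    using S that assms(3) by (intro rapid_decay_conv_bounded) (auto simp: vertex_generators_def)
  then have "\<forall>v\<in>Vs. \<exists>p. \<forall>D\<ge>0. conv_bounded (VG v) {g \<in> carrier (VG v). real (word_length (VG v) (S v) g) \<le> D} (carrier (VG v)) (poly p D)"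
    by blast
  from bchoice[OF this] obtain p where "\<forall>v\<in>Vs. \<forall>D\<ge>0. conv_bounded (VG v) {g \<in> carrier (VG v). real (word_length (VG v) (S v) g) \<le> D} (carrier (VG v)) (poly (p v) D)" ..
  note p = this[rule_format]
  obtain U where U: "poly_bound U" "\<And>v x. v \<in> Vs \<Longrightarrow> 0 \<le> x \<Longrightarrow> poly (p v) x \<le> poly U x"
    using poly_bound_exists_uniform[OF finite_verts] by blast
  \<comment> \<open>the vertex groups decay at the rate \<open>U\<close>, at the radius that distortion assigns to loops of length \<open>3 R\<close>\<close>
  let ?W = "pcompose U (pcompose Q [:0, 3:])"
  have W: "poly_bound ?W" using U Q by (intro poly_bound_pcompose poly_bound_linear) auto
  have ball: "conv_bounded PG {x \<in> carrier PG. pi1_length S x \<le> R} (carrier PG) ((real R + 1)\<^sup>2 * poly ?W (real R))" for R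
  proof (rule ball_bounded[OF S])
    let ?D = "poly Q (3 * real R)"
    have D: "0 \<le> ?D" using Q by (intro poly_bound_nonneg) auto
    show "0 \<le> poly ?W (real R)" using W by (intro poly_bound_nonneg) auto
    show "conv_bounded (VG v) {g \<in> carrier (VG v). real (word_length (VG v) (S v) g) \<le> ?D} (carrier (VG v)) (poly ?W (real R))"
      if "v \<in> Vs" for v
      by (rule conv_bounded_mono[OF p[OF that D]]) (use U(2)[OF that D] in \<open>auto simp: poly_pcompose mult.commute\<close>)
    fix v g c
    assume *: "v \<in> Vs" "g \<in> carrier (VG v)" "c \<in> gseqs \<G> v v" "(c, (g, [])) \<in> gseq_sim \<G> v v"
      and len: "gseq_length \<G> S v c \<le> 3 * R"
    have "real (word_length (VG v) (S v) g) \<le> poly Q (real (gseq_length \<G> S v c))"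
      using P[OF *] Q(2)[of "real (gseq_length \<G> S v c)"] by simp
    also have "\<dots> \<le> ?D" using len by (intro poly_bound_mono[OF Q(1)]) auto
    finally show "real (word_length (VG v) (S v) g) \<le> ?D" .
  qed
  let ?X = "pi1_generators S"
  have X: "finite_generating_set PG ?X" using S by (rule finite_generating_set_pi1)
  obtain C where C: "\<And>x. x \<in> carrier PG \<Longrightarrow> pi1_length S x \<le> C * word_length PG ?X x"
    using P.length_function_bounded_by_word_length[OF X, of "pi1_length S", OF pi1_length_one pi1_length_mult[OF S]]
    by auto
  let ?V = "[:1, real C:] * [:1, real C:] * pcompose ?W [:0, real C:]"
  have V: "poly_bound ?V" by (intro poly_bound_mult poly_bound_pcompose[OF W] poly_bound_linear) auto
  have "l2_norm PG (convolution PG f g) \<le> poly ?V r * l2_norm PG f * l2_norm PG g"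
    if r: "0 < r" and f: "f \<in> pos_group_ring PG" and g: "g \<in> pos_group_ring PG"
      and supp: "{x. f x \<noteq> 0} \<subseteq> {x \<in> carrier PG. real (word_length PG ?X x) \<le> r}" for r f g
  proof -
    define R where "R = nat \<lfloor>real C * r\<rfloor>"
    have Cr: "0 \<le> real C * r" using r by simp
    have R: "real R \<le> real C * r" unfolding R_def using Cr by simp
    have sub: "{x \<in> carrier PG. real (word_length PG ?X x) \<le> r} \<subseteq> {x \<in> carrier PG. pi1_length S x \<le> R}"
    proof clarify
      fix x assume x: "x \<in> carrier PG" "real (word_length PG ?X x) \<le> r"
      have "real (pi1_length S x) \<le> real C * real (word_length PG ?X x)"
        using C[OF x(1)] by (metis of_nat_le_iff of_nat_mult)
      also have "\<dots> \<le> real C * r" using x(2) by (intro mult_left_mono) auto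
      finally show "pi1_length S x \<le> R" unfolding R_def by (simp add: le_nat_floor)
    qed
    have "(real R + 1)\<^sup>2 * poly ?W (real R) \<le> (1 + real C * r)\<^sup>2 * poly ?W (real C * r)"
      using R poly_bound_mono[OF W _ R] poly_bound_nonneg[OF W] Cr by (intro mult_mono power_mono) auto
    also have "\<dots> = poly ?V r" by (simp add: poly_pcompose power2_eq_square algebra_simps)
    finally have "conv_bounded PG {x \<in> carrier PG. real (word_length PG ?X x) \<le> r} (carrier PG) (poly ?V r)"
      using conv_bounded_mono[OF ball sub] by blast
    then show ?thesis using f g supp poly_bound_nonneg[OF V, of r] r
      by (intro l2_norm_bound_of_conv_bounded group_pi1) auto
  qed
  then show ?thesis unfolding rapid_decay_def using group_pi1 X by blast
qed

end
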